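(* Let $\mathbb{T}=(\Sigma,E)$ be a cartesian theory, let $\mathbb{T}^+=(\Sigma,\,E\uplus E^{op}\uplus I_{OLCH})$ be the associated Frobenius theory, and let $\mathbf{C}$ be a cartesian bicategory of relations. Then the category of Frobenius models of $\mathbb{T}^+$ in $\mathbf{C}$ is isomorphic to the category of cartesian models of $\mathbb{T}$ in the category $\mathsf{Map}(\mathbf{C})$ of maps of $\mathbf{C}$: $$\mathsf{Mod_{FROB}}(\mathbb{T}^+,\mathbf{C})\;\cong\;\mathsf{Mod_{CAR}}(\mathbb{T},\mathsf{Map}(\mathbf{C})).$$
   Context: Composition is written in diagrammatic order, $f;g$ meaning first $f$ then $g$; coherence isomorphisms of monoidal categories are suppressed (treat monoidal categories as strict, and monoidal functors as preserving the monoidal structure strictly, so that a model is determined by the image of $1$ and of the generators). **Props.** A prop is a symmetric strict monoidal category with objects the natural numbers and $m\oplus n=m+n$ on objects. An ordered prop is a prop whose homsets are posets, with $;$ and $\oplus$ monotone. A signature $\Sigma$ is a set of generators $o:n\to m$; $\Sigma$-terms are built from generators, $\mathrm{id}_0$, $\mathrm{id}_1$ and the symmetry $\sigma_{1,1}:2\to 2$ by $;$ and $\oplus$. The prop freely generated by $(\Sigma,E)$ ($E$ a set of pairs of terms of equal type) has as arrows terms modulo the laws of symmetric strict monoidal categories and the congruence generated by $E$. The ordered prop freely generated by $(\Sigma,I)$, $I$ a set of inequations $t\le t'$, has as arrows $\Sigma$-terms (modulo the laws of symmetric strict monoidal categories), preordered by the smallest preorder containing $I$ that is preserved by $;$ and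 $\oplus$, and then quotiented by the equivalence induced by the preorder. An equation stands for two inequations; $E^{op}$ is the set of reversed pairs of $E$. **Comonoid and monoid.** Let $\Delta:1\to2$, $!:1\to0$, $\nabla:2\to1$, $?:0\to1$ be generators. Put $\Delta_0=\mathrm{id}_0$, $\Delta_{n+1}=(\Delta\oplus\Delta_n);(\mathrm{id}_1\oplus\sigma_{1,n}\oplus\mathrm{id}_n)$, $!_0=\mathrm{id}_0$, $!_{n+1}=!\oplus!_n$, and dually $\nabla_n$, $?_n$. **Cartesian theories.** A cartesian theory $\mathbb{T}=(\Sigma,E)$ consists of a signature $\Sigma$ of generators $o:n\to1$ and a set $E$ of pairs $(t,t':n\to1)$ of arrows of the prop freely generated by $\Sigma\uplus\{\Delta,!\}$ subject to: $(\Delta,!)$ is a commutative comonoid, and $o;\Delta=\Delta_n;(o\oplus o)$, $o;!=!_n$ for each $o:n\to1$ in $\Sigma$. $\mathcal{L}_{\mathbb{T}}$ is the prop freely generated by the same data with the additional equations $E$. For a cartesian category $\mathbf{D}$ (symmetric monoidal, with monoidal product the categorical product), $\mathsf{Mod_{CAR}}(\mathbb{T},\mathbf{D})$ is the category of product-preserving functors $\mathcal{L}_{\mathbb{T}}\to\mathbf{D}$ and monoidal natural transformations. **Cartesian bicategories of relations.** A cartesian bicategory of relations is a poset-enriched symmetric monoidal category $(\mathbf{C},\oplus,I)$ with, for every object $n$, a cocommutative comonoid $\Delta_n:n\to n\oplus n$, $!_n:n\to I$ and a commutative monoid $\nabla_n:n\oplus n\to n$, $?_n:I\to n$, compatible with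 $\oplus$ (i.e. $\Delta_{m\oplus n}=(\Delta_m\oplus\Delta_n);(\mathrm{id}\oplus\sigma_{m,n}\oplus\mathrm{id})$, $!_{m\oplus n}=!_m\oplus!_n$, and dually), such that $\nabla_n;\Delta_n\le\mathrm{id}_{n\oplus n}$, $\mathrm{id}_n\le\Delta_n;\nabla_n$, $?_n;!_n\le\mathrm{id}_I$, $\mathrm{id}_n\le!_n;?_n$, $(\Delta_n\oplus\mathrm{id}_n);(\mathrm{id}_n\oplus\nabla_n)=\nabla_n;\Delta_n=(\mathrm{id}_n\oplus\Delta_n);(\nabla_n\oplus\mathrm{id}_n)$, and every arrow $R:m\to n$ satisfies $R;\Delta_n\le\Delta_m;(R\oplus R)$ and $R;!_n\le!_m$. A cartesian bifunctor is a poset-enriched symmetric monoidal functor preserving $\Delta_n$ and $!_n$ (hence also $\nabla_n,?_n$). A map is an arrow $R:m\to n$ with $R;\Delta_n=\Delta_m;(R\oplus R)$ and $R;!_n=!_m$. $\mathsf{Map}(\mathbf{C})$ is the subcategory of $\mathbf{C}$ with all objects and the maps as arrows; it is a cartesian category with product $\oplus$. **Frobenius theories.** A Frobenius theory $(\Sigma,I)$ is a signature $\Sigma$ (generators of arbitrary arity and coarity) with a set $I$ of inequations between arrows of the ordered prop freely generated by $\Sigma\uplus\{\Delta,!,\nabla,?\}$ subject to: $I_{CW}$ ($(\Delta,!)$ is a commutative comonoid, $(\nabla,?)$ is a commutative monoid, and the displayed inequations relating $\Delta,!,\nabla,?$ above hold for $n=1$) and $I_{LCH}$ ($o;\Delta_m\le\Delta_n;(o\oplus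 o)$ and $o;!_m\le!_n$ for each $o:n\to m$ in $\Sigma$). $\mathcal{F}_{(\Sigma,I)}$ is the ordered prop freely generated by the same data with the additional inequations $I$; it is a cartesian bicategory of relations. For a cartesian bicategory of relations $\mathbf{C}$, $\mathsf{Mod_{FROB}}((\Sigma,I),\mathbf{C})$ has as objects the cartesian bifunctors $F:\mathcal{F}_{(\Sigma,I)}\to\mathbf{C}$ and as morphisms $F\to G$ families of arrows $\alpha_n:Fn\to Gn$ of $\mathbf{C}$ ($n\in\mathbb{N}$) with $Ff;\alpha_m\le\alpha_n;Gf$ for all $f:n\to m$, $\alpha_{n+m}=\alpha_n\oplus\alpha_m$ and $\alpha_0=\mathrm{id}$. **The theory $\mathbb{T}^+$.** For a cartesian theory $\mathbb{T}=(\Sigma,E)$, $I_{OLCH}$ consists of $!_n\le o;!$ and $\Delta_n;(o\oplus o)\le o;\Delta$ for each generator $o:n\to1$ in $\Sigma$. *)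

theory Defs
  imports Main "HOL-Library.FuncSet"
begin

section \<open>Categories\<close>

text \<open>
  Composition is in diagrammatic order. Every arrow determines its source and target. Structure
  maps are only constrained on the carriers \<open>obj C\<close> and \<open>arr C\<close>; on the monoidal level,
  \<open>\<odot>\<close> is the product of objects and \<open>\<oplus>\<close> that of arrows.
\<close>

record ('o, 'a) cat =
  obj :: "'o set"
  arr :: "'a set"
  src :: "'a \<Rightarrow> 'o"
  tgt :: "'a \<Rightarrow> 'o"
  ident :: "'o \<Rightarrow> 'a"
  cmp :: "'a \<Rightarrow> 'a \<Rightarrow> 'a"  (infixl \<open>\<Zsemi>\<index>\<close> 65)

record ('o, 'a) smcat = "('o, 'a) cat" +
  unit_obj :: "'o"
  tensor_obj :: "'o \<Rightarrow> 'o \<Rightarrow> 'o"  (infixl \<open>\<odot>\<index>\<close> 70)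
  tensor :: "'a \<Rightarrow> 'a \<Rightarrow> 'a"  (infixl \<open>\<oplus>\<index>\<close> 70)
  symm :: "'o \<Rightarrow> 'o \<Rightarrow> 'a"

record ('o, 'a) cbicat = "('o, 'a) smcat" +
  leq :: "'a \<Rightarrow> 'a \<Rightarrow> bool"  (infix \<open>\<sqsubseteq>\<index>\<close> 50)
  copy :: "'o \<Rightarrow> 'a"
  discard :: "'o \<Rightarrow> 'a"
  merge :: "'o \<Rightarrow> 'a"
  create :: "'o \<Rightarrow> 'a"

definition hom :: "('o, 'a, 'm) cat_scheme \<Rightarrow> 'o \<Rightarrow> 'o \<Rightarrow> 'a set" where
  "hom C x y = {f \<in> arr C. src C f = x \<and> tgt C f = y}"

locale category =
  fixes C :: "('o, 'a, 'm) cat_scheme" (structure)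
  assumes src_obj: "f \<in> arr C \<Longrightarrow> src C f \<in> obj C"
    and tgt_obj: "f \<in> arr C \<Longrightarrow> tgt C f \<in> obj C"
    and ident_hom: "x \<in> obj C \<Longrightarrow> ident C x \<in> hom C x x"
    and cmp_hom: "f \<in> hom C x y \<Longrightarrow> g \<in> hom C y z \<Longrightarrow> f \<Zsemi> g \<in> hom C x z"
    and cmp_assoc: "f \<in> hom C w x \<Longrightarrow> g \<in> hom C x y \<Longrightarrow> h \<in> hom C y z \<Longrightarrow>
      (f \<Zsemi> g) \<Zsemi> h = f \<Zsemi> (g \<Zsemi> h)"
    and ident_cmp: "f \<in> hom C x y \<Longrightarrow> ident C x \<Zsemi> f = f"
    and cmp_ident: "f \<in> hom C x y \<Longrightarrow> f \<Zsemi> ident C y = f"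

locale symmetric_strict_monoidal_category = category +
  assumes unit_obj: "unit_obj C \<in> obj C"
    and tensor_obj: "x \<in> obj C \<Longrightarrow> y \<in> obj C \<Longrightarrow> x \<odot> y \<in> obj C"
    and tensor_obj_assoc: "x \<in> obj C \<Longrightarrow> y \<in> obj C \<Longrightarrow> z \<in> obj C \<Longrightarrow>
      (x \<odot> y) \<odot> z = x \<odot> (y \<odot> z)"
    and unit_tensor_obj: "x \<in> obj C \<Longrightarrow> unit_obj C \<odot> x = x"
    and tensor_obj_unit: "x \<in> obj C \<Longrightarrow> x \<odot> unit_obj C = x"
    and tensor_hom: "f \<in> hom C x y \<Longrightarrow> g \<in> hom C x' y' \<Longrightarrow>
      f \<oplus> g \<in> hom C (x \<odot> x') (y \<odot> y')"
    and tensor_ident: "x \<in> obj C \<Longrightarrow> y \<in> obj C \<Longrightarrow>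
      ident C x \<oplus> ident C y = ident C (x \<odot> y)"
    and interchange: "f \<in> hom C x y \<Longrightarrow> g \<in> hom C y z \<Longrightarrow>
      f' \<in> hom C x' y' \<Longrightarrow> g' \<in> hom C y' z' \<Longrightarrow>
      (f \<Zsemi> g) \<oplus> (f' \<Zsemi> g') = (f \<oplus> f') \<Zsemi> (g \<oplus> g')"
    and tensor_assoc: "f \<in> arr C \<Longrightarrow> g \<in> arr C \<Longrightarrow> h \<in> arr C \<Longrightarrow>
      (f \<oplus> g) \<oplus> h = f \<oplus> (g \<oplus> h)"
    and unit_tensor: "f \<in> arr C \<Longrightarrow> ident C (unit_obj C) \<oplus> f = f"
    and tensor_unit: "f \<in> arr C \<Longrightarrow> f \<oplus> ident C (unit_obj C) = f"
    and symm_hom: "x \<in> obj C \<Longrightarrow> y \<in> obj C \<Longrightarrow> symm C x y \<in> hom C (x \<odot> y) (y \<odot> x)"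
    and symm_natural: "f \<in> hom C x y \<Longrightarrow> f' \<in> hom C x' y' \<Longrightarrow>
      (f \<oplus> f') \<Zsemi> symm C y y' = symm C x x' \<Zsemi> (f' \<oplus> f)"
    and symm_symm: "x \<in> obj C \<Longrightarrow> y \<in> obj C \<Longrightarrow>
      symm C x y \<Zsemi> symm C y x = ident C (x \<odot> y)"
    and symm_hexagon: "x \<in> obj C \<Longrightarrow> y \<in> obj C \<Longrightarrow> z \<in> obj C \<Longrightarrow>
      symm C x (y \<odot> z) = (symm C x y \<oplus> ident C z) \<Zsemi> (ident C y \<oplus> symm C x z)"

locale poset_enriched_smc = symmetric_strict_monoidal_category C
  for C :: "('o, 'a, 'm) cbicat_scheme" (structure) +
  assumes leq_refl: "f \<in> hom C x y \<Longrightarrow> f \<sqsubseteq> f"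
    and leq_trans: "f \<in> hom C x y \<Longrightarrow> g \<in> hom C x y \<Longrightarrow> h \<in> hom C x y \<Longrightarrow>
      f \<sqsubseteq> g \<Longrightarrow> g \<sqsubseteq> h \<Longrightarrow> f \<sqsubseteq> h"
    and leq_antisym: "f \<in> hom C x y \<Longrightarrow> g \<in> hom C x y \<Longrightarrow> f \<sqsubseteq> g \<Longrightarrow> g \<sqsubseteq> f \<Longrightarrow> f = g"
    and cmp_mono: "f \<in> hom C x y \<Longrightarrow> f' \<in> hom C x y \<Longrightarrow>
      g \<in> hom C y z \<Longrightarrow> g' \<in> hom C y z \<Longrightarrow>
      f \<sqsubseteq> f' \<Longrightarrow> g \<sqsubseteq> g' \<Longrightarrow> f \<Zsemi> g \<sqsubseteq> f' \<Zsemi> g'"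
    and tensor_mono: "f \<in> hom C x y \<Longrightarrow> f' \<in> hom C x y \<Longrightarrow>
      g \<in> hom C z w \<Longrightarrow> g' \<in> hom C z w \<Longrightarrow>
      f \<sqsubseteq> f' \<Longrightarrow> g \<sqsubseteq> g' \<Longrightarrow> f \<oplus> g \<sqsubseteq> f' \<oplus> g'"

text \<open>Cartesian bicategories of relations; the order \<open>leq\<close> matters only within homsets.\<close>

locale cartesian_bicategory = poset_enriched_smc +
  assumes copy_hom: "x \<in> obj C \<Longrightarrow> copy C x \<in> hom C x (x \<odot> x)"
    and discard_hom: "x \<in> obj C \<Longrightarrow> discard C x \<in> hom C x (unit_obj C)"
    and merge_hom: "x \<in> obj C \<Longrightarrow> merge C x \<in> hom C (x \<odot> x) x"
    and create_hom: "x \<in> obj C \<Longrightarrow> create C x \<in> hom C (unit_obj C) x"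
    and copy_assoc: "x \<in> obj C \<Longrightarrow>
      copy C x \<Zsemi> (copy C x \<oplus> ident C x) = copy C x \<Zsemi> (ident C x \<oplus> copy C x)"
    and copy_unit_left: "x \<in> obj C \<Longrightarrow> copy C x \<Zsemi> (discard C x \<oplus> ident C x) = ident C x"
    and copy_unit_right: "x \<in> obj C \<Longrightarrow> copy C x \<Zsemi> (ident C x \<oplus> discard C x) = ident C x"
    and copy_comm: "x \<in> obj C \<Longrightarrow> copy C x \<Zsemi> symm C x x = copy C x"
    and merge_assoc: "x \<in> obj C \<Longrightarrow>
      (merge C x \<oplus> ident C x) \<Zsemi> merge C x = (ident C x \<oplus> merge C x) \<Zsemi> merge C x"
    and merge_unit_left: "x \<in> obj C \<Longrightarrow> (create C x \<oplus> ident C x) \<Zsemi> merge C x = ident C x"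
    and merge_unit_right: "x \<in> obj C \<Longrightarrow> (ident C x \<oplus> create C x) \<Zsemi> merge C x = ident C x"
    and merge_comm: "x \<in> obj C \<Longrightarrow> symm C x x \<Zsemi> merge C x = merge C x"
    and copy_tensor: "x \<in> obj C \<Longrightarrow> y \<in> obj C \<Longrightarrow> copy C (x \<odot> y) =
      (copy C x \<oplus> copy C y) \<Zsemi> (ident C x \<oplus> symm C x y \<oplus> ident C y)"
    and discard_tensor: "x \<in> obj C \<Longrightarrow> y \<in> obj C \<Longrightarrow>
      discard C (x \<odot> y) = discard C x \<oplus> discard C y"
    and merge_tensor: "x \<in> obj C \<Longrightarrow> y \<in> obj C \<Longrightarrow> merge C (x \<odot> y) =
      (ident C x \<oplus> symm C y x \<oplus> ident C y) \<Zsemi> (merge C x \<oplus> merge C y)"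
    and create_tensor: "x \<in> obj C \<Longrightarrow> y \<in> obj C \<Longrightarrow>
      create C (x \<odot> y) = create C x \<oplus> create C y"
    and merge_copy_le: "x \<in> obj C \<Longrightarrow> merge C x \<Zsemi> copy C x \<sqsubseteq> ident C (x \<odot> x)"
    and le_copy_merge: "x \<in> obj C \<Longrightarrow> ident C x \<sqsubseteq> copy C x \<Zsemi> merge C x"
    and create_discard_le: "x \<in> obj C \<Longrightarrow>
      create C x \<Zsemi> discard C x \<sqsubseteq> ident C (unit_obj C)"
    and le_discard_create: "x \<in> obj C \<Longrightarrow> ident C x \<sqsubseteq> discard C x \<Zsemi> create C x"
    and frobenius_left: "x \<in> obj C \<Longrightarrow>
      (copy C x \<oplus> ident C x) \<Zsemi> (ident C x \<oplus> merge C x) = merge C x \<Zsemi> copy C x"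
    and frobenius_right: "x \<in> obj C \<Longrightarrow>
      (ident C x \<oplus> copy C x) \<Zsemi> (merge C x \<oplus> ident C x) = merge C x \<Zsemi> copy C x"
    and lax_copy: "R \<in> hom C x y \<Longrightarrow> R \<Zsemi> copy C y \<sqsubseteq> copy C x \<Zsemi> (R \<oplus> R)"
    and lax_discard: "R \<in> hom C x y \<Longrightarrow> R \<Zsemi> discard C y \<sqsubseteq> discard C x"

definition is_map :: "('o, 'a, 'm) cbicat_scheme \<Rightarrow> 'a \<Rightarrow> bool" where
  "is_map C R \<longleftrightarrow> R \<in> arr C \<and>
    R \<Zsemi>\<^bsub>C\<^esub> copy C (tgt C R) = copy C (src C R) \<Zsemi>\<^bsub>C\<^esub> (R \<oplus>\<^bsub>C\<^esub> R) \<and>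
    R \<Zsemi>\<^bsub>C\<^esub> discard C (tgt C R) = discard C (src C R)"

definition Map :: "('o, 'a) cbicat \<Rightarrow> ('o, 'a) smcat" where
  "Map C = \<lparr>obj = obj C, arr = {R. is_map C R}, src = src C, tgt = tgt C,
    ident = ident C, cmp = cmp C, unit_obj = unit_obj C,
    tensor_obj = tensor_obj C, tensor = tensor C, symm = symm C\<rparr>"


section \<open>Functors and isomorphism of categories\<close>

record ('o, 'a, 'p, 'b) func =
  omap :: "'o \<Rightarrow> 'p"
  amap :: "'a \<Rightarrow> 'b"

text \<open>
  Extensionality makes equality of functors coincide with agreement on objects and arrows;
  the same device is used for families of arrows below.
\<close>

definition is_functor ::
  "('o, 'a, 'm) cat_scheme \<Rightarrow> ('p, 'b, 'n) cat_scheme \<Rightarrow> ('o, 'a, 'p, 'b) func \<Rightarrow> bool" where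
  "is_functor C D F \<longleftrightarrow>
    omap F \<in> extensional (obj C) \<and> amap F \<in> extensional (arr C) \<and>
    (\<forall>x\<in>obj C. omap F x \<in> obj D) \<and>
    (\<forall>x y. \<forall>f\<in>hom C x y. amap F f \<in> hom D (omap F x) (omap F y)) \<and>
    (\<forall>x\<in>obj C. amap F (ident C x) = ident D (omap F x)) \<and>
    (\<forall>x y z. \<forall>f\<in>hom C x y. \<forall>g\<in>hom C y z.
      amap F (f \<Zsemi>\<^bsub>C\<^esub> g) = amap F f \<Zsemi>\<^bsub>D\<^esub> amap F g)"

definition isomorphic_categories ::
  "('o, 'a, 'm) cat_scheme \<Rightarrow> ('p, 'b, 'n) cat_scheme \<Rightarrow> bool" where
  "isomorphic_categories A B \<longleftrightarrow> category A \<and> category B \<and>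
    (\<exists>F G. is_functor A B F \<and> is_functor B A G \<and>
      (\<forall>x\<in>obj A. omap G (omap F x) = x) \<and> (\<forall>f\<in>arr A. amap G (amap F f) = f) \<and>
      (\<forall>y\<in>obj B. omap F (omap G y) = y) \<and> (\<forall>g\<in>arr B. amap F (amap G g) = g))"

definition symmetric_strict_monoidal_functor ::
  "('o, 'a, 'm) smcat_scheme \<Rightarrow> ('p, 'b, 'n) smcat_scheme \<Rightarrow> ('o, 'a, 'p, 'b) func \<Rightarrow> bool" where
  "symmetric_strict_monoidal_functor C D F \<longleftrightarrow> is_functor C D F \<and>
    omap F (unit_obj C) = unit_obj D \<and>
    (\<forall>x\<in>obj C. \<forall>y\<in>obj C. omap F (x \<odot>\<^bsub>C\<^esub> y) = omap F x \<odot>\<^bsub>D\<^esub> omap F y) \<and>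
    (\<forall>f\<in>arr C. \<forall>g\<in>arr C. amap F (f \<oplus>\<^bsub>C\<^esub> g) = amap F f \<oplus>\<^bsub>D\<^esub> amap F g) \<and>
    (\<forall>x\<in>obj C. \<forall>y\<in>obj C. amap F (symm C x y) = symm D (omap F x) (omap F y))"

definition is_terminal :: "('o, 'a, 'm) cat_scheme \<Rightarrow> 'o \<Rightarrow> bool" where
  "is_terminal C t \<longleftrightarrow> t \<in> obj C \<and> (\<forall>x\<in>obj C. \<exists>!f. f \<in> hom C x t)"

definition is_product ::
  "('o, 'a, 'm) cat_scheme \<Rightarrow> 'o \<Rightarrow> 'o \<Rightarrow> 'o \<Rightarrow> 'a \<Rightarrow> 'a \<Rightarrow> bool" where
  "is_product C x y p u v \<longleftrightarrow>
    x \<in> obj C \<and> y \<in> obj C \<and> p \<in> obj C \<and> u \<in> hom C p x \<and> v \<in> hom C p y \<and>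
    (\<forall>z\<in>obj C. \<forall>f\<in>hom C z x. \<forall>g\<in>hom C z y.
      \<exists>!h. h \<in> hom C z p \<and> h \<Zsemi>\<^bsub>C\<^esub> u = f \<and> h \<Zsemi>\<^bsub>C\<^esub> v = g)"

definition preserves_finite_products ::
  "('o, 'a, 'm) cat_scheme \<Rightarrow> ('p, 'b, 'n) cat_scheme \<Rightarrow> ('o, 'a, 'p, 'b) func \<Rightarrow> bool" where
  "preserves_finite_products C D F \<longleftrightarrow>
    (\<forall>t. is_terminal C t \<longrightarrow> is_terminal D (omap F t)) \<and>
    (\<forall>x y p u v. is_product C x y p u v \<longrightarrow>
      is_product D (omap F x) (omap F y) (omap F p) (amap F u) (amap F v))"

text \<open>
  Monoidal structure is preserved strictly, so a product-preserving functor between cartesian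
  (strict monoidal) categories is a strict symmetric monoidal functor preserving finite products.
\<close>

definition product_preserving_functor ::
  "('o, 'a, 'm) smcat_scheme \<Rightarrow> ('p, 'b, 'n) smcat_scheme \<Rightarrow> ('o, 'a, 'p, 'b) func \<Rightarrow> bool" where
  "product_preserving_functor C D F \<longleftrightarrow>
    symmetric_strict_monoidal_functor C D F \<and> preserves_finite_products C D F"

definition cartesian_bifunctor ::
  "('o, 'a, 'm) cbicat_scheme \<Rightarrow> ('p, 'b, 'n) cbicat_scheme \<Rightarrow> ('o, 'a, 'p, 'b) func \<Rightarrow> bool" where
  "cartesian_bifunctor C D F \<longleftrightarrow> symmetric_strict_monoidal_functor C D F \<and>
    (\<forall>x y. \<forall>f\<in>hom C x y. \<forall>g\<in>hom C x y. f \<sqsubseteq>\<^bsub>C\<^esub> g \<longrightarrow> amap F f \<sqsubseteq>\<^bsub>D\<^esub> amap F g) \<and>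
    (\<forall>x\<in>obj C. amap F (copy C x) = copy D (omap F x)) \<and>
    (\<forall>x\<in>obj C. amap F (discard C x) = discard D (omap F x))"

definition monoidal_family ::
  "('o, 'a, 'm) smcat_scheme \<Rightarrow> ('p, 'b, 'n) smcat_scheme \<Rightarrow>
    ('o, 'a, 'p, 'b) func \<Rightarrow> ('o \<Rightarrow> 'b) \<Rightarrow> ('o, 'a, 'p, 'b) func \<Rightarrow> bool" where
  "monoidal_family C D F \<alpha> G \<longleftrightarrow> \<alpha> \<in> extensional (obj C) \<and>
    (\<forall>x\<in>obj C. \<alpha> x \<in> hom D (omap F x) (omap G x)) \<and>
    (\<forall>x\<in>obj C. \<forall>y\<in>obj C. \<alpha> (x \<odot>\<^bsub>C\<^esub> y) = \<alpha> x \<oplus>\<^bsub>D\<^esub> \<alpha> y) \<and>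
    \<alpha> (unit_obj C) = ident D (unit_obj D)"

definition monoidal_natural ::
  "('o, 'a, 'm) smcat_scheme \<Rightarrow> ('p, 'b, 'n) smcat_scheme \<Rightarrow>
    ('o, 'a, 'p, 'b) func \<Rightarrow> ('o \<Rightarrow> 'b) \<Rightarrow> ('o, 'a, 'p, 'b) func \<Rightarrow> bool" where
  "monoidal_natural C D F \<alpha> G \<longleftrightarrow> monoidal_family C D F \<alpha> G \<and>
    (\<forall>x y. \<forall>f\<in>hom C x y. amap F f \<Zsemi>\<^bsub>D\<^esub> \<alpha> y = \<alpha> x \<Zsemi>\<^bsub>D\<^esub> amap G f)"

definition monoidal_lax_natural ::
  "('o, 'a, 'm) smcat_scheme \<Rightarrow> ('p, 'b, 'n) cbicat_scheme \<Rightarrow>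
    ('o, 'a, 'p, 'b) func \<Rightarrow> ('o \<Rightarrow> 'b) \<Rightarrow> ('o, 'a, 'p, 'b) func \<Rightarrow> bool" where
  "monoidal_lax_natural C D F \<alpha> G \<longleftrightarrow> monoidal_family C D F \<alpha> G \<and>
    (\<forall>x y. \<forall>f\<in>hom C x y. amap F f \<Zsemi>\<^bsub>D\<^esub> \<alpha> y \<sqsubseteq>\<^bsub>D\<^esub> \<alpha> x \<Zsemi>\<^bsub>D\<^esub> amap G f)"

text \<open>
  The category of the functors \<open>F : C \<rightarrow> D\<close> satisfying \<open>P\<close>, an arrow \<open>F \<rightarrow> G\<close> being a
  family of arrows of \<open>D\<close> that satisfies \<open>N\<close>, tagged with its source and target.
\<close>

definition functor_category ::
  "('o, 'a, 'm) cat_scheme \<Rightarrow> ('p, 'b, 'n) cat_scheme \<Rightarrow>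
    (('o, 'a, 'p, 'b) func \<Rightarrow> bool) \<Rightarrow>
    (('o, 'a, 'p, 'b) func \<Rightarrow> ('o \<Rightarrow> 'b) \<Rightarrow> ('o, 'a, 'p, 'b) func \<Rightarrow> bool) \<Rightarrow>
    (('o, 'a, 'p, 'b) func,
     ('o, 'a, 'p, 'b) func \<times> ('o \<Rightarrow> 'b) \<times> ('o, 'a, 'p, 'b) func) cat" where
  "functor_category C D P N = \<lparr>
    obj = {F. P F},
    arr = {(F, \<alpha>, G). P F \<and> P G \<and> N F \<alpha> G},
    src = (\<lambda>(F, \<alpha>, G). F),
    tgt = (\<lambda>(F, \<alpha>, G). G),
    ident = (\<lambda>F. (F, \<lambda>x\<in>obj C. ident D (omap F x), F)),
    cmp = (\<lambda>(F, \<alpha>, G) (G', \<beta>, H). (F, \<lambda>x\<in>obj C. \<alpha> x \<Zsemi>\<^bsub>D\<^esub> \<beta> x, H))\<rparr>"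


section \<open>Terms and free props\<close>

record 'g signature =
  gens :: "'g set"
  arity :: "'g \<Rightarrow> nat"
  coarity :: "'g \<Rightarrow> nat"

datatype 'g trm =
    Gen 'g
  | Id0
  | Id1
  | Sym11
  | Seq "'g trm" "'g trm"  (infixl \<open>;;\<close> 65)
  | Par "'g trm" "'g trm"  (infixl \<open>\<parallel>\<close> 70)

inductive typed :: "'g signature \<Rightarrow> 'g trm \<Rightarrow> nat \<Rightarrow> nat \<Rightarrow> bool" for S where
  typed_Gen: "g \<in> gens S \<Longrightarrow> typed S (Gen g) (arity S g) (coarity S g)"
| typed_Id0: "typed S Id0 0 0"
| typed_Id1: "typed S Id1 1 1"
| typed_Sym11: "typed S Sym11 2 2"
| typed_Seq: "typed S t m n \<Longrightarrow> typed S u n p \<Longrightarrow> typed S (t ;; u) m p"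
| typed_Par: "typed S t m n \<Longrightarrow> typed S u p q \<Longrightarrow> typed S (t \<parallel> u) (m + p) (n + q)"

primrec idt :: "nat \<Rightarrow> 'g trm" where
  "idt 0 = Id0"
| "idt (Suc n) = Id1 \<parallel> idt n"

text \<open>\<open>sym1t n : 1 + n \<rightarrow> n + 1\<close> and \<open>symt m n : m + n \<rightarrow> n + m\<close> are the symmetries.\<close>

primrec sym1t :: "nat \<Rightarrow> 'g trm" where
  "sym1t 0 = Id1"
| "sym1t (Suc n) = (Sym11 \<parallel> idt n) ;; (Id1 \<parallel> sym1t n)"

primrec symt :: "nat \<Rightarrow> nat \<Rightarrow> 'g trm" where
  "symt 0 n = idt n"
| "symt (Suc m) n = (Id1 \<parallel> symt m n) ;; (sym1t n \<parallel> idt m)"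

text \<open>The laws of symmetric strict monoidal categories on terms.\<close>

inductive smc_law :: "'g signature \<Rightarrow> 'g trm \<Rightarrow> 'g trm \<Rightarrow> bool" for S where
  seq_assoc: "typed S s m n \<Longrightarrow> typed S t n p \<Longrightarrow> typed S u p q \<Longrightarrow>
    smc_law S ((s ;; t) ;; u) (s ;; (t ;; u))"
| id_seq: "typed S t m n \<Longrightarrow> smc_law S (idt m ;; t) t"
| seq_id: "typed S t m n \<Longrightarrow> smc_law S (t ;; idt n) t"
| par_assoc: "typed S s m n \<Longrightarrow> typed S t p q \<Longrightarrow> typed S u k l \<Longrightarrow>
    smc_law S ((s \<parallel> t) \<parallel> u) (s \<parallel> (t \<parallel> u))"
| id_par: "typed S t m n \<Longrightarrow> smc_law S (Id0 \<parallel> t) t"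
| par_id: "typed S t m n \<Longrightarrow> smc_law S (t \<parallel> Id0) t"
| par_seq: "typed S s m n \<Longrightarrow> typed S t n p \<Longrightarrow> typed S s' m' n' \<Longrightarrow> typed S t' n' p' \<Longrightarrow>
    smc_law S ((s ;; t) \<parallel> (s' ;; t')) ((s \<parallel> s') ;; (t \<parallel> t'))"
| sym_natural: "typed S s m n \<Longrightarrow> typed S t p q \<Longrightarrow>
    smc_law S ((s \<parallel> t) ;; symt n q) (symt m p ;; (t \<parallel> s))"
| sym_sym: "smc_law S (symt m n ;; symt n m) (idt (m + n))"
| sym_hexagon: "smc_law S (symt m (n + p)) ((symt m n \<parallel> idt p) ;; (idt n \<parallel> symt m p))"

inductive prop_eq :: "'g signature \<Rightarrow> ('g trm \<times> 'g trm) set \<Rightarrow> 'g trm \<Rightarrow> 'g trm \<Rightarrow> bool"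
  for S E where
  prop_eq_law: "smc_law S t u \<Longrightarrow> prop_eq S E t u"
| prop_eq_ax: "(t, u) \<in> E \<Longrightarrow> prop_eq S E t u"
| prop_eq_refl: "typed S t m n \<Longrightarrow> prop_eq S E t t"
| prop_eq_sym: "prop_eq S E t u \<Longrightarrow> prop_eq S E u t"
| prop_eq_trans: "prop_eq S E s t \<Longrightarrow> prop_eq S E t u \<Longrightarrow> prop_eq S E s u"
| prop_eq_Seq: "prop_eq S E t t' \<Longrightarrow> prop_eq S E u u' \<Longrightarrow>
    typed S t m n \<Longrightarrow> typed S u n p \<Longrightarrow> prop_eq S E (t ;; u) (t' ;; u')"
| prop_eq_Par: "prop_eq S E t t' \<Longrightarrow> prop_eq S E u u' \<Longrightarrow> prop_eq S E (t \<parallel> u) (t' \<parallel> u')"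

text \<open>
  The least preorder containing \<open>I\<close> and preserved by both compositions, on terms modulo the laws
  of symmetric strict monoidal categories (that is, containing \<open>prop_eq S {}\<close>).
\<close>

inductive prop_le :: "'g signature \<Rightarrow> ('g trm \<times> 'g trm) set \<Rightarrow> 'g trm \<Rightarrow> 'g trm \<Rightarrow> bool"
  for S I where
  prop_le_eq: "prop_eq S {} t u \<Longrightarrow> prop_le S I t u"
| prop_le_ax: "(t, u) \<in> I \<Longrightarrow> prop_le S I t u"
| prop_le_trans: "prop_le S I s t \<Longrightarrow> prop_le S I t u \<Longrightarrow> prop_le S I s u"
| prop_le_Seq: "prop_le S I t t' \<Longrightarrow> prop_le S I u u' \<Longrightarrow>
    typed S t m n \<Longrightarrow> typed S u n p \<Longrightarrow> prop_le S I (t ;; u) (t' ;; u')"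
| prop_le_Par: "prop_le S I t t' \<Longrightarrow> prop_le S I u u' \<Longrightarrow> prop_le S I (t \<parallel> u) (t' \<parallel> u')"

text \<open>An arrow of a free prop is an equivalence class of terms tagged with its source and target.\<close>

type_synonym 'g prop_arrow = "nat \<times> 'g trm set \<times> nat"

definition term_arrow ::
  "('g trm \<Rightarrow> 'g trm \<Rightarrow> bool) \<Rightarrow> nat \<Rightarrow> 'g trm \<Rightarrow> nat \<Rightarrow> 'g prop_arrow" where
  "term_arrow R m t n = (m, {u. R t u}, n)"

definition quotient_prop ::
  "'g signature \<Rightarrow> ('g trm \<Rightarrow> 'g trm \<Rightarrow> bool) \<Rightarrow> (nat, 'g prop_arrow) smcat" where
  "quotient_prop S R = \<lparr>
    obj = UNIV,
    arr = {term_arrow R m t n | m t n. typed S t m n},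
    src = (\<lambda>(m, A, n). m),
    tgt = (\<lambda>(m, A, n). n),
    ident = (\<lambda>n. term_arrow R n (idt n) n),
    cmp = (\<lambda>(m, A, n) (n', B, p). (m, {w. \<exists>t\<in>A. \<exists>u\<in>B. R (t ;; u) w}, p)),
    unit_obj = 0,
    tensor_obj = (+),
    tensor = (\<lambda>(m, A, n) (p, B, q). (m + p, {w. \<exists>t\<in>A. \<exists>u\<in>B. R (t \<parallel> u) w}, n + q)),
    symm = (\<lambda>m n. term_arrow R (m + n) (symt m n) (n + m))\<rparr>"

definition free_prop ::
  "'g signature \<Rightarrow> ('g trm \<times> 'g trm) set \<Rightarrow> (nat, 'g prop_arrow) smcat" where
  "free_prop S E = quotient_prop S (prop_eq S E)"


section \<open>Cartesian theories\<close>

datatype 's gen = Op 's | Copy | Discard | Merge | Create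

text \<open>The disjoint union of a signature with a subset \<open>X\<close> of \<open>{Copy, Discard, Merge, Create}\<close>.\<close>

definition extend_sig :: "'s gen set \<Rightarrow> 's signature \<Rightarrow> 's gen signature" where
  "extend_sig X S = \<lparr>
    gens = Op ` gens S \<union> X,
    arity = (\<lambda>g. case g of
      Op c \<Rightarrow> arity S c | Copy \<Rightarrow> 1 | Discard \<Rightarrow> 1 | Merge \<Rightarrow> 2 | Create \<Rightarrow> 0),
    coarity = (\<lambda>g. case g of
      Op c \<Rightarrow> coarity S c | Copy \<Rightarrow> 2 | Discard \<Rightarrow> 0 | Merge \<Rightarrow> 1 | Create \<Rightarrow> 1)\<rparr>"

primrec copyt :: "nat \<Rightarrow> 's gen trm" where
  "copyt 0 = Id0"
| "copyt (Suc n) = (Gen Copy \<parallel> copyt n) ;; (Id1 \<parallel> symt 1 n \<parallel> idt n)"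

primrec discardt :: "nat \<Rightarrow> 's gen trm" where
  "discardt 0 = Id0"
| "discardt (Suc n) = Gen Discard \<parallel> discardt n"

primrec merget :: "nat \<Rightarrow> 's gen trm" where
  "merget 0 = Id0"
| "merget (Suc n) = (Id1 \<parallel> symt n 1 \<parallel> idt n) ;; (Gen Merge \<parallel> merget n)"

primrec createt :: "nat \<Rightarrow> 's gen trm" where
  "createt 0 = Id0"
| "createt (Suc n) = Gen Create \<parallel> createt n"

definition comonoid_laws :: "('s gen trm \<times> 's gen trm) set" where
  "comonoid_laws = {
    (Gen Copy ;; (Gen Copy \<parallel> Id1), Gen Copy ;; (Id1 \<parallel> Gen Copy)),
    (Gen Copy ;; (Gen Discard \<parallel> Id1), Id1),
    (Gen Copy ;; (Id1 \<parallel> Gen Discard), Id1),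
    (Gen Copy ;; Sym11, Gen Copy)}"

definition monoid_laws :: "('s gen trm \<times> 's gen trm) set" where
  "monoid_laws = {
    ((Gen Merge \<parallel> Id1) ;; Gen Merge, (Id1 \<parallel> Gen Merge) ;; Gen Merge),
    ((Gen Create \<parallel> Id1) ;; Gen Merge, Id1),
    ((Id1 \<parallel> Gen Create) ;; Gen Merge, Id1),
    (Sym11 ;; Gen Merge, Gen Merge)}"

definition naturality_laws :: "'s signature \<Rightarrow> ('s gen trm \<times> 's gen trm) set" where
  "naturality_laws S =
    {(Gen (Op c) ;; Gen Copy, copyt (arity S c) ;; (Gen (Op c) \<parallel> Gen (Op c))) | c. c \<in> gens S} \<union>
    {(Gen (Op c) ;; Gen Discard, discardt (arity S c)) | c. c \<in> gens S}"

text \<open>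
  A theory is a signature with a set of pairs of terms, which represent arrows of the free
  (ordered) prop named in the definition of the kind of theory at hand; an arrow may be given by
  any of the terms representing it.
\<close>

type_synonym 's monoidal_theory = "'s signature \<times> ('s gen trm \<times> 's gen trm) set"

definition cartesian_theory :: "'s monoidal_theory \<Rightarrow> bool" where
  "cartesian_theory = (\<lambda>(S, E).
    (\<forall>c\<in>gens S. coarity S c = 1) \<and>
    (\<forall>(t, u)\<in>E. \<exists>n. typed (extend_sig {Copy, Discard} S) t n 1 \<and>
      typed (extend_sig {Copy, Discard} S) u n 1))"

definition cartesian_prop :: "'s monoidal_theory \<Rightarrow> (nat, 's gen prop_arrow) smcat" where
  "cartesian_prop = (\<lambda>(S, E).
    free_prop (extend_sig {Copy, Discard} S) (comonoid_laws \<union> naturality_laws S \<union> E))"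

definition Mod_CAR where
  "Mod_CAR T D = functor_category (cartesian_prop T) D
    (product_preserving_functor (cartesian_prop T) D)
    (monoidal_natural (cartesian_prop T) D)"


section \<open>Frobenius theories\<close>

definition CW_laws :: "('s gen trm \<times> 's gen trm) set" where
  "CW_laws =
    comonoid_laws \<union> comonoid_laws\<inverse> \<union> monoid_laws \<union> monoid_laws\<inverse> \<union>
    {(Gen Merge ;; Gen Copy, idt 2), (Id1, Gen Copy ;; Gen Merge),
     (Gen Create ;; Gen Discard, Id0), (Id1, Gen Discard ;; Gen Create)} \<union>
    (let frobenius = {
       ((Gen Copy \<parallel> Id1) ;; (Id1 \<parallel> Gen Merge), Gen Merge ;; Gen Copy),
       ((Id1 \<parallel> Gen Copy) ;; (Gen Merge \<parallel> Id1), Gen Merge ;; Gen Copy)}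
     in frobenius \<union> frobenius\<inverse>)"

definition LCH_laws :: "'s signature \<Rightarrow> ('s gen trm \<times> 's gen trm) set" where
  "LCH_laws S =
    {(Gen (Op c) ;; copyt (coarity S c), copyt (arity S c) ;; (Gen (Op c) \<parallel> Gen (Op c)))
      | c. c \<in> gens S} \<union>
    {(Gen (Op c) ;; discardt (coarity S c), discardt (arity S c)) | c. c \<in> gens S}"

definition OLCH_laws :: "'s signature \<Rightarrow> ('s gen trm \<times> 's gen trm) set" where
  "OLCH_laws S =
    {(discardt (arity S c), Gen (Op c) ;; Gen Discard) | c. c \<in> gens S} \<union>
    {(copyt (arity S c) ;; (Gen (Op c) \<parallel> Gen (Op c)), Gen (Op c) ;; Gen Copy) | c. c \<in> gens S}"

text \<open>In a Frobenius theory \<open>(S, I)\<close> a pair \<open>(t, u) \<in> I\<close> stands for the inequation \<open>t \<le> u\<close>.\<close>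

definition frobenius_theory :: "'s monoidal_theory \<Rightarrow> bool" where
  "frobenius_theory = (\<lambda>(S, I). \<forall>(t, u)\<in>I. \<exists>m n.
    typed (extend_sig {Copy, Discard, Merge, Create} S) t m n \<and>
    typed (extend_sig {Copy, Discard, Merge, Create} S) u m n)"

definition frobenius_prop :: "'s monoidal_theory \<Rightarrow> (nat, 's gen prop_arrow) cbicat" where
  "frobenius_prop = (\<lambda>(S, I).
    let S' = extend_sig {Copy, Discard, Merge, Create} S;
        le = prop_le S' (CW_laws \<union> LCH_laws S \<union> I);
        R = (\<lambda>t u. le t u \<and> le u t)
    in smcat.extend (quotient_prop S' R) (cbicat.fields
      (\<lambda>(m, A, n) (m', B, n'). m = m' \<and> n = n' \<and> (\<exists>t\<in>A. \<exists>u\<in>B. le t u))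
      (\<lambda>n. term_arrow R n (copyt n) (n + n))
      (\<lambda>n. term_arrow R n (discardt n) 0)
      (\<lambda>n. term_arrow R (n + n) (merget n) n)
      (\<lambda>n. term_arrow R 0 (createt n) n)))"

definition Mod_FROB where
  "Mod_FROB T C = functor_category (frobenius_prop T) C
    (cartesian_bifunctor (frobenius_prop T) C)
    (monoidal_lax_natural (frobenius_prop T) C)"

definition frobenius_of_cartesian :: "'s monoidal_theory \<Rightarrow> 's monoidal_theory" where
  "frobenius_of_cartesian = (\<lambda>(S, E). (S, E \<union> E\<inverse> \<union> OLCH_laws S))"

lemma extend_sig_simps [simp]:
  "gens (extend_sig X S) = Op ` gens S \<union> X"
  "arity (extend_sig X S) (Op c) = arity S c" "coarity (extend_sig X S) (Op c) = coarity S c"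
  "arity (extend_sig X S) Copy = 1" "coarity (extend_sig X S) Copy = 2"
  "arity (extend_sig X S) Discard = 1" "coarity (extend_sig X S) Discard = 0"
  "arity (extend_sig X S) Merge = 2" "coarity (extend_sig X S) Merge = 1"
  "arity (extend_sig X S) Create = 0" "coarity (extend_sig X S) Create = 1"
  by (simp_all add: extend_sig_def)

lemma typed_idt: "typed S (idt n) n n"
proof (induction n)
  case (Suc n)
  then show ?case using typed_Par[OF typed_Id1 Suc] by simp
qed (simp add: typed_Id0)

lemma typed_sym1t: "typed S (sym1t n) (1 + n) (n + 1)"
proof (induction n)
  case (Suc n)
  have "typed S (Sym11 \<parallel> idt n) (2 + n) (2 + n)"
    by (intro typed_Par typed_Sym11 typed_idt)
  moreover have "typed S (Id1 \<parallel> sym1t n) (1 + (1 + n)) (1 + (n + 1))"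
    by (intro typed_Par typed_Id1 Suc)
  ultimately show ?case using typed_Seq[of S _ "2 + n" "2 + n"] by simp
qed (simp add: typed_Id1[simplified])

lemma typed_symt: "typed S (symt m n) (m + n) (n + m)"
proof (induction m)
  case (Suc m)
  have "typed S (Id1 \<parallel> symt m n) (1 + (m + n)) (1 + (n + m))"
    by (intro typed_Par typed_Id1 Suc)
  moreover have "typed S (sym1t n \<parallel> idt m) (1 + n + m) (n + 1 + m)"
    by (intro typed_Par typed_sym1t typed_idt)
  ultimately show ?case by (auto intro: typed_Seq simp: ac_simps numeral_2_eq_2)
qed (simp add: typed_idt)

lemma typed_copyt:
  assumes "Copy \<in> X"
  shows "typed (extend_sig X S) (copyt n) n (n + n)"
proof (induction n)
  case (Suc n)
  have c: "typed (extend_sig X S) (Gen Copy) 1 2"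
    using typed_Gen[of Copy "extend_sig X S"] assms by simp
  have "typed (extend_sig X S) (Gen Copy \<parallel> copyt n) (1 + n) (2 + (n + n))"
    by (intro typed_Par c Suc)
  moreover have "typed (extend_sig X S) (Id1 \<parallel> symt 1 n \<parallel> idt n)
      (1 + (1 + n) + n) (1 + (n + 1) + n)"
    by (intro typed_Par typed_Id1 typed_symt typed_idt)
  ultimately show ?case by (auto intro: typed_Seq simp: ac_simps numeral_2_eq_2)
qed (simp add: typed_Id0)

lemma typed_discardt:
  assumes "Discard \<in> X"
  shows "typed (extend_sig X S) (discardt n) n 0"
proof (induction n)
  case (Suc n)
  have "typed (extend_sig X S) (Gen Discard) 1 0"
    using typed_Gen[of Discard "extend_sig X S"] assms by simp
  from typed_Par[OF this Suc] show ?case by simp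
qed (simp add: typed_Id0)

lemma typed_mono: "typed (extend_sig X S) t m n \<Longrightarrow> X \<subseteq> Y \<Longrightarrow> typed (extend_sig Y S) t m n"
proof (induction rule: typed.induct)
  case (typed_Gen g)
  have "arity (extend_sig Y S) = arity (extend_sig X S)"
    "coarity (extend_sig Y S) = coarity (extend_sig X S)"
    by (simp_all add: extend_sig_def)
  moreover have "g \<in> gens (extend_sig Y S)"
    using typed_Gen by auto
  ultimately show ?case using typed.typed_Gen[of g "extend_sig Y S"] by simp
qed (blast intro: typed.intros)+

lemma frobenius_theory_frobenius_of_cartesian:
  assumes "cartesian_theory T"
  shows "frobenius_theory (frobenius_of_cartesian T)"
proof -
  obtain S E where T: "T = (S, E)" by (cases T)
  let ?X = "{Copy, Discard, Merge, Create}"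
  let ?S = "extend_sig ?X S"
  have E: "\<exists>m n. typed ?S t m n \<and> typed ?S u m n" if "(t, u) \<in> E" for t u
    using assms that typed_mono[of "{Copy, Discard}" S _ _ _ ?X]
    unfolding T cartesian_theory_def by fastforce
  have copy: "typed ?S (Gen Copy) 1 2" and discard: "typed ?S (Gen Discard) 1 0"
    using typed_Gen[of Copy ?S] typed_Gen[of Discard ?S] by simp_all
  have "\<exists>m n. typed ?S t m n \<and> typed ?S u m n" if tu: "(t, u) \<in> OLCH_laws S" for t u
  proof -
    obtain c where c: "c \<in> gens S" and
      eq: "(t, u) = (discardt (arity S c), Gen (Op c) ;; Gen Discard) \<or>
        (t, u) = (copyt (arity S c) ;; (Gen (Op c) \<parallel> Gen (Op c)), Gen (Op c) ;; Gen Copy)"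
      using tu unfolding OLCH_laws_def by blast
    have op: "typed ?S (Gen (Op c)) (arity S c) 1"
      using typed_Gen[of "Op c" ?S] c assms unfolding T cartesian_theory_def by auto
    have "typed ?S (Gen (Op c) \<parallel> Gen (Op c)) (arity S c + arity S c) 2"
      using typed_Par[OF op op] by (simp add: numeral_2_eq_2)
    then show ?thesis
      using eq typed_Seq[OF op copy] typed_Seq[OF op discard] typed_Seq
        typed_copyt[of ?X S "arity S c"] typed_discardt[of ?X S "arity S c"] by blast
  qed
  with E show ?thesis
    unfolding T frobenius_theory_def frobenius_of_cartesian_def by fast
qed

end

(*
  Every arrow of C with a right adjoint is a map, and the order between parallel maps is
  discrete. In a Frobenius model of T+ the generators of T, copy and discard are maps, so all
  terms of T are, and the inequations of T+ between them become equations. Conversely merge and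
  create are the right adjoints of copy and discard, hence are determined by the cartesian part,
  and copy and discard are determined by the product structure of Map C. Both kinds of models
  therefore amount to the same interpretation of the generators of T by maps, and a functor out of
  either prop is evaluation of terms. A lax transformation has maps as components (by laxness at
  copy and discard), and is natural on maps because their order is discrete; conversely every
  arrow of C is lax with respect to merge and create.
*)

theory Submission
  imports Defs
begin

section \<open>Calculus in symmetric strict monoidal categories\<close>

text \<open>Three points shape the details. Arrows of both props are classes of terms, so no functor
  can be defined by recursion on arrows: it evaluates a chosen representative, and conversely every
  strict monoidal functor is recovered from its values on generators by induction on typed terms.
  The defined terms \<open>idt\<close>, \<open>symt\<close>, \<open>copyt\<close>,
  \<open>discardt\<close> agree with the generators \<open>Id1\<close>, \<open>Sym11\<close>,
  \<open>Copy\<close>, \<open>Discard\<close> only up to the congruence, which costs small bridging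
  lemmas. Next, \<open>product_preserving_functor\<close> speaks of every terminal object and every
  product cone of the syntactic prop, not only of the canonical cones on a sum. This is derived from
  strict monoidality by comparing a given cone with the canonical one. Finally, discreteness of the
  order between maps comes from the Frobenius law: it makes every object self-dual, so wires can be
  bent and the inequality reversed. Merge and create are determined because adjoints are unique in a
  poset-enriched category; copy and discard because the unit object of the category of maps is
  terminal and the counit laws fix a pairing.\<close>

lemma hom_iff: "f \<in> hom C x y \<longleftrightarrow> f \<in> arr C \<and> src C f = x \<and> tgt C f = y"
  by (auto simp: hom_def)

context category
begin

lemma arr_ident [simp]:
  assumes "x \<in> obj C"
  shows "ident C x \<in> arr C" "src C (ident C x) = x" "tgt C (ident C x) = x"
  using ident_hom[OF assms] by (auto simp: hom_iff)

lemma arr_cmp [simp]: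
  assumes "f \<in> arr C" "g \<in> arr C" "tgt C f = src C g"
  shows "f \<Zsemi> g \<in> arr C" "src C (f \<Zsemi> g) = src C f" "tgt C (f \<Zsemi> g) = tgt C g"
  using cmp_hom[of f "src C f" "tgt C f" g "tgt C g"] assms by (auto simp: hom_iff)

lemma arr_src_tgt [simp]:
  assumes "f \<in> arr C"
  shows "src C f \<in> obj C" "tgt C f \<in> obj C"
  using assms src_obj tgt_obj by auto

lemma arr_cmp_assoc:
  assumes "f \<in> arr C" "g \<in> arr C" "h \<in> arr C" "tgt C f = src C g" "tgt C g = src C h"
  shows "(f \<Zsemi> g) \<Zsemi> h = f \<Zsemi> (g \<Zsemi> h)"
  using cmp_assoc[of f "src C f" "tgt C f" g "tgt C g" h "tgt C h"] assms by (auto simp: hom_iff)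

lemma arr_ident_cmp [simp]: "f \<in> arr C \<Longrightarrow> src C f = x \<Longrightarrow> ident C x \<Zsemi> f = f"
  using ident_cmp[of f x "tgt C f"] by (auto simp: hom_iff)

lemma arr_cmp_ident [simp]: "f \<in> arr C \<Longrightarrow> tgt C f = y \<Longrightarrow> f \<Zsemi> ident C y = f"
  using cmp_ident[of f "src C f" y] by (auto simp: hom_iff)

lemma hom_obj:
  assumes "f \<in> hom C x y"
  shows "x \<in> obj C" "y \<in> obj C"
  using assms by (auto simp: hom_iff)

lemma inverse_unique:
  assumes "f \<in> hom C x y" "g \<in> hom C y x" "h \<in> hom C y x"
    and "g \<Zsemi> f = ident C y" "f \<Zsemi> h = ident C x"
  shows "g = h"
proof -
  have "g \<Zsemi> (f \<Zsemi> h) = (g \<Zsemi> f) \<Zsemi> h"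
    using assms(1-3) by (simp add: cmp_assoc)
  then show ?thesis
    using assms by (simp add: hom_iff)
qed

end

context symmetric_strict_monoidal_category
begin

declare unit_obj [simp] tensor_obj [simp] tensor_obj_assoc [simp] unit_tensor_obj [simp]
  tensor_obj_unit [simp] unit_tensor [simp] tensor_unit [simp] tensor_ident [simp]

lemma arr_tensor [simp]:
  assumes "f \<in> arr C" "g \<in> arr C"
  shows "f \<oplus> g \<in> arr C" "src C (f \<oplus> g) = src C f \<odot> src C g"
    "tgt C (f \<oplus> g) = tgt C f \<odot> tgt C g"
  using tensor_hom[of f "src C f" "tgt C f" g "src C g" "tgt C g"] assms by (auto simp: hom_iff)

lemma arr_symm [simp]:
  assumes "x \<in> obj C" "y \<in> obj C"
  shows "symm C x y \<in> arr C" "src C (symm C x y) = x \<odot> y" "tgt C (symm C x y) = y \<odot> x"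
  using symm_hom[OF assms] by (auto simp: hom_iff)

lemma tensor_cmp:
  assumes "f \<in> arr C" "g \<in> arr C" "f' \<in> arr C" "g' \<in> arr C"
    and "tgt C f = src C g" "tgt C f' = src C g'"
  shows "(f \<oplus> f') \<Zsemi> (g \<oplus> g') = (f \<Zsemi> g) \<oplus> (f' \<Zsemi> g')"
  using interchange[of f "src C f" "tgt C f" g "tgt C g" f' "src C f'" "tgt C f'" g' "tgt C g'"]
    assms by (auto simp: hom_iff)

lemma arr_symm_natural:
  assumes "f \<in> arr C" "g \<in> arr C" "tgt C f = x" "tgt C g = y"
  shows "(f \<oplus> g) \<Zsemi> symm C x y = symm C (src C f) (src C g) \<Zsemi> (g \<oplus> f)"
  using symm_natural[of f "src C f" x g "src C g" y] assms by (auto simp: hom_iff)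

text \<open>The hexagon with two unit objects makes this symmetry idempotent, and an invertible
  idempotent is an identity.\<close>

lemma symm_unit_right [simp]:
  assumes "x \<in> obj C"
  shows "symm C x (unit_obj C) = ident C x"
proof -
  let ?s = "symm C x (unit_obj C)" and ?t = "symm C (unit_obj C) x"
  have idem: "?s = ?s \<Zsemi> ?s"
    using symm_hexagon[of x "unit_obj C" "unit_obj C"] assms by simp
  have "?s = (?t \<Zsemi> ?s) \<Zsemi> ?s"
    using symm_symm[of "unit_obj C" x] assms by simp
  also have "\<dots> = ?t \<Zsemi> ?s"
    using idem assms by (simp add: arr_cmp_assoc)
  finally show ?thesis
    using symm_symm[of "unit_obj C" x] assms by simp
qed

lemma symm_unit_left [simp]:
  assumes "x \<in> obj C"
  shows "symm C (unit_obj C) x = ident C x"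
  using symm_symm[of x "unit_obj C"] assms by simp

text \<open>The axiom is the hexagon in the second argument. Both sides here are inverse to
  \<open>symm C z (x \<odot> y)\<close>, to which that axiom applies.\<close>

lemma symm_hexagon_left:
  assumes [simp]: "x \<in> obj C" "y \<in> obj C" "z \<in> obj C"
  shows "symm C (x \<odot> y) z = (ident C x \<oplus> symm C y z) \<Zsemi> (symm C x z \<oplus> ident C y)"
    (is "_ = ?a \<Zsemi> ?b")
proof (rule inverse_unique[of "symm C z (x \<odot> y)" "z \<odot> (x \<odot> y)" "x \<odot> y \<odot> z"])
  let ?c = "symm C z x \<oplus> ident C y" and ?d = "ident C x \<oplus> symm C z y"
  have "?d \<Zsemi> ?a = ident C (x \<odot> z \<odot> y)"
    using symm_symm[of z y] by (simp add: tensor_cmp)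
  moreover have "?c \<Zsemi> ?b = ident C (z \<odot> x \<odot> y)"
    using symm_symm[of z x] by (simp add: tensor_cmp)
  moreover have "(?c \<Zsemi> ?d) \<Zsemi> (?a \<Zsemi> ?b) = ?c \<Zsemi> ((?d \<Zsemi> ?a) \<Zsemi> ?b)"
    by (simp add: arr_cmp_assoc)
  ultimately show "symm C z (x \<odot> y) \<Zsemi> (?a \<Zsemi> ?b) = ident C (z \<odot> (x \<odot> y))"
    by (simp add: symm_hexagon[of z x y])
qed (use symm_symm[of "x \<odot> y" z] in \<open>simp_all add: hom_iff\<close>)

text \<open>The middle swap is the shape occurring in \<open>copy_tensor\<close> and in
  \<open>copyt\<close>; computations with a copy on a tensor (\<open>counit_tensor\<close>,
  \<open>is_map_tensor\<close>) rest on its naturality.\<close>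

lemma middle_swap_natural:
  assumes "f \<in> arr C" "g \<in> arr C" "h \<in> arr C" "k \<in> arr C"
  shows "(f \<oplus> (g \<oplus> h) \<oplus> k) \<Zsemi>
      (ident C (tgt C f) \<oplus> symm C (tgt C g) (tgt C h) \<oplus> ident C (tgt C k)) =
    (ident C (src C f) \<oplus> symm C (src C g) (src C h) \<oplus> ident C (src C k)) \<Zsemi>
      (f \<oplus> (h \<oplus> g) \<oplus> k)"
  using assms by (simp add: tensor_cmp arr_symm_natural)

text \<open>The comonoids are arbitrary because this serves both the copies of a bicategory and the
  syntactic \<open>copyt\<close>. The first two conclusions carry the counit laws from the factors
  to the tensor; the third is the law \<open>d_projections\<close> of
  \<open>cartesian_smc\<close>.\<close>

lemma counit_tensor:
  assumes x: "x \<in> obj C" "d \<in> hom C x (x \<odot> x)" "e \<in> hom C x (unit_obj C)"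
    and y: "y \<in> obj C" "d' \<in> hom C y (y \<odot> y)" "e' \<in> hom C y (unit_obj C)"
    and left: "d \<Zsemi> (e \<oplus> ident C x) = ident C x" "d' \<Zsemi> (e' \<oplus> ident C y) = ident C y"
    and right: "d \<Zsemi> (ident C x \<oplus> e) = ident C x" "d' \<Zsemi> (ident C y \<oplus> e') = ident C y"
  shows "(d \<oplus> d') \<Zsemi> (ident C x \<oplus> symm C x y \<oplus> ident C y) \<Zsemi>
      ((e \<oplus> e') \<oplus> ident C (x \<odot> y)) = ident C (x \<odot> y)"
    and "(d \<oplus> d') \<Zsemi> (ident C x \<oplus> symm C x y \<oplus> ident C y) \<Zsemi>
      (ident C (x \<odot> y) \<oplus> (e \<oplus> e')) = ident C (x \<odot> y)"
    and "(d \<oplus> d') \<Zsemi> (ident C x \<oplus> symm C x y \<oplus> ident C y) \<Zsemi>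
      ((ident C x \<oplus> e') \<oplus> (e \<oplus> ident C y)) = ident C (x \<odot> y)"
proof -
  note [simp] = x[unfolded hom_iff] y[unfolded hom_iff]
  let ?m = "ident C x \<oplus> symm C x y \<oplus> ident C y"
  have "?m \<Zsemi> ((e \<oplus> e') \<oplus> ident C (x \<odot> y)) = ?m \<Zsemi> (e \<oplus> (e' \<oplus> ident C x) \<oplus> ident C y)"
    by (simp add: tensor_assoc flip: tensor_ident)
  \<comment> \<open>A discarded wire ends in the unit object, where the symmetry is an identity, so
    naturality removes the swap.\<close>
  also have "\<dots> = (e \<oplus> (ident C x \<oplus> e') \<oplus> ident C y)"
    using middle_swap_natural[of e "ident C x" e' "ident C y"] by simp
  also have "\<dots> = (e \<oplus> ident C x) \<oplus> (e' \<oplus> ident C y)"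
    by (simp add: tensor_assoc)
  finally show "(d \<oplus> d') \<Zsemi> ?m \<Zsemi> ((e \<oplus> e') \<oplus> ident C (x \<odot> y)) = ident C (x \<odot> y)"
    using left by (simp add: arr_cmp_assoc tensor_cmp)
  have "?m \<Zsemi> (ident C (x \<odot> y) \<oplus> (e \<oplus> e')) = ?m \<Zsemi> (ident C x \<oplus> (ident C y \<oplus> e) \<oplus> e')"
    by (simp add: tensor_assoc flip: tensor_ident)
  also have "\<dots> = (ident C x \<oplus> (e \<oplus> ident C y) \<oplus> e')"
    using middle_swap_natural[of "ident C x" e "ident C y" e'] by simp
  also have "\<dots> = (ident C x \<oplus> e) \<oplus> (ident C y \<oplus> e')"
    by (simp add: tensor_assoc)
  finally show "(d \<oplus> d') \<Zsemi> ?m \<Zsemi> (ident C (x \<odot> y) \<oplus> (e \<oplus> e')) = ident C (x \<odot> y)"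
    using right by (simp add: arr_cmp_assoc tensor_cmp)
  have "?m \<Zsemi> ((ident C x \<oplus> e') \<oplus> (e \<oplus> ident C y)) = ?m \<Zsemi> (ident C x \<oplus> (e' \<oplus> e) \<oplus> ident C y)"
    by (simp add: tensor_assoc)
  also have "\<dots> = (ident C x \<oplus> (e \<oplus> e') \<oplus> ident C y)"
    using middle_swap_natural[of "ident C x" e e' "ident C y"] by simp
  also have "\<dots> = (ident C x \<oplus> e) \<oplus> (e' \<oplus> ident C y)"
    by (simp add: tensor_assoc)
  finally show "(d \<oplus> d') \<Zsemi> ?m \<Zsemi> ((ident C x \<oplus> e') \<oplus> (e \<oplus> ident C y)) = ident C (x \<odot> y)"
    using left right by (simp add: arr_cmp_assoc tensor_cmp)
qed

end

section \<open>Products from comonoids\<close>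

context category
begin

text \<open>Moves the canonical cone on a tensor, along an isomorphism, to the image of an arbitrary
  product cone.\<close>

lemma is_product_transport:
  assumes p: "is_product C x y p u v"
    and i: "i \<in> hom C q p" and j: "j \<in> hom C p q"
    and ij: "i \<Zsemi> j = ident C q" and ji: "j \<Zsemi> i = ident C p"
  shows "is_product C x y q (i \<Zsemi> u) (i \<Zsemi> v)"
proof -
  have uv: "u \<in> hom C p x" "v \<in> hom C p y" and xy: "x \<in> obj C" "y \<in> obj C"
    and ex1: "\<And>z f g. z \<in> obj C \<Longrightarrow> f \<in> hom C z x \<Longrightarrow> g \<in> hom C z y \<Longrightarrow>
      \<exists>!h. h \<in> hom C z p \<and> h \<Zsemi> u = f \<and> h \<Zsemi> v = g"
    using p by (auto simp: is_product_def)
  have "\<exists>!h. h \<in> hom C z q \<and> h \<Zsemi> (i \<Zsemi> u) = f \<and> h \<Zsemi> (i \<Zsemi> v) = g"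
    if z: "z \<in> obj C" and f: "f \<in> hom C z x" and g: "g \<in> hom C z y" for z f g
  proof -
    obtain h where h: "h \<in> hom C z p" "h \<Zsemi> u = f" "h \<Zsemi> v = g"
      and uniq: "\<And>h'. h' \<in> hom C z p \<and> h' \<Zsemi> u = f \<and> h' \<Zsemi> v = g \<Longrightarrow> h' = h"
      using ex1[OF z f g] by blast
    show ?thesis
    proof (intro ex1I[of _ "h \<Zsemi> j"] conjI)
      have "(h \<Zsemi> j) \<Zsemi> i = h"
        using cmp_assoc[OF h(1) j i] ji h(1) by (simp add: hom_iff)
      then show "h \<Zsemi> j \<Zsemi> (i \<Zsemi> u) = f" "h \<Zsemi> j \<Zsemi> (i \<Zsemi> v) = g"
        using cmp_assoc[OF cmp_hom[OF h(1) j] i uv(1)] cmp_assoc[OF cmp_hom[OF h(1) j] i uv(2)] h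
        by auto
      show "h \<Zsemi> j \<in> hom C z q"
        using h(1) j by (rule cmp_hom)
    next
      fix k assume k: "k \<in> hom C z q \<and> k \<Zsemi> (i \<Zsemi> u) = f \<and> k \<Zsemi> (i \<Zsemi> v) = g"
      then have k': "k \<in> hom C z q" by simp
      have "k \<Zsemi> i = h"
        using k i uniq[of "k \<Zsemi> i"] cmp_assoc[OF k' i uv(1)] cmp_assoc[OF k' i uv(2)]
          cmp_hom[OF k' i] by auto
      then show "k = h \<Zsemi> j"
        using cmp_assoc[OF k' i j] ij k' by (simp add: hom_iff)
    qed
  qed
  then show ?thesis
    using cmp_hom[OF i uv(1)] cmp_hom[OF i uv(2)] xy hom_obj[OF i]
    by (simp add: is_product_def)
qed

end

text \<open>Enough structure for pairings to exist; their uniqueness is added in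
  \<open>cartesian_smc\<close>. The source of a product-preserving functor is treated at this level,
  its target at the next one.\<close>

locale counital_smc = symmetric_strict_monoidal_category C
  for C :: "('o, 'a, 'm) smcat_scheme" (structure) +
  fixes d e :: "'o \<Rightarrow> 'a"
  assumes d_hom: "x \<in> obj C \<Longrightarrow> d x \<in> hom C x (x \<odot> x)"
    and e_hom: "x \<in> obj C \<Longrightarrow> e x \<in> hom C x (unit_obj C)"
    and e_natural: "f \<in> hom C x y \<Longrightarrow> f \<Zsemi> e y = e x"
    and d_unit_left: "x \<in> obj C \<Longrightarrow> d x \<Zsemi> (e x \<oplus> ident C x) = ident C x"
    and d_unit_right: "x \<in> obj C \<Longrightarrow> d x \<Zsemi> (ident C x \<oplus> e x) = ident C x"
begin

lemma arr_d_e [simp]: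
  assumes "x \<in> obj C"
  shows "d x \<in> arr C" "src C (d x) = x" "tgt C (d x) = x \<odot> x"
    "e x \<in> arr C" "src C (e x) = x" "tgt C (e x) = unit_obj C"
  using d_hom[OF assms] e_hom[OF assms] by (auto simp: hom_iff)

text \<open>On the unit object, \<open>d\<close> followed by \<open>e\<close> is the identity by the
  counit law and \<open>e\<close> itself by naturality.\<close>

lemma e_unit: "e (unit_obj C) = ident C (unit_obj C)"
  using d_unit_left[of "unit_obj C"] e_natural[of "d (unit_obj C)" "unit_obj C" "unit_obj C"]
  by (simp add: hom_iff)

lemma e_unique:
  assumes "f \<in> hom C x (unit_obj C)"
  shows "f = e x"
  using e_natural[OF assms] assms by (simp add: e_unit hom_iff)

text \<open>The existence half of the universal property of \<open>x \<odot> y\<close>: naturality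
  of \<open>e\<close> turns the discarded component into a discarded copy of \<open>z\<close>, which
  the counit law removes.\<close>

lemma pairing:
  assumes f: "f \<in> hom C z x" and g: "g \<in> hom C z y"
  shows "d z \<Zsemi> (f \<oplus> g) \<in> hom C z (x \<odot> y)"
    and "d z \<Zsemi> (f \<oplus> g) \<Zsemi> (ident C x \<oplus> e y) = f"
    and "d z \<Zsemi> (f \<oplus> g) \<Zsemi> (e x \<oplus> ident C y) = g"
proof -
  note [simp] = f[unfolded hom_iff] g[unfolded hom_iff] hom_obj[OF f] hom_obj[OF g]
  show "d z \<Zsemi> (f \<oplus> g) \<in> hom C z (x \<odot> y)"
    by (simp add: hom_iff)
  have "(f \<oplus> g) \<Zsemi> (ident C x \<oplus> e y) = (ident C z \<oplus> e z) \<Zsemi> (f \<oplus> ident C (unit_obj C))"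
    using e_natural[OF g] by (simp add: tensor_cmp del: tensor_unit)
  then have "d z \<Zsemi> (f \<oplus> g) \<Zsemi> (ident C x \<oplus> e y) = (d z \<Zsemi> (ident C z \<oplus> e z)) \<Zsemi> f"
    by (simp add: arr_cmp_assoc)
  then show "d z \<Zsemi> (f \<oplus> g) \<Zsemi> (ident C x \<oplus> e y) = f"
    by (simp add: d_unit_right)
  have "(f \<oplus> g) \<Zsemi> (e x \<oplus> ident C y) = (e z \<oplus> ident C z) \<Zsemi> (ident C (unit_obj C) \<oplus> g)"
    using e_natural[OF f] by (simp add: tensor_cmp del: unit_tensor)
  then have "d z \<Zsemi> (f \<oplus> g) \<Zsemi> (e x \<oplus> ident C y) = (d z \<Zsemi> (e z \<oplus> ident C z)) \<Zsemi> g"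
    by (simp add: arr_cmp_assoc)
  then show "d z \<Zsemi> (f \<oplus> g) \<Zsemi> (e x \<oplus> ident C y) = g"
    by (simp add: d_unit_left)
qed

end

text \<open>\<open>d_projections\<close> is the eta rule for the identity of
  \<open>x \<odot> y\<close>; naturality of \<open>d\<close> extends it to every arrow into
  \<open>x \<odot> y\<close> in \<open>pairing_eta\<close>.\<close>

locale cartesian_smc = counital_smc +
  assumes d_natural: "f \<in> hom C x y \<Longrightarrow> f \<Zsemi> d y = d x \<Zsemi> (f \<oplus> f)"
    and d_projections: "x \<in> obj C \<Longrightarrow> y \<in> obj C \<Longrightarrow>
      d (x \<odot> y) \<Zsemi> ((ident C x \<oplus> e y) \<oplus> (e x \<oplus> ident C y)) = ident C (x \<odot> y)"
begin

lemma pairing_eta: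
  assumes h: "h \<in> hom C z (x \<odot> y)" and xy [simp]: "x \<in> obj C" "y \<in> obj C"
  shows "d z \<Zsemi> ((h \<Zsemi> (ident C x \<oplus> e y)) \<oplus> (h \<Zsemi> (e x \<oplus> ident C y))) = h"
proof -
  note [simp] = h[unfolded hom_iff] hom_obj[OF h]
  have "d z \<Zsemi> ((h \<Zsemi> (ident C x \<oplus> e y)) \<oplus> (h \<Zsemi> (e x \<oplus> ident C y))) =
      d z \<Zsemi> (h \<oplus> h) \<Zsemi> ((ident C x \<oplus> e y) \<oplus> (e x \<oplus> ident C y))"
    by (simp add: arr_cmp_assoc tensor_cmp)
  also have "\<dots> = h \<Zsemi> (d (x \<odot> y) \<Zsemi> ((ident C x \<oplus> e y) \<oplus> (e x \<oplus> ident C y)))"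
    by (simp add: arr_cmp_assoc flip: d_natural[OF h])
  finally show ?thesis
    by (simp add: d_projections)
qed

lemma pairing_unique:
  assumes "h \<in> hom C z (x \<odot> y)" "k \<in> hom C z (x \<odot> y)" "x \<in> obj C" "y \<in> obj C"
    and "h \<Zsemi> (ident C x \<oplus> e y) = k \<Zsemi> (ident C x \<oplus> e y)"
    and "h \<Zsemi> (e x \<oplus> ident C y) = k \<Zsemi> (e x \<oplus> ident C y)"
  shows "h = k"
  using pairing_eta[OF assms(1,3,4), unfolded assms(5,6), symmetric] pairing_eta[OF assms(2,3,4)]
  by (rule trans)

lemma is_product_tensor:
  assumes [simp]: "x \<in> obj C" "y \<in> obj C"
  shows "is_product C x y (x \<odot> y) (ident C x \<oplus> e y) (e x \<oplus> ident C y)"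
proof -
  have "\<exists>!h. h \<in> hom C z (x \<odot> y) \<and> h \<Zsemi> (ident C x \<oplus> e y) = f \<and>
      h \<Zsemi> (e x \<oplus> ident C y) = g"
    if "f \<in> hom C z x" "g \<in> hom C z y" for z f g
  proof (intro ex1I[of _ "d z \<Zsemi> (f \<oplus> g)"] conjI)
    fix h assume "h \<in> hom C z (x \<odot> y) \<and> h \<Zsemi> (ident C x \<oplus> e y) = f \<and>
      h \<Zsemi> (e x \<oplus> ident C y) = g"
    then show "h = d z \<Zsemi> (f \<oplus> g)"
      using pairing_unique[OF _ pairing(1)[OF that] assms] pairing(2,3)[OF that] by simp
  qed (fact pairing[OF that])+
  moreover have "ident C x \<oplus> e y \<in> hom C (x \<odot> y) x" "e x \<oplus> ident C y \<in> hom C (x \<odot> y) y"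
    by (simp_all add: hom_iff)
  ultimately show ?thesis
    by (simp add: is_product_def)
qed

text \<open>The counit laws say that both projections of \<open>h\<close> are identities, so
  \<open>h\<close> is the diagonal. This leaves a cartesian model no freedom in its value at
  \<open>Copy\<close>.\<close>

lemma d_unique:
  assumes "h \<in> hom C x (x \<odot> x)" "h \<Zsemi> (e x \<oplus> ident C x) = ident C x"
    "h \<Zsemi> (ident C x \<oplus> e x) = ident C x"
  shows "h = d x"
  using pairing_unique[of h x x x "d x"] assms d_unit_left d_unit_right d_hom hom_obj by auto

end

lemma strict_monoidal_functorD:
  assumes "symmetric_strict_monoidal_functor C D F"
  shows "x \<in> obj C \<Longrightarrow> omap F x \<in> obj D"
    and "f \<in> hom C x y \<Longrightarrow> amap F f \<in> hom D (omap F x) (omap F y)"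
    and "x \<in> obj C \<Longrightarrow> amap F (ident C x) = ident D (omap F x)"
    and "f \<in> hom C x y \<Longrightarrow> g \<in> hom C y z \<Longrightarrow>
      amap F (f \<Zsemi>\<^bsub>C\<^esub> g) = amap F f \<Zsemi>\<^bsub>D\<^esub> amap F g"
    and "omap F (unit_obj C) = unit_obj D"
    and "x \<in> obj C \<Longrightarrow> y \<in> obj C \<Longrightarrow> omap F (x \<odot>\<^bsub>C\<^esub> y) = omap F x \<odot>\<^bsub>D\<^esub> omap F y"
    and "f \<in> arr C \<Longrightarrow> g \<in> arr C \<Longrightarrow> amap F (f \<oplus>\<^bsub>C\<^esub> g) = amap F f \<oplus>\<^bsub>D\<^esub> amap F g"
    and "x \<in> obj C \<Longrightarrow> y \<in> obj C \<Longrightarrow> amap F (symm C x y) = symm D (omap F x) (omap F y)"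
  using assms by (auto simp: symmetric_strict_monoidal_functor_def is_functor_def)

text \<open>The terminal objects and product cones of \<open>C\<close> are arbitrary, so each is
  compared with the canonical one. A comparison in \<open>C\<close> need only be a retraction there;
  it becomes an isomorphism in \<open>D\<close>, where pairings are unique.\<close>

lemma strict_monoidal_functor_preserves_finite_products:
  fixes C :: "('o, 'a, 'm) smcat_scheme" and D :: "('p, 'b, 'n) smcat_scheme"
  assumes "counital_smc C d e" and "cartesian_smc D d' e'"
    and F: "symmetric_strict_monoidal_functor C D F"
  shows "preserves_finite_products C D F"
proof -
  interpret C: counital_smc C d e by fact
  interpret D: cartesian_smc D d' e' by fact
  note F = strict_monoidal_functorD[OF F]
  have F_e: "amap F (e x) = e' (omap F x)" if "x \<in> obj C" for x
    using D.e_unique F(2)[OF C.e_hom[OF that]] by (simp add: F(5))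
  have terminal: "is_terminal D (omap F t)" if t: "is_terminal C t" for t
  proof -
    have t_obj: "t \<in> obj C" and to_t: "\<And>x. x \<in> obj C \<Longrightarrow> \<exists>!f. f \<in> hom C x t"
      using t by (auto simp: is_terminal_def)
    \<comment> \<open>\<open>t\<close> is a retract of the unit object through \<open>e t\<close>
      and \<open>h\<close>. The functor preserves the retraction, and in \<open>D\<close> arrows
      into the unit object are unique.\<close>
    obtain h where h: "h \<in> hom C (unit_obj C) t"
      using to_t[of "unit_obj C"] by auto
    have et: "e t \<in> hom C t (unit_obj C)"
      by (rule C.e_hom[OF t_obj])
    have eh: "e t \<Zsemi>\<^bsub>C\<^esub> h = ident C t"
      using to_t[OF t_obj] C.cmp_hom[OF et h] C.ident_hom[OF t_obj] by blast
    note Fh = F(2)[OF h, unfolded F(5)] and Fe = F(2)[OF et, unfolded F(5)]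
    have Feh: "amap F (e t) \<Zsemi>\<^bsub>D\<^esub> amap F h = ident D (omap F t)"
      using F(4)[OF et h] eh F(3)[OF t_obj] by simp
    have uniq: "f = e' x \<Zsemi>\<^bsub>D\<^esub> amap F h" if f: "f \<in> hom D x (omap F t)" for f x
    proof -
      have "f = f \<Zsemi>\<^bsub>D\<^esub> (amap F (e t) \<Zsemi>\<^bsub>D\<^esub> amap F h)"
        using f by (simp add: Feh hom_iff)
      also have "\<dots> = (f \<Zsemi>\<^bsub>D\<^esub> amap F (e t)) \<Zsemi>\<^bsub>D\<^esub> amap F h"
        using D.cmp_assoc[OF f Fe Fh] by simp
      also have "f \<Zsemi>\<^bsub>D\<^esub> amap F (e t) = e' x"
        by (rule D.e_unique[OF D.cmp_hom[OF f Fe]])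
      finally show ?thesis .
    qed
    have "\<exists>!f. f \<in> hom D x (omap F t)" if "x \<in> obj D" for x
      using D.cmp_hom[OF D.e_hom[OF that] Fh] uniq by blast
    then show ?thesis
      using F(1)[OF t_obj] by (auto simp: is_terminal_def)
  qed
  have product: "is_product D (omap F x) (omap F y) (omap F p) (amap F u) (amap F v)"
    if prod: "is_product C x y p u v" for x y p u v
  proof -
    have xyp [simp]: "x \<in> obj C" "y \<in> obj C" "p \<in> obj C"
      and u: "u \<in> hom C p x" and v: "v \<in> hom C p y"
      and ex1: "\<And>z f g. z \<in> obj C \<Longrightarrow> f \<in> hom C z x \<Longrightarrow> g \<in> hom C z y \<Longrightarrow>
        \<exists>!h. h \<in> hom C z p \<and> h \<Zsemi>\<^bsub>C\<^esub> u = f \<and> h \<Zsemi>\<^bsub>C\<^esub> v = g"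
      using prod by (auto simp: is_product_def)
    let ?l = "ident C x \<oplus>\<^bsub>C\<^esub> e y" and ?r = "e x \<oplus>\<^bsub>C\<^esub> ident C y"
    let ?l' = "ident D (omap F x) \<oplus>\<^bsub>D\<^esub> e' (omap F y)"
    let ?r' = "e' (omap F x) \<oplus>\<^bsub>D\<^esub> ident D (omap F y)"
    have l: "?l \<in> hom C (x \<odot>\<^bsub>C\<^esub> y) x" and r: "?r \<in> hom C (x \<odot>\<^bsub>C\<^esub> y) y"
      by (simp_all add: hom_iff)
    have Fl: "amap F ?l = ?l'" and Fr: "amap F ?r = ?r'"
      by (simp_all add: F F_e)
    obtain h where h: "h \<in> hom C (x \<odot>\<^bsub>C\<^esub> y) p" "h \<Zsemi>\<^bsub>C\<^esub> u = ?l" "h \<Zsemi>\<^bsub>C\<^esub> v = ?r"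
      using ex1[OF _ l r] by auto
    define k where "k = d p \<Zsemi>\<^bsub>C\<^esub> (u \<oplus>\<^bsub>C\<^esub> v)"
    have k: "k \<in> hom C p (x \<odot>\<^bsub>C\<^esub> y)" "k \<Zsemi>\<^bsub>C\<^esub> ?l = u" "k \<Zsemi>\<^bsub>C\<^esub> ?r = v"
      using C.pairing[OF u v] by (simp_all add: k_def)
    \<comment> \<open>\<open>k\<close> followed by \<open>h\<close> commutes with the legs
      \<open>u\<close> and \<open>v\<close>, so the universal property of the given cone makes it an
      identity already in \<open>C\<close>.\<close>
    have "k \<Zsemi>\<^bsub>C\<^esub> h = ident C p"
      using ex1[OF xyp(3) u v] C.cmp_hom[OF k(1) h(1)] C.ident_hom[OF xyp(3)]
        C.cmp_assoc[OF k(1) h(1) u] C.cmp_assoc[OF k(1) h(1) v] h k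
        C.ident_cmp[OF u] C.ident_cmp[OF v] by metis
    then have kh: "amap F k \<Zsemi>\<^bsub>D\<^esub> amap F h = ident D (omap F p)"
      using F(4)[OF k(1) h(1)] by (simp add: F)
    note Fk = F(2)[OF k(1), unfolded F(6)[OF xyp(1,2)]]
      and Fh = F(2)[OF h(1), unfolded F(6)[OF xyp(1,2)]]
    have Fxy [simp]: "omap F x \<in> obj D" "omap F y \<in> obj D"
      by (simp_all add: F)
    have l': "?l' \<in> hom D (omap F x \<odot>\<^bsub>D\<^esub> omap F y) (omap F x)"
      and r': "?r' \<in> hom D (omap F x \<odot>\<^bsub>D\<^esub> omap F y) (omap F y)"
      by (simp_all add: hom_iff)
    have u_eq: "amap F u = amap F k \<Zsemi>\<^bsub>D\<^esub> ?l'" and v_eq: "amap F v = amap F k \<Zsemi>\<^bsub>D\<^esub> ?r'"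
      using F(4)[OF k(1) l] F(4)[OF k(1) r] k Fl Fr by auto
    \<comment> \<open>The other composite is an endomorphism of the canonical cone; it is cancelled
      after applying the functor, by uniqueness of pairings in \<open>D\<close>.\<close>
    have "amap F h \<Zsemi>\<^bsub>D\<^esub> amap F k = ident D (omap F x \<odot>\<^bsub>D\<^esub> omap F y)"
    proof (rule D.pairing_unique[OF D.cmp_hom[OF Fh Fk] D.ident_hom])
      have "amap F h \<Zsemi>\<^bsub>D\<^esub> amap F u = ?l'" "amap F h \<Zsemi>\<^bsub>D\<^esub> amap F v = ?r'"
        using F(4)[OF h(1) u] F(4)[OF h(1) v] h Fl Fr by auto
      then show "amap F h \<Zsemi>\<^bsub>D\<^esub> amap F k \<Zsemi>\<^bsub>D\<^esub> ?l' = ident D (omap F x \<odot>\<^bsub>D\<^esub> omap F y) \<Zsemi>\<^bsub>D\<^esub> ?l'"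
        "amap F h \<Zsemi>\<^bsub>D\<^esub> amap F k \<Zsemi>\<^bsub>D\<^esub> ?r' = ident D (omap F x \<odot>\<^bsub>D\<^esub> omap F y) \<Zsemi>\<^bsub>D\<^esub> ?r'"
        using D.cmp_assoc[OF Fh Fk l'] D.cmp_assoc[OF Fh Fk r'] u_eq v_eq
          D.ident_cmp[OF l'] D.ident_cmp[OF r'] by simp_all
    qed simp_all
    with D.is_product_transport[OF D.is_product_tensor[OF Fxy] Fk Fh kh] show ?thesis
      by (simp add: u_eq v_eq)
  qed
  show ?thesis
    using terminal product by (simp add: preserves_finite_products_def)
qed

section \<open>Maps in a cartesian bicategory of relations\<close>

context poset_enriched_smc
begin

text \<open>\<open>leq\<close> is unconstrained between arrows that are not parallel. Storing the
  typing in the relation lets chains of inequations run without side conditions on homsets.\<close>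

definition parallel_leq :: "'a \<Rightarrow> 'a \<Rightarrow> bool"  (infix \<open>\<preceq>\<close> 50) where
  "f \<preceq> g \<longleftrightarrow> f \<in> arr C \<and> g \<in> arr C \<and> src C f = src C g \<and> tgt C f = tgt C g \<and> f \<sqsubseteq> g"

lemma parallel_leq_hom: "f \<in> hom C x y \<Longrightarrow> g \<in> hom C x y \<Longrightarrow> f \<preceq> g \<longleftrightarrow> f \<sqsubseteq> g"
  by (auto simp: parallel_leq_def hom_iff)

lemma parallel_leqD:
  assumes "f \<preceq> g"
  shows "f \<in> arr C" "g \<in> arr C" "src C f = src C g" "tgt C f = tgt C g" "f \<sqsubseteq> g"
  using assms by (auto simp: parallel_leq_def)

lemma parallel_leq_refl [simp]: "f \<in> arr C \<Longrightarrow> f \<preceq> f"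
  using leq_refl[of f "src C f" "tgt C f"] by (simp add: parallel_leq_def hom_iff)

lemma parallel_leq_trans [trans]: "f \<preceq> g \<Longrightarrow> g \<preceq> h \<Longrightarrow> f \<preceq> h"
  using leq_trans[of f "src C f" "tgt C f" g h] by (simp add: parallel_leq_def hom_iff)

lemma parallel_leq_antisym: "f \<preceq> g \<Longrightarrow> g \<preceq> f \<Longrightarrow> f = g"
  using leq_antisym[of f "src C f" "tgt C f" g] by (simp add: parallel_leq_def hom_iff)

lemma parallel_leq_cmp: "f \<preceq> f' \<Longrightarrow> g \<preceq> g' \<Longrightarrow> tgt C f = src C g \<Longrightarrow> f \<Zsemi> g \<preceq> f' \<Zsemi> g'"
  using cmp_mono[of f "src C f" "tgt C f" f' g "tgt C g" g']
  by (simp add: parallel_leq_def hom_iff)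

lemma parallel_leq_cmp_left: "f \<preceq> f' \<Longrightarrow> g \<in> arr C \<Longrightarrow> tgt C f = src C g \<Longrightarrow> f \<Zsemi> g \<preceq> f' \<Zsemi> g"
  by (simp add: parallel_leq_cmp)

lemma parallel_leq_cmp_right: "g \<preceq> g' \<Longrightarrow> f \<in> arr C \<Longrightarrow> tgt C f = src C g \<Longrightarrow> f \<Zsemi> g \<preceq> f \<Zsemi> g'"
  by (simp add: parallel_leq_cmp)

lemma parallel_leq_tensor: "f \<preceq> f' \<Longrightarrow> g \<preceq> g' \<Longrightarrow> f \<oplus> g \<preceq> f' \<oplus> g'"
  using tensor_mono[of f "src C f" "tgt C f" f' g "src C g" "tgt C g" g']
  by (simp add: parallel_leq_def hom_iff)

text \<open>Half of the uniqueness of right adjoints: the unit for \<open>S'\<close> inserts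
  \<open>R\<close> and \<open>S'\<close> after \<open>S\<close>, and the counit for \<open>S\<close>
  cancels \<open>S\<close> against \<open>R\<close>. Used in both directions it identifies the
  images of merge and create.\<close>

lemma right_adjoint_leq:
  assumes "R \<in> hom C x y" "S \<in> hom C y x" "S' \<in> hom C y x"
    and "S \<Zsemi> R \<preceq> ident C y" "ident C x \<preceq> R \<Zsemi> S'"
  shows "S \<preceq> S'"
proof -
  note [simp] = assms(1-3)[unfolded hom_iff] hom_obj[OF assms(1)]
  have "S = S \<Zsemi> ident C x"
    by simp
  also have "\<dots> \<preceq> S \<Zsemi> (R \<Zsemi> S')"
    by (intro parallel_leq_cmp_right assms) simp_all
  also have "S \<Zsemi> (R \<Zsemi> S') = (S \<Zsemi> R) \<Zsemi> S'"
    by (simp add: arr_cmp_assoc)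
  also have "\<dots> \<preceq> ident C y \<Zsemi> S'"
    by (intro parallel_leq_cmp_left assms) simp_all
  finally show ?thesis
    by simp
qed

end

context cartesian_bicategory
begin

lemma arr_comonoid [simp]:
  assumes "x \<in> obj C"
  shows "copy C x \<in> arr C" "src C (copy C x) = x" "tgt C (copy C x) = x \<odot> x"
    "discard C x \<in> arr C" "src C (discard C x) = x" "tgt C (discard C x) = unit_obj C"
    "merge C x \<in> arr C" "src C (merge C x) = x \<odot> x" "tgt C (merge C x) = x"
    "create C x \<in> arr C" "src C (create C x) = unit_obj C" "tgt C (create C x) = x"
  using copy_hom[OF assms] discard_hom[OF assms] merge_hom[OF assms] create_hom[OF assms]
  by (auto simp: hom_iff)

lemma arr_merge_copy: "x \<in> obj C \<Longrightarrow> merge C x \<Zsemi> copy C x \<preceq> ident C (x \<odot> x)"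
  and arr_copy_merge: "x \<in> obj C \<Longrightarrow> ident C x \<preceq> copy C x \<Zsemi> merge C x"
  and arr_create_discard: "x \<in> obj C \<Longrightarrow> create C x \<Zsemi> discard C x \<preceq> ident C (unit_obj C)"
  and arr_discard_create: "x \<in> obj C \<Longrightarrow> ident C x \<preceq> discard C x \<Zsemi> create C x"
  using merge_copy_le le_copy_merge create_discard_le le_discard_create
  by (simp_all add: parallel_leq_def)

lemma arr_lax_copy: "R \<in> hom C x y \<Longrightarrow> R \<Zsemi> copy C y \<preceq> copy C x \<Zsemi> (R \<oplus> R)"
  and arr_lax_discard: "R \<in> hom C x y \<Longrightarrow> R \<Zsemi> discard C y \<preceq> discard C x"
  using lax_copy lax_discard by (auto simp: parallel_leq_def hom_iff)

text \<open>The axioms give compatibility with binary tensors only. On the unit object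
  \<open>discard_tensor\<close> makes discard idempotent, while the counit law makes copy a section
  of it; so both are identities.\<close>

lemma discard_unit_obj [simp]: "discard C (unit_obj C) = ident C (unit_obj C)"
  and copy_unit_obj [simp]: "copy C (unit_obj C) = ident C (unit_obj C)"
proof -
  let ?I = "unit_obj C"
  have unit: "copy C ?I \<Zsemi> discard C ?I = ident C ?I"
    using copy_unit_left[of ?I] by simp
  have "discard C ?I = (discard C ?I \<oplus> ident C ?I) \<Zsemi> (ident C ?I \<oplus> discard C ?I)"
    using discard_tensor[of ?I ?I] by (subst tensor_cmp) simp_all
  then have "discard C ?I = discard C ?I \<Zsemi> discard C ?I"
    by simp
  then have "copy C ?I \<Zsemi> discard C ?I = (copy C ?I \<Zsemi> discard C ?I) \<Zsemi> discard C ?I"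
    by (simp add: arr_cmp_assoc)
  then show "discard C ?I = ident C ?I"
    by (simp add: unit)
  with unit show "copy C ?I = ident C ?I"
    by simp
qed

lemma is_map_iff:
  assumes "R \<in> hom C x y"
  shows "is_map C R \<longleftrightarrow> R \<Zsemi> copy C y = copy C x \<Zsemi> (R \<oplus> R) \<and> R \<Zsemi> discard C y = discard C x"
  using assms by (auto simp: is_map_def hom_iff)

lemma is_mapI:
  assumes R: "R \<in> hom C x y"
    and "copy C x \<Zsemi> (R \<oplus> R) \<preceq> R \<Zsemi> copy C y" "discard C x \<preceq> R \<Zsemi> discard C y"
  shows "is_map C R"
  using assms arr_lax_copy[OF R] arr_lax_discard[OF R] is_map_iff[OF R]
  by (auto intro: parallel_leq_antisym)

text \<open>The inequations missing from a map come from laxness of the right adjoint: the unit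
  inserts \<open>R\<close> followed by \<open>S\<close>, then \<open>S\<close> slides through the
  copy or discard, and in the case of copy the counit cancels both occurrences of \<open>S\<close>
  against \<open>R\<close>.\<close>

lemma left_adjoint_is_map:
  assumes R: "R \<in> hom C x y" and S: "S \<in> hom C y x"
    and unit: "ident C x \<preceq> R \<Zsemi> S" and counit: "S \<Zsemi> R \<preceq> ident C y"
  shows "is_map C R"
proof (rule is_mapI[OF R])
  note [simp] = R[unfolded hom_iff] S[unfolded hom_iff] hom_obj[OF R]
  have "copy C x \<Zsemi> (R \<oplus> R) = ident C x \<Zsemi> (copy C x \<Zsemi> (R \<oplus> R))"
    by simp
  also have "\<dots> \<preceq> (R \<Zsemi> S) \<Zsemi> (copy C x \<Zsemi> (R \<oplus> R))"
    by (intro parallel_leq_cmp_left unit) simp_all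
  also have "\<dots> = R \<Zsemi> ((S \<Zsemi> copy C x) \<Zsemi> (R \<oplus> R))"
    by (simp add: arr_cmp_assoc)
  also have "\<dots> \<preceq> R \<Zsemi> ((copy C y \<Zsemi> (S \<oplus> S)) \<Zsemi> (R \<oplus> R))"
    by (intro parallel_leq_cmp_left parallel_leq_cmp_right arr_lax_copy S) simp_all
  also have "\<dots> = R \<Zsemi> (copy C y \<Zsemi> ((S \<Zsemi> R) \<oplus> (S \<Zsemi> R)))"
    by (simp add: arr_cmp_assoc tensor_cmp)
  also have "\<dots> \<preceq> R \<Zsemi> (copy C y \<Zsemi> (ident C y \<oplus> ident C y))"
    by (intro parallel_leq_cmp_right parallel_leq_tensor counit) simp_all
  finally show "copy C x \<Zsemi> (R \<oplus> R) \<preceq> R \<Zsemi> copy C y"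
    by simp
  have "discard C x = ident C x \<Zsemi> discard C x"
    by simp
  also have "\<dots> \<preceq> (R \<Zsemi> S) \<Zsemi> discard C x"
    by (intro parallel_leq_cmp_left unit) simp_all
  also have "\<dots> = R \<Zsemi> (S \<Zsemi> discard C x)"
    by (simp add: arr_cmp_assoc)
  also have "\<dots> \<preceq> R \<Zsemi> discard C y"
    by (intro parallel_leq_cmp_right arr_lax_discard S) simp_all
  finally show "discard C x \<preceq> R \<Zsemi> discard C y" .
qed

lemma is_map_ident: "x \<in> obj C \<Longrightarrow> is_map C (ident C x)"
  by (rule left_adjoint_is_map[of _ x x "ident C x"]) (simp_all add: hom_iff)

lemma is_map_symm: "x \<in> obj C \<Longrightarrow> y \<in> obj C \<Longrightarrow> is_map C (symm C x y)"
  by (rule left_adjoint_is_map[of _ "x \<odot> y" "y \<odot> x" "symm C y x"])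
    (simp_all add: hom_iff symm_symm)

lemma is_map_copy: "x \<in> obj C \<Longrightarrow> is_map C (copy C x)"
  by (rule left_adjoint_is_map[of _ x "x \<odot> x" "merge C x"])
    (simp_all add: hom_iff arr_copy_merge arr_merge_copy)

lemma is_map_discard: "x \<in> obj C \<Longrightarrow> is_map C (discard C x)"
  by (rule left_adjoint_is_map[of _ x "unit_obj C" "create C x"])
    (simp_all add: hom_iff arr_discard_create arr_create_discard)

lemma is_map_cmp:
  assumes f: "f \<in> hom C x y" "is_map C f" and g: "g \<in> hom C y z" "is_map C g"
  shows "is_map C (f \<Zsemi> g)"
proof -
  note [simp] = f(1)[unfolded hom_iff] g(1)[unfolded hom_iff] hom_obj[OF f(1)] hom_obj[OF g(1)]
  note f' = f(2)[unfolded is_map_iff[OF f(1)]] and g' = g(2)[unfolded is_map_iff[OF g(1)]]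
  have "f \<Zsemi> g \<Zsemi> copy C z = (f \<Zsemi> copy C y) \<Zsemi> (g \<oplus> g)"
    using g' by (simp add: arr_cmp_assoc)
  also have "\<dots> = copy C x \<Zsemi> ((f \<Zsemi> g) \<oplus> (f \<Zsemi> g))"
    using f' by (simp add: arr_cmp_assoc tensor_cmp)
  finally have "f \<Zsemi> g \<Zsemi> copy C z = copy C x \<Zsemi> ((f \<Zsemi> g) \<oplus> (f \<Zsemi> g))" .
  moreover have "f \<Zsemi> g \<Zsemi> discard C z = discard C x"
    using f' g' by (simp add: arr_cmp_assoc)
  ultimately show ?thesis
    using is_map_iff[OF cmp_hom[OF f(1) g(1)]] by simp
qed

lemma is_map_tensor:
  assumes f: "f \<in> hom C x y" "is_map C f" and g: "g \<in> hom C z w" "is_map C g"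
  shows "is_map C (f \<oplus> g)"
proof -
  note [simp] = f(1)[unfolded hom_iff] g(1)[unfolded hom_iff] hom_obj[OF f(1)] hom_obj[OF g(1)]
  note f' = f(2)[unfolded is_map_iff[OF f(1)]] and g' = g(2)[unfolded is_map_iff[OF g(1)]]
  let ?m = "\<lambda>x y. ident C x \<oplus> symm C x y \<oplus> ident C y"
  have "(f \<oplus> g) \<Zsemi> copy C (y \<odot> w) = (f \<oplus> g) \<Zsemi> (copy C y \<oplus> copy C w) \<Zsemi> ?m y w"
    by (simp add: copy_tensor arr_cmp_assoc)
  also have "\<dots> = (copy C x \<Zsemi> (f \<oplus> f)) \<oplus> (copy C z \<Zsemi> (g \<oplus> g)) \<Zsemi> ?m y w"
    using f' g' by (simp add: tensor_cmp)
  also have "\<dots> = (copy C x \<oplus> copy C z) \<Zsemi> ((f \<oplus> (f \<oplus> g) \<oplus> g) \<Zsemi> ?m y w)"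
    by (simp add: arr_cmp_assoc tensor_assoc flip: tensor_cmp)
  also have "\<dots> = (copy C x \<oplus> copy C z) \<Zsemi> (?m x z \<Zsemi> (f \<oplus> (g \<oplus> f) \<oplus> g))"
    using middle_swap_natural[of f f g g] by simp
  also have "\<dots> = copy C (x \<odot> z) \<Zsemi> ((f \<oplus> g) \<oplus> (f \<oplus> g))"
    by (simp add: copy_tensor arr_cmp_assoc tensor_assoc)
  finally have "(f \<oplus> g) \<Zsemi> copy C (y \<odot> w) = copy C (x \<odot> z) \<Zsemi> ((f \<oplus> g) \<oplus> (f \<oplus> g))" .
  moreover have "(f \<oplus> g) \<Zsemi> discard C (y \<odot> w) = discard C (x \<odot> z)"
    using f' g' by (simp add: discard_tensor tensor_cmp)
  ultimately show ?thesis
    using is_map_iff[OF tensor_hom[OF f(1) g(1)]] by simp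
qed

text \<open>The mate of \<open>lax_copy\<close> under the adjunctions between copy and merge: the
  unit is inserted at \<open>y\<close> and the counit removed at \<open>x\<close>.\<close>

lemma arr_lax_merge:
  assumes R: "R \<in> hom C x y"
  shows "merge C x \<Zsemi> R \<preceq> (R \<oplus> R) \<Zsemi> merge C y"
proof -
  note [simp] = R[unfolded hom_iff] hom_obj[OF R]
  have "merge C x \<Zsemi> R = merge C x \<Zsemi> R \<Zsemi> ident C y"
    by simp
  also have "\<dots> \<preceq> merge C x \<Zsemi> R \<Zsemi> (copy C y \<Zsemi> merge C y)"
    by (intro parallel_leq_cmp_right arr_copy_merge) simp_all
  also have "\<dots> = merge C x \<Zsemi> (R \<Zsemi> copy C y) \<Zsemi> merge C y"
    by (simp add: arr_cmp_assoc)
  also have "\<dots> \<preceq> merge C x \<Zsemi> (copy C x \<Zsemi> (R \<oplus> R)) \<Zsemi> merge C y"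
    by (intro parallel_leq_cmp_left parallel_leq_cmp_right arr_lax_copy R) simp_all
  also have "\<dots> = (merge C x \<Zsemi> copy C x) \<Zsemi> ((R \<oplus> R) \<Zsemi> merge C y)"
    by (simp add: arr_cmp_assoc)
  also have "\<dots> \<preceq> ident C (x \<odot> x) \<Zsemi> ((R \<oplus> R) \<Zsemi> merge C y)"
    by (intro parallel_leq_cmp_left arr_merge_copy) simp_all
  finally show ?thesis
    by simp
qed

text \<open>The mate of \<open>lax_discard\<close> under the adjunctions between discard and
  create.\<close>

lemma arr_lax_create:
  assumes R: "R \<in> hom C x y"
  shows "create C x \<Zsemi> R \<preceq> create C y"
proof -
  note [simp] = R[unfolded hom_iff] hom_obj[OF R]
  have "create C x \<Zsemi> R = create C x \<Zsemi> R \<Zsemi> ident C y"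
    by simp
  also have "\<dots> \<preceq> create C x \<Zsemi> R \<Zsemi> (discard C y \<Zsemi> create C y)"
    by (intro parallel_leq_cmp_right arr_discard_create) simp_all
  also have "\<dots> = create C x \<Zsemi> (R \<Zsemi> discard C y) \<Zsemi> create C y"
    by (simp add: arr_cmp_assoc)
  also have "\<dots> \<preceq> create C x \<Zsemi> discard C x \<Zsemi> create C y"
    by (intro parallel_leq_cmp_left parallel_leq_cmp_right arr_lax_discard R) simp_all
  also have "\<dots> \<preceq> ident C (unit_obj C) \<Zsemi> create C y"
    by (intro parallel_leq_cmp_left arr_create_discard) simp_all
  finally show ?thesis
    by simp
qed

text \<open>Self-duality of every object, with cup create-then-copy and cap merge-then-discard. The
  Frobenius law turns the middle into merge-then-copy, and the unit and counit laws erase the two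
  ends.\<close>

lemma snake:
  assumes [simp]: "x \<in> obj C"
  shows "(ident C x \<oplus> (create C x \<Zsemi> copy C x)) \<Zsemi> ((merge C x \<Zsemi> discard C x) \<oplus> ident C x) =
    ident C x"
proof -
  have "(ident C x \<oplus> (create C x \<Zsemi> copy C x)) \<Zsemi> ((merge C x \<Zsemi> discard C x) \<oplus> ident C x) =
      ((ident C x \<oplus> create C x) \<Zsemi> (ident C x \<oplus> copy C x)) \<Zsemi>
      ((merge C x \<oplus> ident C x) \<Zsemi> (discard C x \<oplus> ident C x))"
    by (simp add: tensor_cmp)
  also have "\<dots> = (ident C x \<oplus> create C x) \<Zsemi>
      ((ident C x \<oplus> copy C x) \<Zsemi> (merge C x \<oplus> ident C x)) \<Zsemi> (discard C x \<oplus> ident C x)"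
    by (simp add: arr_cmp_assoc)
  also have "\<dots> = (ident C x \<oplus> create C x) \<Zsemi> (merge C x \<Zsemi> copy C x) \<Zsemi> (discard C x \<oplus> ident C x)"
    by (simp add: frobenius_right)
  also have "\<dots> = ((ident C x \<oplus> create C x) \<Zsemi> merge C x) \<Zsemi> (copy C x \<Zsemi> (discard C x \<oplus> ident C x))"
    by (simp add: arr_cmp_assoc)
  finally show ?thesis
    by (simp add: merge_unit_right copy_unit_left)
qed

text \<open>
  Bending a wire with the snake identity turns one copy of the larger map \<open>g\<close> into \<open>f\<close>: the
  totality of \<open>f\<close> is used on the cap and the single-valuedness of \<open>g\<close> on the cup.
\<close>

lemma map_leq_eq:
  assumes f: "f \<in> hom C x y" "is_map C f" and g: "g \<in> hom C x y" "is_map C g"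
    and le: "f \<preceq> g"
  shows "f = g"
proof (rule parallel_leq_antisym[OF le])
  note [simp] = f(1)[unfolded hom_iff] g(1)[unfolded hom_iff] hom_obj[OF f(1)]
  note f' = f(2)[unfolded is_map_iff[OF f(1)]] and g' = g(2)[unfolded is_map_iff[OF g(1)]]
  define cap where "cap x = merge C x \<Zsemi> discard C x" for x
  define cup where "cup x = create C x \<Zsemi> copy C x" for x
  have arr [simp]: "cap x \<in> arr C" "src C (cap x) = x \<odot> x" "tgt C (cap x) = unit_obj C"
    "cup x \<in> arr C" "src C (cup x) = unit_obj C" "tgt C (cup x) = x \<odot> x" if "x \<in> obj C" for x
    using that by (simp_all add: cap_def cup_def)
  have snake: "(ident C x \<oplus> cup x) \<Zsemi> (cap x \<oplus> ident C x) = ident C x" if "x \<in> obj C" for x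
    using snake[OF that] by (simp add: cap_def cup_def)
  have "cap x = merge C x \<Zsemi> f \<Zsemi> discard C y"
    using f' by (simp add: cap_def arr_cmp_assoc)
  also have "\<dots> \<preceq> (f \<oplus> f) \<Zsemi> merge C y \<Zsemi> discard C y"
    by (intro parallel_leq_cmp_left arr_lax_merge f) simp_all
  finally have cap: "cap x \<preceq> (f \<oplus> f) \<Zsemi> cap y"
    by (simp add: cap_def arr_cmp_assoc)
  have "cup x \<Zsemi> (g \<oplus> g) = create C x \<Zsemi> g \<Zsemi> copy C y"
    using g' by (simp add: cup_def arr_cmp_assoc)
  also have "\<dots> \<preceq> create C y \<Zsemi> copy C y"
    by (intro parallel_leq_cmp_left arr_lax_create g) simp_all
  finally have cup: "cup x \<Zsemi> (g \<oplus> g) \<preceq> cup y"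
    by (simp add: cup_def)
  have "g = ((ident C x \<oplus> cup x) \<Zsemi> (cap x \<oplus> ident C x)) \<Zsemi> (ident C (unit_obj C) \<oplus> g)"
    by (simp add: snake)
  also have "\<dots> = (ident C x \<oplus> cup x) \<Zsemi> (cap x \<oplus> g)"
    by (simp add: arr_cmp_assoc tensor_cmp del: unit_tensor)
  also have "\<dots> \<preceq> (ident C x \<oplus> cup x) \<Zsemi> (((f \<oplus> f) \<Zsemi> cap y) \<oplus> g)"
    by (intro parallel_leq_cmp_right parallel_leq_tensor cap) simp_all
  also have "((f \<oplus> f) \<Zsemi> cap y) \<oplus> g = (f \<oplus> (f \<oplus> g)) \<Zsemi> (cap y \<oplus> ident C y)"
    by (simp add: tensor_cmp flip: tensor_assoc)
  \<comment> \<open>The hypothesis \<open>f \<preceq> g\<close> enters here: the copy of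
    \<open>f\<close> shared by cap and cup is enlarged, so that both legs of the cup carry
    \<open>g\<close> and single-valuedness applies.\<close>
  also have "(ident C x \<oplus> cup x) \<Zsemi> ((f \<oplus> (f \<oplus> g)) \<Zsemi> (cap y \<oplus> ident C y)) \<preceq>
      (ident C x \<oplus> cup x) \<Zsemi> ((f \<oplus> (g \<oplus> g)) \<Zsemi> (cap y \<oplus> ident C y))"
    by (intro parallel_leq_cmp_right parallel_leq_cmp_left parallel_leq_tensor le) simp_all
  also have "\<dots> = (f \<oplus> (cup x \<Zsemi> (g \<oplus> g))) \<Zsemi> (cap y \<oplus> ident C y)"
    by (simp add: tensor_cmp flip: arr_cmp_assoc)
  also have "\<dots> \<preceq> (f \<oplus> cup y) \<Zsemi> (cap y \<oplus> ident C y)"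
    by (intro parallel_leq_cmp_left parallel_leq_tensor cup) simp_all
  also have "f \<oplus> cup y = (f \<oplus> ident C (unit_obj C)) \<Zsemi> (ident C y \<oplus> cup y)"
    by (simp add: tensor_cmp del: tensor_unit)
  also have "\<dots> \<Zsemi> (cap y \<oplus> ident C y) = f"
    by (simp add: snake arr_cmp_assoc)
  finally show "g \<preceq> f" .
qed

end

section \<open>The cartesian category of maps\<close>

lemma Map_simps [simp]:
  "obj (Map C) = obj C" "arr (Map C) = {R. is_map C R}" "src (Map C) = src C" "tgt (Map C) = tgt C"
  "ident (Map C) = ident C" "cmp (Map C) = cmp C" "unit_obj (Map C) = unit_obj C"
  "tensor_obj (Map C) = tensor_obj C" "tensor (Map C) = tensor C" "symm (Map C) = symm C"
  by (simp_all add: Map_def)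

lemma hom_Map: "f \<in> hom (Map C) x y \<longleftrightarrow> f \<in> hom C x y \<and> is_map C f"
  by (auto simp: hom_iff is_map_def)

lemma (in cartesian_bicategory) is_map_arr: "is_map C f \<Longrightarrow> f \<in> arr C"
  by (simp add: is_map_def)

text \<open>This is Fox's characterisation of cartesian categories: a map is by definition an arrow
  for which copy and discard are natural, so on maps the tensor is the product.\<close>

lemma cartesian_smc_Map:
  fixes C :: "('o, 'a) cbicat" (structure)
  assumes "cartesian_bicategory C"
  shows "cartesian_smc (Map C) (copy C) (discard C)"
proof -
  interpret cartesian_bicategory C by fact
  show ?thesis
  proof (unfold_locales, simp_all only: Map_simps hom_Map mem_Collect_eq)
    show "(f \<oplus> g) \<oplus> h = f \<oplus> (g \<oplus> h)" if "is_map C f" "is_map C g" "is_map C h" for f g h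
      using that by (simp add: is_map_arr tensor_assoc)
    show "copy C (x \<odot> y) \<Zsemi> ((ident C x \<oplus> discard C y) \<oplus> (discard C x \<oplus> ident C y)) =
        ident C (x \<odot> y)" if "x \<in> obj C" "y \<in> obj C" for x y
      using counit_tensor(3)[OF that(1) copy_hom discard_hom that(2) copy_hom discard_hom] that
      by (simp add: copy_tensor copy_unit_left copy_unit_right)
  qed (auto simp: is_map_arr is_map_ident is_map_symm is_map_copy is_map_discard copy_hom
      discard_hom ident_hom cmp_hom cmp_assoc ident_cmp cmp_ident tensor_hom interchange symm_hom
      symm_natural symm_symm symm_hexagon copy_unit_left copy_unit_right
      intro: is_map_cmp is_map_tensor dest: is_map_iff)
qed

section \<open>Quotients of terms\<close>

text \<open>The rules of \<open>prop_eq\<close> and \<open>prop_le\<close> do not type all their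
  terms. Uniqueness of types aligns the two premises of transitivity and transfers the types of
  \<open>t\<close> and \<open>u\<close> to \<open>t'\<close> and \<open>u'\<close> under
  composition.\<close>

lemma typed_unique:
  assumes "typed S t m n" "typed S t m' n'"
  shows "m = m' \<and> n = n'"
  using assms
proof (induction arbitrary: m' n' rule: typed.induct)
  case (typed_Seq t m n u p)
  from typed_Seq.prems show ?case
    by cases (use typed_Seq.IH in blast)
next
  case (typed_Par t m n u p q)
  from typed_Par.prems show ?case
    by cases (use typed_Par.IH in blast)
qed (auto elim: typed.cases)

lemma smc_law_typed:
  assumes "smc_law S t u"
  shows "\<exists>m n. typed S t m n \<and> typed S u m n"
  using assms
proof cases
  case (sym_natural s m n t' p q)
  have "typed S t (m + p) (q + n)" "typed S u (m + p) (q + n)"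
    unfolding sym_natural(1,2)
    by (rule typed_Seq typed_Par typed_symt sym_natural(3,4))+
  then show ?thesis by blast
next
  case (sym_sym m n)
  have "typed S t (m + n) (m + n)" "typed S u (m + n) (m + n)"
    unfolding sym_sym by (rule typed_Seq typed_symt typed_idt)+
  then show ?thesis by blast
next
  case (sym_hexagon m n p)
  have "typed S (symt m n \<parallel> idt p) (m + (n + p)) (n + m + p)"
    "typed S (idt n \<parallel> symt m p) (n + m + p) (n + p + m)"
    using typed_Par[OF typed_symt[of S m n] typed_idt[of S p]]
      typed_Par[OF typed_idt[of S n] typed_symt[of S m p]] by (simp_all add: ac_simps)
  then have "typed S t (m + (n + p)) (n + p + m)" "typed S u (m + (n + p)) (n + p + m)"
    unfolding sym_hexagon by (auto intro: typed_symt typed_Seq)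
  then show ?thesis by blast
next
  case (par_assoc s m n t' p q u' k l)
  have "typed S t (m + p + k) (n + q + l)" "typed S u (m + (p + k)) (n + (q + l))"
    unfolding par_assoc(1,2) by (rule typed_Par par_assoc(3-5))+
  then show ?thesis by (auto simp: add.assoc)
next
  case (id_par m n)
  then show ?thesis using typed_Par[OF typed_Id0 id_par(2)] by auto
next
  case (par_id m n)
  then show ?thesis using typed_Par[OF par_id(2) typed_Id0] by auto
qed (blast intro: typed_Seq typed_idt typed_Par)+

lemma prop_eq_typed:
  assumes "prop_eq S E t u"
    and E: "\<And>t u. (t, u) \<in> E \<Longrightarrow> \<exists>m n. typed S t m n \<and> typed S u m n"
  shows "\<exists>m n. typed S t m n \<and> typed S u m n"
  using assms(1)
proof induction
  case (prop_eq_trans s t u)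
  then show ?case using typed_unique by metis
next
  case (prop_eq_Seq t t' u u' m n p)
  then have "typed S t' m n" "typed S u' n p"
    using typed_unique by metis+
  with prop_eq_Seq(3,4) show ?case by (blast intro: typed_Seq)
next
  case (prop_eq_Par t t' u u')
  then show ?case by (blast intro: typed_Par)
qed (use E smc_law_typed in blast)+

lemma prop_le_typed:
  assumes "prop_le S I t u"
    and I: "\<And>t u. (t, u) \<in> I \<Longrightarrow> \<exists>m n. typed S t m n \<and> typed S u m n"
  shows "\<exists>m n. typed S t m n \<and> typed S u m n"
  using assms(1)
proof induction
  case (prop_le_trans s t u)
  then show ?case using typed_unique by metis
next
  case (prop_le_Seq t t' u u' m n p)
  then have "typed S t' m n" "typed S u' n p"
    using typed_unique by metis+
  with prop_le_Seq(3,4) show ?case by (blast intro: typed_Seq)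
next
  case (prop_le_Par t t' u u')
  then show ?case by (blast intro: typed_Par)
next
  case (prop_le_eq t u)
  then show ?case using prop_eq_typed[of S "{}" t u] by simp
qed (use I in blast)

text \<open>Covers both the equational congruence of the cartesian prop and the symmetric part of
  the preorder of the Frobenius prop. \<open>R\<close> is reflexive on typed terms and relates only
  such terms, so a class contains no ill-typed term.\<close>

locale prop_congruence =
  fixes S :: "'g signature" and R :: "'g trm \<Rightarrow> 'g trm \<Rightarrow> bool"
  assumes R_law: "smc_law S t u \<Longrightarrow> R t u"
    and R_refl: "typed S t m n \<Longrightarrow> R t t"
    and R_sym: "R t u \<Longrightarrow> R u t"
    and R_trans: "R s t \<Longrightarrow> R t u \<Longrightarrow> R s u"
    and R_Seq: "R t t' \<Longrightarrow> R u u' \<Longrightarrow> typed S t m n \<Longrightarrow> typed S u n p \<Longrightarrow> R (t ;; u) (t' ;; u')"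
    and R_Par: "R t t' \<Longrightarrow> R u u' \<Longrightarrow> R (t \<parallel> u) (t' \<parallel> u')"
    and R_typed: "R t u \<Longrightarrow> \<exists>m n. typed S t m n \<and> typed S u m n"
begin

abbreviation Q where "Q \<equiv> quotient_prop S R"

abbreviation tarr ("\<lbrakk>_, _, _\<rbrakk>") where "tarr m t n \<equiv> term_arrow R m t n"

lemma tarr_eqI: "R t u \<Longrightarrow> \<lbrakk>m, t, n\<rbrakk> = \<lbrakk>m, u, n\<rbrakk>"
  unfolding term_arrow_def using R_sym R_trans by blast

lemma Q_simps [simp]:
  "obj Q = UNIV" "unit_obj Q = 0" "tensor_obj Q = (+)" "ident Q n = \<lbrakk>n, idt n, n\<rbrakk>"
  "symm Q m n = \<lbrakk>m + n, symt m n, n + m\<rbrakk>"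
  "src Q \<lbrakk>m, t, n\<rbrakk> = m" "tgt Q \<lbrakk>m, t, n\<rbrakk> = n"
  by (simp_all add: quotient_prop_def term_arrow_def)

lemma arr_Q: "arr Q = {\<lbrakk>m, t, n\<rbrakk> | m t n. typed S t m n}"
  by (simp add: quotient_prop_def)

lemma tarr_arr: "typed S t m n \<Longrightarrow> \<lbrakk>m, t, n\<rbrakk> \<in> arr Q"
  by (auto simp: arr_Q)

lemma arr_Q_cases:
  assumes "f \<in> arr Q"
  obtains m t n where "typed S t m n" "f = \<lbrakk>m, t, n\<rbrakk>"
  using assms by (auto simp: arr_Q)

lemma hom_Q_cases:
  assumes "f \<in> hom Q m n"
  obtains t where "typed S t m n" "f = \<lbrakk>m, t, n\<rbrakk>"
  using assms by (auto simp: hom_def elim!: arr_Q_cases)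

lemma tarr_hom: "typed S t m n \<Longrightarrow> \<lbrakk>m, t, n\<rbrakk> \<in> hom Q m n"
  by (simp add: hom_def tarr_arr)

text \<open>Composition in \<open>Q\<close> saturates over all representatives; the congruence
  property on typed terms reduces it to one representative of each factor.\<close>

lemma tarr_Seq:
  assumes "typed S t m n" "typed S u n p"
  shows "\<lbrakk>m, t, n\<rbrakk> \<Zsemi>\<^bsub>Q\<^esub> \<lbrakk>n, u, p\<rbrakk> = \<lbrakk>m, t ;; u, p\<rbrakk>"
proof -
  have "{w. \<exists>t'\<in>{w. R t w}. \<exists>u'\<in>{w. R u w}. R (t' ;; u') w} = {w. R (t ;; u) w}"
    using R_Seq[OF _ _ assms] R_refl[OF assms(1)] R_refl[OF assms(2)] R_trans by blast
  then show ?thesis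
    by (simp add: quotient_prop_def term_arrow_def)
qed

lemma tarr_Par:
  assumes "typed S t m n" "typed S u p q"
  shows "\<lbrakk>m, t, n\<rbrakk> \<oplus>\<^bsub>Q\<^esub> \<lbrakk>p, u, q\<rbrakk> = \<lbrakk>m + p, t \<parallel> u, n + q\<rbrakk>"
proof -
  have "{w. \<exists>t'\<in>{w. R t w}. \<exists>u'\<in>{w. R u w}. R (t' \<parallel> u') w} = {w. R (t \<parallel> u) w}"
    using R_Par R_refl[OF assms(1)] R_refl[OF assms(2)] R_trans by blast
  then show ?thesis
    by (simp add: quotient_prop_def term_arrow_def)
qed

lemma idt_Par: "R (idt m \<parallel> idt n) (idt (m + n))"
proof (induction m)
  case (Suc m)
  have "R ((Id1 \<parallel> idt m) \<parallel> idt n) (Id1 \<parallel> (idt m \<parallel> idt n))"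
    by (rule R_law par_assoc typed_Id1 typed_idt)+
  moreover have "R (Id1 \<parallel> (idt m \<parallel> idt n)) (Id1 \<parallel> idt (m + n))"
    by (rule R_Par[OF R_refl[OF typed_Id1] Suc])
  ultimately show ?case using R_trans by auto
qed (auto intro: R_law id_par typed_idt)

text \<open>The recursion for \<open>symt 1 1\<close> wraps the generator \<open>Sym11\<close> in
  identities. The identification is needed because functors preserve the symmetry given by
  \<open>symt\<close>, whereas terms contain \<open>Sym11\<close>.\<close>

lemma symt_1_1: "R (symt 1 1) Sym11"
proof -
  have id1: "R (Id1 \<parallel> Id1) (idt 2)"
    using R_Par[OF R_refl[OF typed_Id1] R_sym[OF R_law[OF par_id[OF typed_Id1]]]]
    by (simp add: numeral_2_eq_2)
  have typed: "typed S (Id1 \<parallel> Id1 :: 'g trm) 2 2" "typed S (Sym11 \<parallel> Id0 :: 'g trm) 2 2"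
    using typed_Par[OF typed_Id1 typed_Id1, of S] typed_Par[OF typed_Sym11 typed_Id0, of S]
    by (simp_all add: numeral_2_eq_2)
  have "R ((Sym11 \<parallel> Id0) ;; (Id1 \<parallel> Id1)) (Sym11 ;; idt 2)"
    by (rule R_Seq[OF R_law[OF par_id[OF typed_Sym11]] id1 typed(2,1)])
  then have "R ((Sym11 \<parallel> Id0) ;; (Id1 \<parallel> Id1)) Sym11"
    using R_trans R_law[OF seq_id[OF typed_Sym11]] by blast
  then have inner: "R (((Sym11 \<parallel> Id0) ;; (Id1 \<parallel> Id1)) \<parallel> Id0) Sym11"
    using R_trans R_law[OF par_id[OF typed_Seq[OF typed(2,1)]]] by blast
  have "typed S (((Sym11 \<parallel> Id0) ;; (Id1 \<parallel> Id1)) \<parallel> Id0) 2 2"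
    using typed_Par[OF typed_Seq[OF typed(2,1)] typed_Id0] by simp
  from R_Seq[OF R_refl[OF typed_idt] inner typed_idt this]
  have "R (symt 1 1) (idt 2 ;; Sym11)"
    by (simp add: numeral_2_eq_2)
  then show ?thesis
    using R_trans R_law[OF id_seq[OF typed_Sym11]] by blast
qed

lemmas typed_intros = typed_Seq typed_Par typed_symt typed_idt

lemma symmetric_strict_monoidal_category_Q: "symmetric_strict_monoidal_category Q"
proof
  note tarr = tarr_hom tarr_Seq tarr_Par typed_intros
  fix f g h f' g' :: "'g prop_arrow" and w x y z x' y' z' :: nat
  show "ident Q x \<in> hom Q x x" for x
    by (simp add: tarr)
  show "symm Q x y \<in> hom Q (x \<odot>\<^bsub>Q\<^esub> y) (y \<odot>\<^bsub>Q\<^esub> x)"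
    by (simp add: tarr)
  show "symm Q x y \<Zsemi>\<^bsub>Q\<^esub> symm Q y x = ident Q (x \<odot>\<^bsub>Q\<^esub> y)"
    by (simp add: tarr, intro tarr_eqI R_law sym_sym)
  show "ident Q x \<oplus>\<^bsub>Q\<^esub> ident Q y = ident Q (x \<odot>\<^bsub>Q\<^esub> y)"
    by (simp add: tarr, intro tarr_eqI idt_Par)
  show "symm Q x (y \<odot>\<^bsub>Q\<^esub> z) =
      (symm Q x y \<oplus>\<^bsub>Q\<^esub> ident Q z) \<Zsemi>\<^bsub>Q\<^esub> (ident Q y \<oplus>\<^bsub>Q\<^esub> symm Q x z)"
  proof -
    have "typed S (symt x y \<parallel> idt z) (x + y + z) (y + x + z)"
      "typed S (idt y \<parallel> symt x z) (y + x + z) (y + (z + x))"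
      using typed_Par[OF typed_symt typed_idt, of S x y z]
        typed_Par[OF typed_idt typed_symt, of S y x z] by (simp_all add: add.assoc)
    from tarr_Seq[OF this] show ?thesis
      by (simp add: tarr add.assoc, intro tarr_eqI R_law sym_hexagon)
  qed
  { assume f: "f \<in> arr Q"
    then obtain m t n where t: "typed S t m n" "f = \<lbrakk>m, t, n\<rbrakk>" by (rule arr_Q_cases)
    have "ident Q (unit_obj Q) \<oplus>\<^bsub>Q\<^esub> f = \<lbrakk>m, Id0 \<parallel> t, n\<rbrakk>"
      "f \<oplus>\<^bsub>Q\<^esub> ident Q (unit_obj Q) = \<lbrakk>m, t \<parallel> Id0, n\<rbrakk>"
      using tarr_Par[OF typed_idt[of S 0] t(1)] tarr_Par[OF t(1) typed_idt[of S 0]]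
      by (simp_all add: t(2))
    then show "ident Q (unit_obj Q) \<oplus>\<^bsub>Q\<^esub> f = f" "f \<oplus>\<^bsub>Q\<^esub> ident Q (unit_obj Q) = f"
      using tarr_eqI[OF R_law[OF id_par[OF t(1)]]] tarr_eqI[OF R_law[OF par_id[OF t(1)]]]
      by (simp_all add: t(2)) }
  { assume "f \<in> arr Q" "g \<in> arr Q" "h \<in> arr Q"
    then show "f \<oplus>\<^bsub>Q\<^esub> g \<oplus>\<^bsub>Q\<^esub> h = f \<oplus>\<^bsub>Q\<^esub> (g \<oplus>\<^bsub>Q\<^esub> h)"
      by (elim arr_Q_cases) (simp add: tarr add.assoc, intro tarr_eqI R_law par_assoc) }
  { assume "f \<in> hom Q x y" "g \<in> hom Q y z"
    then show "f \<Zsemi>\<^bsub>Q\<^esub> g \<in> hom Q x z"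
      by (elim hom_Q_cases) (simp add: tarr_Seq, intro tarr_hom typed_Seq) }
  { assume "f \<in> hom Q w x" "g \<in> hom Q x y" "h \<in> hom Q y z"
    then show "f \<Zsemi>\<^bsub>Q\<^esub> g \<Zsemi>\<^bsub>Q\<^esub> h = f \<Zsemi>\<^bsub>Q\<^esub> (g \<Zsemi>\<^bsub>Q\<^esub> h)"
      by (elim hom_Q_cases) (simp add: tarr_Seq typed_Seq[of S _ w x _ y] typed_Seq[of S _ x y _ z],
        intro tarr_eqI R_law seq_assoc) }
  { assume "f \<in> hom Q x y"
    then obtain t where t: "typed S t x y" "f = \<lbrakk>x, t, y\<rbrakk>" by (rule hom_Q_cases)
    then show "ident Q x \<Zsemi>\<^bsub>Q\<^esub> f = f" "f \<Zsemi>\<^bsub>Q\<^esub> ident Q y = f"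
      using tarr_eqI[OF R_law[OF id_seq[OF t(1)]]] tarr_eqI[OF R_law[OF seq_id[OF t(1)]]]
      by (simp_all add: tarr_Seq typed_idt) }
  { assume "f \<in> hom Q x y" "g \<in> hom Q x' y'"
    then show "f \<oplus>\<^bsub>Q\<^esub> g \<in> hom Q (x \<odot>\<^bsub>Q\<^esub> x') (y \<odot>\<^bsub>Q\<^esub> y')"
      by (elim hom_Q_cases) (simp add: tarr) }
  { assume "f \<in> hom Q x y" "g \<in> hom Q y z" "f' \<in> hom Q x' y'" "g' \<in> hom Q y' z'"
    then obtain s t s' t' where st: "typed S s x y" "typed S t y z" "typed S s' x' y'"
        "typed S t' y' z'" "f = \<lbrakk>x, s, y\<rbrakk>" "g = \<lbrakk>y, t, z\<rbrakk>" "f' = \<lbrakk>x', s', y'\<rbrakk>" "g' = \<lbrakk>y', t', z'\<rbrakk>"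
      by (elim hom_Q_cases)
    show "(f \<Zsemi>\<^bsub>Q\<^esub> g) \<oplus>\<^bsub>Q\<^esub> (f' \<Zsemi>\<^bsub>Q\<^esub> g') = (f \<oplus>\<^bsub>Q\<^esub> f') \<Zsemi>\<^bsub>Q\<^esub> (g \<oplus>\<^bsub>Q\<^esub> g')"
      using tarr_Seq[OF st(1,2)] tarr_Seq[OF st(3,4)] tarr_Par[OF st(1,3)] tarr_Par[OF st(2,4)]
        tarr_Par[OF typed_Seq[OF st(1,2)] typed_Seq[OF st(3,4)]]
        tarr_Seq[OF typed_Par[OF st(1,3)] typed_Par[OF st(2,4)]]
        tarr_eqI[OF R_law[OF par_seq[OF st(1-4)]]]
      by (simp add: st(5-8)) }
  { assume "f \<in> hom Q x y" "f' \<in> hom Q x' y'"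
    then obtain s t where st: "typed S s x y" "typed S t x' y'" "f = \<lbrakk>x, s, y\<rbrakk>" "f' = \<lbrakk>x', t, y'\<rbrakk>"
      by (elim hom_Q_cases)
    show "(f \<oplus>\<^bsub>Q\<^esub> f') \<Zsemi>\<^bsub>Q\<^esub> symm Q y y' = symm Q x x' \<Zsemi>\<^bsub>Q\<^esub> (f' \<oplus>\<^bsub>Q\<^esub> f)"
      using tarr_Par[OF st(1,2)] tarr_Par[OF st(2,1)]
        tarr_Seq[OF typed_Par[OF st(1,2)] typed_symt]
        tarr_Seq[OF typed_symt typed_Par[OF st(2,1)]]
        tarr_eqI[OF R_law[OF sym_natural[OF st(1,2)]]]
      by (simp add: st(3,4)) }
qed simp_all

text \<open>An arrow stores only a class of terms, hence the choice of a representative in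
  \<open>F\<close>; \<open>resp\<close> makes the value independent of it. The interpretation
  \<open>I\<close> is left abstract so that its values may be read in a bicategory or in its
  category of maps.\<close>

lemma term_functor:
  assumes ob: "\<And>n. ob n \<in> obj C" "ob 0 = unit_obj C" "\<And>m n. ob (m + n) = ob m \<odot>\<^bsub>C\<^esub> ob n"
    and hom: "\<And>t m n. typed S t m n \<Longrightarrow> I t \<in> hom C (ob m) (ob n)"
    and resp: "\<And>t u. R t u \<Longrightarrow> I t = I u"
    and Seq: "\<And>t u. I (t ;; u) = I t \<Zsemi>\<^bsub>C\<^esub> I u" and Par: "\<And>t u. I (t \<parallel> u) = I t \<oplus>\<^bsub>C\<^esub> I u"
    and idt: "\<And>n. I (idt n) = ident C (ob n)" and symt: "\<And>m n. I (symt m n) = symm C (ob m) (ob n)"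
    and F: "omap F = ob" "amap F = (\<lambda>(m, A, n)\<in>arr Q. I (SOME t. t \<in> A))"
  shows "symmetric_strict_monoidal_functor Q C F"
    and "\<And>t m n. typed S t m n \<Longrightarrow> amap F \<lbrakk>m, t, n\<rbrakk> = I t"
proof -
  show amap: "amap F \<lbrakk>m, t, n\<rbrakk> = I t" if t: "typed S t m n" for t m n
  proof -
    have "R t (SOME u. u \<in> {u. R t u})"
      using someI[of "\<lambda>u. u \<in> {u. R t u}" t] R_refl[OF t] by simp
    then show ?thesis
      using resp tarr_arr[OF t] by (simp add: F(2) term_arrow_def)
  qed
  note amaps = amap typed_Seq typed_Par typed_idt typed_symt
  show "symmetric_strict_monoidal_functor Q C F"
    unfolding symmetric_strict_monoidal_functor_def is_functor_def
  proof (intro conjI ballI allI)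
    show "amap F \<in> extensional (arr Q)"
      by (simp add: F(2))
    show "amap F f \<in> hom C (omap F x) (omap F y)" if "f \<in> hom Q x y" for f x y
      using that by (elim hom_Q_cases) (simp add: amap hom F(1))
    show "amap F (f \<Zsemi>\<^bsub>Q\<^esub> g) = amap F f \<Zsemi>\<^bsub>C\<^esub> amap F g"
      if "f \<in> hom Q x y" "g \<in> hom Q y z" for f g x y z
      using that by (elim hom_Q_cases) (simp add: amap tarr_Seq typed_Seq[of S _ x y _ z] Seq)
    show "amap F (f \<oplus>\<^bsub>Q\<^esub> g) = amap F f \<oplus>\<^bsub>C\<^esub> amap F g" if "f \<in> arr Q" "g \<in> arr Q" for f g
      using that by (elim arr_Q_cases) (simp add: amap tarr_Par typed_Par Par)
  qed (simp_all add: amaps ob idt symt F(1))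
qed

end


section \<open>Evaluation of terms\<close>

primrec eval_term :: "('o, 'a, 'm) smcat_scheme \<Rightarrow> 'o \<Rightarrow> ('g \<Rightarrow> 'a) \<Rightarrow> 'g trm \<Rightarrow> 'a" where
  "eval_term C x g (Gen c) = g c"
| "eval_term C x g Id0 = ident C (unit_obj C)"
| "eval_term C x g Id1 = ident C x"
| "eval_term C x g Sym11 = symm C x x"
| "eval_term C x g (t ;; u) = eval_term C x g t \<Zsemi>\<^bsub>C\<^esub> eval_term C x g u"
| "eval_term C x g (t \<parallel> u) = eval_term C x g t \<oplus>\<^bsub>C\<^esub> eval_term C x g u"

text \<open>\<open>ob_0\<close> and \<open>ob_add\<close> force \<open>ob n\<close> to be the n-th
  power of \<open>ob 1\<close>. Keeping \<open>ob\<close> as a parameter allows it to be the object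
  map of a given functor.\<close>

locale term_model = symmetric_strict_monoidal_category C
  for C :: "('o, 'a, 'm) smcat_scheme" (structure) +
  fixes S :: "'g signature" and ob :: "nat \<Rightarrow> 'o" and g :: "'g \<Rightarrow> 'a"
  assumes ob_obj [simp]: "ob n \<in> obj C"
    and ob_0: "ob 0 = unit_obj C"
    and ob_add: "ob (m + n) = ob m \<odot> ob n"
    and gen_hom: "c \<in> gens S \<Longrightarrow> g c \<in> hom C (ob (arity S c)) (ob (coarity S c))"
begin

abbreviation ev where "ev \<equiv> eval_term C (ob (Suc 0)) g"

lemma ob_Suc: "ob (Suc n) = ob (Suc 0) \<odot> ob n"
  using ob_add[of 1 n] by simp

lemma ob_2: "ob 2 = ob (Suc 0) \<odot> ob (Suc 0)"
  using ob_add[of 1 1] by (simp add: numeral_2_eq_2)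

lemma ev_hom: "typed S t m n \<Longrightarrow> ev t \<in> hom C (ob m) (ob n)"
  by (induction rule: typed.induct)
    (auto simp: ob_0 ob_add ob_2 gen_hom ident_hom symm_hom intro: cmp_hom tensor_hom)

lemma ev_arr [simp]:
  assumes "typed S t m n"
  shows "ev t \<in> arr C" "src C (ev t) = ob m" "tgt C (ev t) = ob n"
  using ev_hom[OF assms] by (auto simp: hom_iff)

lemma ev_idt: "ev (idt n) = ident C (ob n)"
proof (induction n)
  case (Suc n)
  then show ?case by (simp add: ob_Suc[of n])
qed (simp add: ob_0)

lemma ev_sym1t: "ev (sym1t n) = symm C (ob (Suc 0)) (ob n)"
proof (induction n)
  case (Suc n)
  then show ?case by (simp add: ob_Suc[of n] ev_idt symm_hexagon)
qed (simp add: ob_0)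

lemma ev_symt: "ev (symt m n) = symm C (ob m) (ob n)"
proof (induction m)
  case (Suc m)
  then show ?case
    by (simp add: ob_Suc[of m] ev_sym1t ev_idt symm_hexagon_left)
qed (simp add: ob_0 ev_idt)

lemma ev_smc_law: "smc_law S t u \<Longrightarrow> ev t = ev u"
proof (induction rule: smc_law.induct)
  case (sym_natural s m n t p q)
  then show ?case
    using symm_natural[OF ev_hom[of s m n] ev_hom[of t p q]] by (simp add: ev_symt)
next
  case (par_seq s m n t p s' m' n' t' p')
  then show ?case
    by (simp add: tensor_cmp)
qed (simp_all add: arr_cmp_assoc ev_idt ev_symt symm_symm ob_add symm_hexagon tensor_assoc)

lemma ev_prop_eq_empty: "prop_eq S {} t u \<Longrightarrow> ev t = ev u"
  by (induction rule: prop_eq.induct) (simp_all add: ev_smc_law)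

end

context prop_congruence
begin

text \<open>Converse to \<open>term_functor\<close>: a strict monoidal functor out of
  \<open>Q\<close> is evaluation at its own values on generators.\<close>

lemma functor_eval_term:
  assumes "symmetric_strict_monoidal_category C" and F: "symmetric_strict_monoidal_functor Q C F"
    and g: "\<And>c. c \<in> gens S \<Longrightarrow> g c = amap F \<lbrakk>arity S c, Gen c, coarity S c\<rbrakk>"
  shows "term_model C S (omap F) g"
    and "typed S t m n \<Longrightarrow> amap F \<lbrakk>m, t, n\<rbrakk> = eval_term C (omap F (Suc 0)) g t"
proof -
  interpret C: symmetric_strict_monoidal_category C by fact
  note F = strict_monoidal_functorD[OF F]
  show "term_model C S (omap F) g"
    using F(1,5,6) F(2)[OF tarr_hom[OF typed_Gen]] by unfold_locales (simp_all add: g)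
  show "amap F \<lbrakk>m, t, n\<rbrakk> = eval_term C (omap F (Suc 0)) g t" if "typed S t m n"
    using that
  proof induction
    case typed_Id0
    then show ?case using F(3)[of 0] F(5) by simp
  next
    case typed_Id1
    \<comment> \<open>The identity of the object 1 is the class of \<open>idt 1\<close>, which is
      \<open>Id1 \<parallel> Id0\<close> and not literally \<open>Id1\<close>.\<close>
    have "R (Id1 \<parallel> Id0) Id1"
      by (rule R_law[OF par_id[OF typed.typed_Id1]])
    then show ?case using F(3)[of "Suc 0"] tarr_eqI[of "Id1 \<parallel> Id0" Id1 1 1] by simp
  next
    case typed_Sym11
    show ?case
      using F(8)[of "Suc 0" "Suc 0"] tarr_eqI[OF symt_1_1, of 2 2] by (simp add: numeral_2_eq_2)
  next
    case (typed_Seq t m n u p)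
    then show ?case
      using F(4)[OF tarr_hom tarr_hom] by (simp add: tarr_Seq)
  next
    case (typed_Par t m n u p q)
    then show ?case
      using F(7)[OF tarr_arr tarr_arr] by (simp add: tarr_Par)
  qed (simp add: g)
qed

end

text \<open>Type inference by recursion: with \<open>typed_iff\<close> the simplifier decides typing
  of concrete terms, where the inductive \<open>typed\<close> would require guessing intermediate
  objects.\<close>

primrec term_dom :: "'g signature \<Rightarrow> 'g trm \<Rightarrow> nat" where
  "term_dom S (Gen c) = arity S c"
| "term_dom S Id0 = 0"
| "term_dom S Id1 = 1"
| "term_dom S Sym11 = 2"
| "term_dom S (t ;; u) = term_dom S t"
| "term_dom S (t \<parallel> u) = term_dom S t + term_dom S u"

primrec term_cod :: "'g signature \<Rightarrow> 'g trm \<Rightarrow> nat" where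
  "term_cod S (Gen c) = coarity S c"
| "term_cod S Id0 = 0"
| "term_cod S Id1 = 1"
| "term_cod S Sym11 = 2"
| "term_cod S (t ;; u) = term_cod S u"
| "term_cod S (t \<parallel> u) = term_cod S t + term_cod S u"

primrec well_typed :: "'g signature \<Rightarrow> 'g trm \<Rightarrow> bool" where
  "well_typed S (Gen c) \<longleftrightarrow> c \<in> gens S"
| "well_typed S Id0 \<longleftrightarrow> True"
| "well_typed S Id1 \<longleftrightarrow> True"
| "well_typed S Sym11 \<longleftrightarrow> True"
| "well_typed S (t ;; u) \<longleftrightarrow> well_typed S t \<and> well_typed S u \<and> term_cod S t = term_dom S u"
| "well_typed S (t \<parallel> u) \<longleftrightarrow> well_typed S t \<and> well_typed S u"

lemma typed_iff: "typed S t m n \<longleftrightarrow> well_typed S t \<and> term_dom S t = m \<and> term_cod S t = n"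
proof
  show "typed S t m n \<Longrightarrow> well_typed S t \<and> term_dom S t = m \<and> term_cod S t = n"
    by (induction rule: typed.induct) auto
next
  have "well_typed S t \<Longrightarrow> typed S t (term_dom S t) (term_cod S t)"
    by (induction t) (auto intro: typed.intros typed_Id1[simplified])
  then show "well_typed S t \<and> term_dom S t = m \<and> term_cod S t = n \<Longrightarrow> typed S t m n"
    by blast
qed

lemma well_typed_idt [simp]:
  "well_typed S (idt n)" "term_dom S (idt n) = n" "term_cod S (idt n) = n"
  using typed_idt[of S n] by (simp_all add: typed_iff)

lemma well_typed_copyt [simp]:
  assumes "Copy \<in> X"
  shows "well_typed (extend_sig X S) (copyt n)" "term_dom (extend_sig X S) (copyt n) = n"
    "term_cod (extend_sig X S) (copyt n) = n + n"
  using typed_copyt[OF assms, of S n] by (simp_all add: typed_iff)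

lemma well_typed_discardt [simp]:
  assumes "Discard \<in> X"
  shows "well_typed (extend_sig X S) (discardt n)" "term_dom (extend_sig X S) (discardt n) = n"
    "term_cod (extend_sig X S) (discardt n) = 0"
  using typed_discardt[OF assms, of S n] by (simp_all add: typed_iff)

text \<open>Assumes on generators and at the object 1 what \<open>counital_smc\<close> demands of
  all arrows and all objects; induction over terms and over \<open>n\<close> closes the gap.\<close>

locale comonoid_term_model = term_model C "extend_sig {Copy, Discard} S" ob g
  for C :: "('o, 'a, 'm) smcat_scheme" (structure) and S :: "'s signature"
    and ob :: "nat \<Rightarrow> 'o" and g :: "'s gen \<Rightarrow> 'a" +
  assumes counit_left: "g Copy \<Zsemi> (g Discard \<oplus> ident C (ob (Suc 0))) = ident C (ob (Suc 0))"
    and counit_right: "g Copy \<Zsemi> (ident C (ob (Suc 0)) \<oplus> g Discard) = ident C (ob (Suc 0))"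
    and coarity_1: "c \<in> gens S \<Longrightarrow> coarity S c = 1"
    and discard_natural: "c \<in> gens S \<Longrightarrow>
      g (Op c) \<Zsemi> g Discard = eval_term C (ob (Suc 0)) g (discardt (arity S c))"
begin

abbreviation sig where "sig \<equiv> extend_sig {Copy, Discard} S"

lemma g_hom:
  "g Copy \<in> hom C (ob (Suc 0)) (ob (Suc 0) \<odot> ob (Suc 0))"
  "g Discard \<in> hom C (ob (Suc 0)) (unit_obj C)"
  using gen_hom[of Copy] gen_hom[of Discard] by (simp_all add: ob_2 ob_0)

lemmas g_arr [simp] = g_hom[unfolded hom_iff]

lemma ev_copyt_hom: "ev (copyt n) \<in> hom C (ob n) (ob n \<odot> ob n)"
  and ev_discardt_hom: "ev (discardt n) \<in> hom C (ob n) (unit_obj C)"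
  using ev_hom[OF typed_copyt, of n] ev_hom[OF typed_discardt, of n] by (simp_all add: ob_add ob_0)

lemma ev_discardt_arr [simp]:
  "ev (discardt n) \<in> arr C" "src C (ev (discardt n)) = ob n" "tgt C (ev (discardt n)) = unit_obj C"
  using ev_discardt_hom by (simp_all add: hom_iff)

lemma ev_discardt_add: "ev (discardt (m + n)) = ev (discardt m) \<oplus> ev (discardt n)"
proof (induction m)
  case (Suc m)
  then show ?case by (simp add: tensor_assoc)
qed simp

lemma ev_discardt_natural: "typed sig t m n \<Longrightarrow> ev t \<Zsemi> ev (discardt n) = ev (discardt m)"
proof (induction rule: typed.induct)
  case (typed_Gen c)
  then consider b where "c = Op b" "b \<in> gens S" | "c = Copy" | "c = Discard"
    by auto
  then show ?case
  proof cases
    case 1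
    then show ?thesis by (simp add: coarity_1 discard_natural)
  next
    case 2
    \<comment> \<open>Discarding both outputs of a copy is split into two stages, so that the counit
      law removes the first one and a single discard remains.\<close>
    have "g Discard \<oplus> g Discard =
        (g Discard \<oplus> ident C (ob (Suc 0))) \<Zsemi> (ident C (unit_obj C) \<oplus> g Discard)"
      by (subst tensor_cmp) simp_all
    then have "g Copy \<Zsemi> (g Discard \<oplus> g Discard) =
        (g Copy \<Zsemi> (g Discard \<oplus> ident C (ob (Suc 0)))) \<Zsemi> g Discard"
      by (simp add: arr_cmp_assoc)
    with 2 show ?thesis by (simp add: counit_left numeral_2_eq_2)
  qed simp
next
  case (typed_Seq t m n u p)
  then show ?case by (simp add: arr_cmp_assoc)
next
  case (typed_Par t m n u p q)
  then show ?case by (simp add: ev_discardt_add tensor_cmp)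
next
  case typed_Sym11
  then show ?case
    using arr_symm_natural[of "g Discard" "g Discard"] by (simp add: numeral_2_eq_2)
qed simp_all

text \<open>Both laws go through the induction together, since \<open>counit_tensor\<close> takes
  both laws of both factors as premises.\<close>

lemma ev_copyt_counit:
  "ev (copyt n) \<Zsemi> (ev (discardt n) \<oplus> ident C (ob n)) = ident C (ob n)"
  "ev (copyt n) \<Zsemi> (ident C (ob n) \<oplus> ev (discardt n)) = ident C (ob n)"
proof (induction n)
  case 0
  case 1 show ?case by (simp add: ob_0)
  case 2 show ?case by (simp add: ob_0)
next
  case (Suc n)
  note counit = counit_tensor[OF ob_obj g_hom ob_obj ev_copyt_hom ev_discardt_hom
    counit_left Suc(1) counit_right Suc(2)]
  have eq: "ev (copyt (Suc n)) = (g Copy \<oplus> ev (copyt n)) \<Zsemi>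
      (ident C (ob (Suc 0)) \<oplus> symm C (ob (Suc 0)) (ob n) \<oplus> ident C (ob n))"
    "ev (discardt (Suc n)) = g Discard \<oplus> ev (discardt n)"
    using ev_symt[of "Suc 0" n] by (simp_all add: ev_idt)
  case 1 show ?case using counit(1) unfolding eq ob_Suc[of n] .
  case 2 show ?case using counit(2) unfolding eq ob_Suc[of n] .
qed

end

section \<open>The two presentations of a theory and the passage between their congruences\<close>

locale cartesian_theory_locale =
  fixes S :: "'s signature" and E :: "('s gen trm \<times> 's gen trm) set"
  assumes cartesian_theory: "cartesian_theory (S, E)"
begin

abbreviation sigL where "sigL \<equiv> extend_sig {Copy, Discard} S"
abbreviation sigF where "sigF \<equiv> extend_sig {Copy, Discard, Merge, Create} S"
abbreviation axL where "axL \<equiv> comonoid_laws \<union> naturality_laws S \<union> E"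
abbreviation axF where "axF \<equiv> CW_laws \<union> LCH_laws S \<union> (E \<union> E\<inverse> \<union> OLCH_laws S)"
abbreviation eqL where "eqL \<equiv> prop_eq sigL axL"
abbreviation leF where "leF \<equiv> prop_le sigF axF"
abbreviation eqF where "eqF \<equiv> \<lambda>t u. leF t u \<and> leF u t"

lemma coarity_1: "c \<in> gens S \<Longrightarrow> coarity S c = 1"
  using cartesian_theory by (simp add: cartesian_theory_def)

lemma E_typed: "(t, u) \<in> E \<Longrightarrow> \<exists>n. typed sigL t n 1 \<and> typed sigL u n 1"
  using cartesian_theory by (auto simp: cartesian_theory_def)

lemma typed_sigL_sigF: "typed sigL t m n \<Longrightarrow> typed sigF t m n"
  by (erule typed_mono) auto

lemma axL_typed: "(t, u) \<in> axL \<Longrightarrow> \<exists>m n. typed sigL t m n \<and> typed sigL u m n"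
proof (elim UnE)
  show "(t, u) \<in> E \<Longrightarrow> ?thesis"
    using E_typed by blast
qed (auto simp: typed_iff comonoid_laws_def naturality_laws_def coarity_1)

lemma axF_typed: "(t, u) \<in> axF \<Longrightarrow> \<exists>m n. typed sigF t m n \<and> typed sigF u m n"
proof -
  have E: "\<exists>m n. typed sigF t m n \<and> typed sigF u m n" if "(t, u) \<in> E" for t u
    using E_typed[OF that] typed_sigL_sigF by blast
  show "(t, u) \<in> axF \<Longrightarrow> ?thesis"
  proof (elim UnE)
    show "(t, u) \<in> CW_laws \<Longrightarrow> ?thesis"
      unfolding CW_laws_def comonoid_laws_def monoid_laws_def Let_def
      by (elim UnE insertE emptyE converseE) (simp_all add: typed_iff)
    show "(t, u) \<in> LCH_laws S \<Longrightarrow> ?thesis" "(t, u) \<in> OLCH_laws S \<Longrightarrow> ?thesis"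
      by (auto simp: typed_iff LCH_laws_def OLCH_laws_def coarity_1)
    show "(t, u) \<in> E \<Longrightarrow> ?thesis" "(t, u) \<in> E\<inverse> \<Longrightarrow> ?thesis"
      using E[of t u] E[of u t] by blast+
  qed
qed

sublocale L: prop_congruence sigL eqL
proof
  show "eqL t u \<Longrightarrow> \<exists>m n. typed sigL t m n \<and> typed sigL u m n" for t u
    by (rule prop_eq_typed[OF _ axL_typed])
qed (rule prop_eq.intros; assumption)+

sublocale F: prop_congruence sigF eqF
proof
  show "eqF t u \<Longrightarrow> \<exists>m n. typed sigF t m n \<and> typed sigF u m n" for t u
    by (rule prop_le_typed[OF _ axF_typed]) blast
  show "eqF t u" if "smc_law sigF t u" for t u
    using that by (blast intro: prop_le_eq prop_eq_law prop_eq_sym)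
  show "eqF t t" if "typed sigF t m n" for t m n
    using that by (blast intro: prop_le_eq prop_eq_refl)
  show "eqF (t ;; u) (t' ;; u')"
    if "eqF t t'" "eqF u u'" "typed sigF t m n" "typed sigF u n p" for t t' u u' m n p
  proof -
    \<comment> \<open>The reverse inequation composes \<open>t'\<close> with \<open>u'\<close>,
      whose types are read off from the inequations.\<close>
    have "typed sigF t' m n" "typed sigF u' n p"
      using that prop_le_typed[OF _ axF_typed] typed_unique by metis+
    with that show ?thesis by (blast intro: prop_le_Seq)
  qed
qed (blast intro: prop_le_trans prop_le_Par)+

text \<open>Bridges two conventions: \<open>LCH_laws\<close> and \<open>cartesian_bifunctor\<close>
  refer to \<open>copyt 1\<close>, whereas \<open>naturality_laws\<close> and
  \<open>OLCH_laws\<close> refer to the generator \<open>Copy\<close>.\<close>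

lemma eqF_copyt_1: "eqF (copyt 1) (Gen Copy)"
proof -
  have id: "eqF (idt 1) Id1"
    using F.R_law[OF par_id[OF typed_Id1]] by simp
  have symt: "eqF (symt 1 0) Id1"
  proof -
    have "typed sigF (idt 1) 1 1"
      by (rule typed_idt)
    then have "eqF (idt 1 ;; idt 1) Id1"
      using F.R_law[OF id_seq] id F.R_trans by blast
    then show ?thesis by simp
  qed
  have copy: "typed sigF (Gen Copy) 1 2"
    by (simp add: typed_iff)
  have mid: "eqF ((Id1 \<parallel> symt 1 0) \<parallel> idt 0) (idt 2)"
  proof -
    have "typed sigF (Id1 \<parallel> symt 1 0) 2 2"
      using typed_symt[of sigF 1 0] by (simp add: typed_iff)
    then have "eqF ((Id1 \<parallel> symt 1 0) \<parallel> idt 0) (Id1 \<parallel> symt 1 0)"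
      using F.R_law[OF par_id] by simp
    moreover have "eqF (Id1 \<parallel> symt 1 0) (Id1 \<parallel> idt 1)"
      using F.R_Par[OF F.R_refl[OF typed_Id1] F.R_trans[OF symt F.R_sym[OF id]]] .
    ultimately have "eqF ((Id1 \<parallel> symt 1 0) \<parallel> idt 0) (Id1 \<parallel> idt 1)"
      by (rule F.R_trans)
    then show ?thesis by (simp add: numeral_2_eq_2)
  qed
  have "eqF ((Gen Copy \<parallel> Id0) ;; ((Id1 \<parallel> symt 1 0) \<parallel> idt 0)) (Gen Copy ;; idt 2)"
    using typed_symt[of sigF 1 0]
    by (intro F.R_Seq[OF F.R_law[OF par_id[OF copy]] mid, of 1 2 2]) (simp_all add: typed_iff)
  from F.R_trans[OF this F.R_law[OF seq_id[OF copy]]] show ?thesis by simp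
qed

lemma eqF_discardt_1: "eqF (discardt 1) (Gen Discard)"
proof -
  have "typed sigF (Gen Discard) 1 0"
    by (simp add: typed_iff)
  from F.R_law[OF par_id[OF this]] show ?thesis by simp
qed

text \<open>Well-definedness of the evident functor from the cartesian to the Frobenius prop. Each
  naturality law of a generator is assembled from one inequation of \<open>LCH_laws\<close> and its
  reverse in \<open>OLCH_laws\<close>; the equations \<open>E\<close> occur in both
  directions.\<close>

lemma eqL_imp_eqF: "eqL t u \<Longrightarrow> eqF t u"
proof (induction rule: prop_eq.induct)
  case (prop_eq_law t u)
  have "smc_law sigF t u"
    using prop_eq_law by cases (auto intro: smc_law.intros typed_sigL_sigF)
  then show ?case by (rule F.R_law)
next
  case (prop_eq_ax t u)
  show ?case using prop_eq_ax
  proof (elim UnE)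
    assume "(t, u) \<in> comonoid_laws"
    then show ?case by (auto simp: CW_laws_def intro: prop_le_ax)
  next
    assume "(t, u) \<in> E"
    then show ?case by (auto intro: prop_le_ax)
  next
    assume "(t, u) \<in> naturality_laws S"
    then obtain c where c: "c \<in> gens S" and
      tu: "(t, u) = (Gen (Op c) ;; Gen Copy, copyt (arity S c) ;; (Gen (Op c) \<parallel> Gen (Op c))) \<or>
        (t, u) = (Gen (Op c) ;; Gen Discard, discardt (arity S c))"
      unfolding naturality_laws_def by blast
    have op: "typed sigF (Gen (Op c)) (arity S c) 1"
      and cd: "typed sigF (Gen Copy) 1 2" "typed sigF (Gen Discard) 1 0"
      using c by (simp_all add: typed_iff coarity_1)
    \<comment> \<open>\<open>LCH_laws\<close> at coarity 1 is stated with \<open>copyt 1\<close> and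
      \<open>discardt 1\<close>, so the generators are first replaced by these.\<close>
    have "eqF (Gen (Op c) ;; Gen Copy) (Gen (Op c) ;; copyt 1)"
      "eqF (Gen (Op c) ;; Gen Discard) (Gen (Op c) ;; discardt 1)"
      by (rule F.R_Seq[OF F.R_refl[OF op] F.R_sym op] eqF_copyt_1 eqF_discardt_1 cd)+
    moreover have "(Gen (Op c) ;; copyt 1, copyt (arity S c) ;; (Gen (Op c) \<parallel> Gen (Op c))) \<in> axF"
      "(Gen (Op c) ;; discardt 1, discardt (arity S c)) \<in> axF"
      "(copyt (arity S c) ;; (Gen (Op c) \<parallel> Gen (Op c)), Gen (Op c) ;; Gen Copy) \<in> axF"
      "(discardt (arity S c), Gen (Op c) ;; Gen Discard) \<in> axF"
      using c coarity_1[OF c] unfolding LCH_laws_def OLCH_laws_def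
      by (intro UnI1 UnI2 CollectI; force)+
    ultimately show ?case
      using tu by (blast intro: prop_le_ax prop_le_trans)
  qed
next
  case (prop_eq_refl t m n)
  then show ?case using F.R_refl typed_sigL_sigF by blast
next
  case (prop_eq_trans s t u)
  then show ?case using F.R_trans by blast
next
  case (prop_eq_Seq t t' u u' m n p)
  then show ?case using F.R_Seq typed_sigL_sigF by blast
next
  case (prop_eq_Par t t' u u')
  then show ?case using F.R_Par by blast
qed blast

end

section \<open>Models of the Frobenius theory\<close>

text \<open>The data on which the two kinds of models meet: \<open>car_model_eval\<close> and
  \<open>frob_model_eval\<close> extract it, \<open>eval_functor_L\<close> and
  \<open>eval_functor_F\<close> turn it back into a model.\<close>

locale frobenius_term_model = cartesian_bicategory C + cartesian_theory_locale S E +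
  term_model C "extend_sig {Copy, Discard, Merge, Create} S" ob g
  for C :: "('o, 'a, 'm) cbicat_scheme" (structure) and S :: "'s signature" and E
    and ob :: "nat \<Rightarrow> 'o" and g :: "'s gen \<Rightarrow> 'a" +
  assumes g_Copy [simp]: "g Copy = copy C (ob (Suc 0))"
    and g_Discard [simp]: "g Discard = discard C (ob (Suc 0))"
    and g_Merge [simp]: "g Merge = merge C (ob (Suc 0))"
    and g_Create [simp]: "g Create = create C (ob (Suc 0))"
    and g_Op_map: "c \<in> gens S \<Longrightarrow> is_map C (g (Op c))"
    and ev_E: "(t, u) \<in> E \<Longrightarrow> eval_term C (ob (Suc 0)) g t = eval_term C (ob (Suc 0)) g u"
begin

lemma g_Op_hom: "c \<in> gens S \<Longrightarrow> g (Op c) \<in> hom C (ob (arity S c)) (ob (Suc 0))"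
  using gen_hom[of "Op c"] by (simp add: coarity_1)

lemma ev_copyt: "ev (copyt n) = copy C (ob n)"
proof (induction n)
  case (Suc n)
  then show ?case
    using ev_symt[of "Suc 0" n] copy_tensor[of "ob (Suc 0)" "ob n"]
    by (simp add: ev_idt ob_Suc[of n])
qed (simp add: ob_0)

lemma ev_discardt: "ev (discardt n) = discard C (ob n)"
proof (induction n)
  case (Suc n)
  then show ?case by (simp add: ob_Suc[of n] discard_tensor)
qed (simp add: ob_0)

text \<open>\<open>CW_laws\<close> are axioms of the bicategory and \<open>LCH_laws\<close> hold for
  every arrow; that the generators are interpreted by maps is used exactly for
  \<open>OLCH_laws\<close>.\<close>

lemma ev_ax: "(t, u) \<in> axF \<Longrightarrow> ev t \<preceq> ev u"
proof (elim UnE)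
  let ?x = "ob (Suc 0)"
  have x: "?x \<in> obj C"
    by simp
  have E: "ev t \<preceq> ev u" if tu: "(t, u) \<in> E \<or> (u, t) \<in> E" for t u
  proof -
    obtain n where "typed sigF t n 1"
      using tu E_typed typed_sigL_sigF by blast
    then have "ev t \<in> arr C"
      by simp
    then show ?thesis
      using tu ev_E[of t u] ev_E[of u t] by auto
  qed
  then show "(t, u) \<in> E \<Longrightarrow> ?thesis" "(t, u) \<in> E\<inverse> \<Longrightarrow> ?thesis"
    by auto
  show "(t, u) \<in> CW_laws \<Longrightarrow> ?thesis"
    unfolding CW_laws_def comonoid_laws_def monoid_laws_def Let_def
    by (elim UnE insertE emptyE converseE)
      (simp_all add: copy_assoc[OF x] copy_unit_left[OF x] copy_unit_right[OF x] copy_comm[OF x]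
        merge_assoc[OF x] merge_unit_left[OF x] merge_unit_right[OF x] merge_comm[OF x]
        frobenius_left[OF x] frobenius_right[OF x] ev_idt ob_2 ob_0 arr_merge_copy[OF x]
        arr_copy_merge[OF x] arr_create_discard[OF x] arr_discard_create[OF x])
  show "(t, u) \<in> LCH_laws S \<Longrightarrow> ?thesis"
    using arr_lax_copy[OF g_Op_hom] arr_lax_discard[OF g_Op_hom]
    by (auto simp: LCH_laws_def coarity_1 ev_copyt[of "Suc 0"] ev_discardt[of "Suc 0"] ev_copyt
        ev_discardt simp del: copyt.simps discardt.simps)
  show "(t, u) \<in> OLCH_laws S \<Longrightarrow> ?thesis"
    using g_Op_hom g_Op_map is_map_iff[OF g_Op_hom]
    by (auto simp: OLCH_laws_def ev_copyt ev_discardt hom_iff)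
qed

lemma ev_le: "leF t u \<Longrightarrow> ev t \<preceq> ev u"
proof (induction rule: prop_le.induct)
  case (prop_le_eq t u)
  then obtain m n where "typed sigF t m n"
    using prop_eq_typed[of sigF "{}" t u] by auto
  then show ?case using ev_prop_eq_empty[OF prop_le_eq] by (metis ev_arr(1) parallel_leq_refl)
next
  case (prop_le_ax t u)
  then show ?case by (rule ev_ax)
next
  case (prop_le_trans s t u)
  then show ?case using parallel_leq_trans by blast
next
  case (prop_le_Seq t t' u u' m n p)
  then show ?case by (simp add: parallel_leq_cmp)
next
  case (prop_le_Par t t' u u')
  then show ?case by (simp add: parallel_leq_tensor)
qed

lemma ev_eqF: "eqF t u \<Longrightarrow> ev t = ev u"
  using ev_le parallel_leq_antisym by blast

lemma ev_is_map: "typed sigL t m n \<Longrightarrow> is_map C (ev t)"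
proof (induction rule: typed.induct)
  case (typed_Gen c)
  then show ?case by (auto simp: g_Op_map is_map_copy is_map_discard)
next
  case (typed_Seq t m n u p)
  then show ?case using is_map_cmp[OF ev_hom _ ev_hom] typed_sigL_sigF by (metis eval_term.simps(5))
next
  case (typed_Par t m n u p q)
  then show ?case
    using is_map_tensor[OF ev_hom _ ev_hom] typed_sigL_sigF by (metis eval_term.simps(6))
qed (simp_all add: is_map_ident is_map_symm)

end

lemma frobenius_prop_of_cartesian:
  "frobenius_prop (frobenius_of_cartesian (S, E)) =
    (let S' = extend_sig {Copy, Discard, Merge, Create} S;
        le = prop_le S' (CW_laws \<union> LCH_laws S \<union> (E \<union> E\<inverse> \<union> OLCH_laws S));
        R = (\<lambda>t u. le t u \<and> le u t)
    in smcat.extend (quotient_prop S' R) (cbicat.fields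
      (\<lambda>(m, A, n) (m', B, n'). m = m' \<and> n = n' \<and> (\<exists>t\<in>A. \<exists>u\<in>B. le t u))
      (\<lambda>n. term_arrow R n (copyt n) (n + n))
      (\<lambda>n. term_arrow R n (discardt n) 0)
      (\<lambda>n. term_arrow R (n + n) (merget n) n)
      (\<lambda>n. term_arrow R 0 (createt n) n)))"
  by (simp add: frobenius_prop_def frobenius_of_cartesian_def)

section \<open>The syntactic props and the functors out of them\<close>

context cartesian_theory_locale
begin

abbreviation Fr where "Fr \<equiv> frobenius_prop (frobenius_of_cartesian (S, E))"

lemma cartesian_prop_eq: "cartesian_prop (S, E) = L.Q"
  by (simp add: cartesian_prop_def free_prop_def)

lemma Fr_simps [simp]:
  "obj Fr = obj F.Q" "arr Fr = arr F.Q" "src Fr = src F.Q" "tgt Fr = tgt F.Q"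
  "ident Fr = ident F.Q" "cmp Fr = cmp F.Q" "unit_obj Fr = unit_obj F.Q"
  "tensor_obj Fr = tensor_obj F.Q" "tensor Fr = tensor F.Q" "symm Fr = symm F.Q"
  "copy Fr n = term_arrow eqF n (copyt n) (n + n)"
  "discard Fr n = term_arrow eqF n (discardt n) 0"
  by (simp_all add: frobenius_prop_of_cartesian Let_def smcat.defs cbicat.defs)

lemma hom_Fr [simp]: "hom Fr = hom F.Q"
  by (simp add: fun_eq_iff hom_def)

lemma leq_Fr: "leq Fr (term_arrow eqF m t n) (term_arrow eqF m u n) \<longleftrightarrow>
    (\<exists>t' u'. eqF t t' \<and> eqF u u' \<and> leF t' u')"
  by (auto simp: frobenius_prop_of_cartesian Let_def smcat.defs cbicat.defs term_arrow_def)

lemma strict_monoidal_functor_Fr: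
  "symmetric_strict_monoidal_functor Fr C F \<longleftrightarrow> symmetric_strict_monoidal_functor F.Q C F"
  unfolding symmetric_strict_monoidal_functor_def is_functor_def Fr_simps hom_Fr ..

text \<open>The identity functor exhibits evaluation in the prop itself as sending a term to its own
  class. Thus the axioms become equations between evaluations, and
  \<open>comonoid_term_model\<close> applies to the syntactic prop.\<close>

lemma counital_L:
  "counital_smc L.Q (\<lambda>n. term_arrow eqL n (copyt n) (n + n)) (\<lambda>n. term_arrow eqL n (discardt n) 0)"
proof -
  interpret Q: symmetric_strict_monoidal_category L.Q
    by (rule L.symmetric_strict_monoidal_category_Q)
  let ?I = "\<lparr>omap = \<lambda>n. n, amap = \<lambda>f\<in>arr L.Q. f\<rparr> :: (nat, 's gen prop_arrow, nat, 's gen prop_arrow) func"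
  let ?g = "\<lambda>c. term_arrow eqL (arity sigL c) (Gen c) (coarity sigL c)"
  have gen: "?g c = amap ?I (?g c)" if "c \<in> gens sigL" for c
    using L.tarr_arr[OF typed_Gen[OF that]] by simp
  have I: "symmetric_strict_monoidal_functor L.Q L.Q ?I"
    unfolding symmetric_strict_monoidal_functor_def is_functor_def
  proof (intro conjI ballI allI)
    show "amap ?I (f \<Zsemi>\<^bsub>L.Q\<^esub> h) = amap ?I f \<Zsemi>\<^bsub>L.Q\<^esub> amap ?I h"
      if "f \<in> hom L.Q x y" "h \<in> hom L.Q y z" for f h x y z
      using that Q.cmp_hom[OF that] by (simp add: hom_iff)
  qed (simp_all add: hom_iff L.tarr_arr typed_idt typed_symt Q.arr_tensor)
  note eval = L.functor_eval_term[OF L.symmetric_strict_monoidal_category_Q I gen]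
  interpret M: term_model L.Q sigL "\<lambda>n. n" ?g
    using eval(1) by simp
  have ev: "M.ev t = term_arrow eqL m t n" if "typed sigL t m n" for t m n
    using eval(2)[OF _ that] L.tarr_arr[OF that] by simp
  have ev_eq: "M.ev t = M.ev u" if "(t, u) \<in> axL" for t u
  proof -
    have eq: "eqL t u"
      using that by (rule prop_eq_ax)
    then obtain m n where "typed sigL t m n" "typed sigL u m n"
      using L.R_typed by blast
    then show ?thesis
      using L.tarr_eqI[OF eq] by (simp add: ev)
  qed
  interpret M: comonoid_term_model L.Q S "\<lambda>n. n" ?g
  proof
    show "?g Copy \<Zsemi>\<^bsub>L.Q\<^esub> (?g Discard \<oplus>\<^bsub>L.Q\<^esub> ident L.Q (Suc 0)) = ident L.Q (Suc 0)"
      using ev_eq[of "Gen Copy ;; (Gen Discard \<parallel> Id1)" Id1] by (simp add: comonoid_laws_def)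
    show "?g Copy \<Zsemi>\<^bsub>L.Q\<^esub> (ident L.Q (Suc 0) \<oplus>\<^bsub>L.Q\<^esub> ?g Discard) = ident L.Q (Suc 0)"
      using ev_eq[of "Gen Copy ;; (Id1 \<parallel> Gen Discard)" Id1] by (simp add: comonoid_laws_def)
    show "?g (Op c) \<Zsemi>\<^bsub>L.Q\<^esub> ?g Discard = eval_term L.Q (Suc 0) ?g (discardt (arity S c))"
      if "c \<in> gens S" for c
      using ev_eq[of "Gen (Op c) ;; Gen Discard" "discardt (arity S c)"] that
      by (auto simp: naturality_laws_def)
  qed (rule coarity_1)
  have ev_copyt: "M.ev (copyt n) = term_arrow eqL n (copyt n) (n + n)"
    and ev_discardt: "M.ev (discardt n) = term_arrow eqL n (discardt n) 0" for n
    by (rule ev; simp add: typed_iff)+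
  show ?thesis
  proof
    show "f \<Zsemi>\<^bsub>L.Q\<^esub> term_arrow eqL y (discardt y) 0 = term_arrow eqL x (discardt x) 0"
      if "f \<in> hom L.Q x y" for f x y
      using that
    proof (rule L.hom_Q_cases)
      fix t assume t: "typed sigL t x y" "f = term_arrow eqL x t y"
      show ?thesis
        using M.ev_discardt_natural[OF t(1)] unfolding ev_discardt ev[OF t(1)] t(2) .
    qed
  qed (use M.ev_copyt_hom M.ev_discardt_hom M.ev_copyt_counit in
      \<open>simp_all add: ev_copyt ev_discardt\<close>)
qed

end

definition eval_functor where
  "eval_functor C S R ob g = \<lparr>omap = ob,
    amap = (\<lambda>(m, A, n)\<in>arr (quotient_prop S R). eval_term C (ob (Suc 0)) g (SOME t. t \<in> A))\<rparr>"

lemma omap_eval_functor [simp]: "omap (eval_functor C S R ob g) = ob"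
  by (simp add: eval_functor_def)

context frobenius_term_model
begin

lemma eval_functor_F:
  shows "cartesian_bifunctor Fr C (eval_functor C sigF eqF ob g)"
    and "typed sigF t m n \<Longrightarrow> amap (eval_functor C sigF eqF ob g) (term_arrow eqF m t n) = ev t"
proof -
  let ?F = "eval_functor C sigF eqF ob g"
  have F: "omap ?F = ob" "amap ?F = (\<lambda>(m, A, n)\<in>arr F.Q. ev (SOME t. t \<in> A))"
    by (simp_all add: eval_functor_def)
  note ftr = F.term_functor[of ob C ev ?F, OF ob_obj ob_0 ob_add ev_hom ev_eqF
      eval_term.simps(5) eval_term.simps(6) ev_idt ev_symt F]
  show amap: "amap ?F (term_arrow eqF m t n) = ev t" if "typed sigF t m n" for t m n
    using ftr(2) that by blast
  show "cartesian_bifunctor Fr C ?F"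
    unfolding cartesian_bifunctor_def strict_monoidal_functor_Fr
  proof (intro conjI ballI allI impI)
    show "symmetric_strict_monoidal_functor F.Q C ?F"
      using ftr(1) by blast
    show "amap ?F f \<sqsubseteq> amap ?F h"
      if fh: "f \<in> hom Fr x y" "h \<in> hom Fr x y" and le: "f \<sqsubseteq>\<^bsub>Fr\<^esub> h" for x y f h
    proof -
      obtain t u where t: "typed sigF t x y" "f = term_arrow eqF x t y"
        and u: "typed sigF u x y" "h = term_arrow eqF x u y"
        using fh by (auto elim!: F.hom_Q_cases)
      \<comment> \<open>The order on classes is witnessed by some representatives; equivalence
        carries it back to \<open>t\<close> and \<open>u\<close>.\<close>
      then have "leF t u"
        using le by (auto simp: leq_Fr intro: prop_le_trans)
      then show ?thesis
        using parallel_leqD(5)[OF ev_le] t u by (simp add: amap)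
    qed
  qed (simp_all add: amap typed_iff ev_copyt ev_discardt)
qed

end

text \<open>\<open>Map C\<close> shares all operations with \<open>C\<close>, so the same evaluation
  is used, with \<open>ev_is_map\<close> placing its values among the maps. Product preservation
  then follows from strict monoidality.\<close>

lemma eval_functor_L:
  fixes C :: "('o, 'a) cbicat"
  assumes "frobenius_term_model C S E ob g"
  defines "sigL \<equiv> extend_sig {Copy, Discard} S"
  defines "eqL \<equiv> prop_eq sigL (comonoid_laws \<union> naturality_laws S \<union> E)"
  shows "product_preserving_functor (cartesian_prop (S, E)) (Map C) (eval_functor C sigL eqL ob g)"
    and "typed sigL t m n \<Longrightarrow> amap (eval_functor C sigL eqL ob g) (term_arrow eqL m t n) =
      eval_term C (ob (Suc 0)) g t"
proof -
  interpret frobenius_term_model C S E ob g by fact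
  let ?F = "eval_functor C sigL eqL ob g"
  have F: "omap ?F = ob" "amap ?F = (\<lambda>(m, A, n)\<in>arr L.Q. ev (SOME t. t \<in> A))"
    by (simp_all add: eval_functor_def sigL_def eqL_def)
  have "ev t \<in> hom (Map C) (ob m) (ob n)" if "typed (extend_sig {Copy, Discard} S) t m n" for t m n
    using ev_hom[OF typed_sigL_sigF[OF that]] ev_is_map[OF that] by (simp add: hom_Map)
  note ftr = L.term_functor[of ob "Map C" ev ?F, unfolded Map_simps, OF ob_obj ob_0 ob_add
      this ev_eqF[OF eqL_imp_eqF] eval_term.simps(5) eval_term.simps(6) ev_idt ev_symt F]
  show "amap ?F (term_arrow eqL m t n) = ev t" if "typed sigL t m n"
    using ftr(2) that unfolding sigL_def eqL_def by blast
  have strict: "symmetric_strict_monoidal_functor L.Q (Map C) ?F"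
    using ftr(1) by blast
  show "product_preserving_functor (cartesian_prop (S, E)) (Map C) ?F"
    unfolding product_preserving_functor_def cartesian_prop_eq
    using strict strict_monoidal_functor_preserves_finite_products[OF counital_L
      cartesian_smc_Map[OF cartesian_bicategory_axioms] strict] by blast
qed

lemma func_eqI:
  fixes F G :: "('o, 'a, 'p, 'b) func"
  assumes "omap F = omap G" "amap F \<in> extensional A" "amap G \<in> extensional A"
    and "\<And>f. f \<in> A \<Longrightarrow> amap F f = amap G f"
  shows "F = G"
  using assms extensionalityI[of "amap F" A "amap G"] by simp

lemma eval_term_Map: "eval_term (Map C) x g t = eval_term C x g t"
  by (induction t) simp_all

text \<open>Naturality is assumed at the operations only. At \<open>Copy\<close> and
  \<open>Discard\<close> it holds because the components are maps, at \<open>Merge\<close> and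
  \<open>Create\<close> every arrow is lax, and lax squares paste along both compositions.\<close>

lemma lax_natural_on_terms:
  fixes C :: "('o, 'a, 'm) cbicat_scheme" (structure)
  assumes "frobenius_term_model C S E ob g" "frobenius_term_model C S E ob' g'"
    and hom: "\<And>n. \<alpha> n \<in> hom C (ob n) (ob' n)" and map: "\<And>n. is_map C (\<alpha> n)"
    and add: "\<And>m n. \<alpha> (m + n) = \<alpha> m \<oplus> \<alpha> n" and zero: "\<alpha> 0 = ident C (unit_obj C)"
    and Op: "\<And>c. c \<in> gens S \<Longrightarrow> g (Op c) \<Zsemi> \<alpha> (Suc 0) = \<alpha> (arity S c) \<Zsemi> g' (Op c)"
    and t: "typed (extend_sig {Copy, Discard, Merge, Create} S) t m n"
  shows "poset_enriched_smc.parallel_leq C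
    (eval_term C (ob (Suc 0)) g t \<Zsemi> \<alpha> n) (\<alpha> m \<Zsemi> eval_term C (ob' (Suc 0)) g' t)"
proof -
  interpret M: frobenius_term_model C S E ob g by fact
  interpret M': frobenius_term_model C S E ob' g' by fact
  have \<alpha> [simp]: "\<alpha> n \<in> arr C" "src C (\<alpha> n) = ob n" "tgt C (\<alpha> n) = ob' n" for n
    using hom[of n] by (simp_all add: hom_iff)
  have two: "\<alpha> 2 = \<alpha> (Suc 0) \<oplus> \<alpha> (Suc 0)"
    using add[of "Suc 0" "Suc 0"] by (simp add: numeral_2_eq_2)
  have map1: "\<alpha> (Suc 0) \<Zsemi> copy C (ob' (Suc 0)) = copy C (ob (Suc 0)) \<Zsemi> (\<alpha> (Suc 0) \<oplus> \<alpha> (Suc 0))"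
    "\<alpha> (Suc 0) \<Zsemi> discard C (ob' (Suc 0)) = discard C (ob (Suc 0))"
    using map[of "Suc 0"] M.is_map_iff[OF hom] by simp_all
  from t show ?thesis
  proof (induction rule: typed.induct)
    case (typed_Gen c)
    then consider b where "c = Op b" "b \<in> gens S" | "c = Copy" | "c = Discard" | "c = Merge" | "c = Create"
      by auto
    then show ?case
    proof cases
      case 1
      then show ?thesis
        using M'.g_Op_hom[of b] by (simp add: M.coarity_1 Op hom_iff)
    next
      case 4
      then show ?thesis
        using M.arr_lax_merge[OF hom[of "Suc 0"]] by (simp add: two)
    next
      case 5
      then show ?thesis
        using M.arr_lax_create[OF hom[of "Suc 0"]] by (simp add: zero)
    qed (simp_all add: two map1 zero)
  next
    case (typed_Seq t m n u p)
    have "M.ev (t ;; u) \<Zsemi> \<alpha> p = M.ev t \<Zsemi> (M.ev u \<Zsemi> \<alpha> p)"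
      using typed_Seq by (simp add: M.arr_cmp_assoc)
    also have "M.parallel_leq (M.ev t \<Zsemi> (M.ev u \<Zsemi> \<alpha> p)) (M.ev t \<Zsemi> (\<alpha> n \<Zsemi> M'.ev u))"
      using typed_Seq by (intro M.parallel_leq_cmp_right) simp_all
    also have "M.ev t \<Zsemi> (\<alpha> n \<Zsemi> M'.ev u) = (M.ev t \<Zsemi> \<alpha> n) \<Zsemi> M'.ev u"
      using typed_Seq by (simp add: M.arr_cmp_assoc)
    also have "M.parallel_leq ((M.ev t \<Zsemi> \<alpha> n) \<Zsemi> M'.ev u) ((\<alpha> m \<Zsemi> M'.ev t) \<Zsemi> M'.ev u)"
      using typed_Seq by (intro M.parallel_leq_cmp_left) simp_all
    also have "(\<alpha> m \<Zsemi> M'.ev t) \<Zsemi> M'.ev u = \<alpha> m \<Zsemi> M'.ev (t ;; u)"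
      using typed_Seq by (simp add: M.arr_cmp_assoc)
    finally show ?case .
  next
    case (typed_Par t m n u p q)
    then have "M.parallel_leq ((M.ev t \<Zsemi> \<alpha> n) \<oplus> (M.ev u \<Zsemi> \<alpha> q))
        ((\<alpha> m \<Zsemi> M'.ev t) \<oplus> (\<alpha> p \<Zsemi> M'.ev u))"
      by (intro M.parallel_leq_tensor)
    with typed_Par show ?case
      by (simp add: add M.tensor_cmp)
  next
    case typed_Sym11
    then show ?case
      by (simp add: two M.arr_symm_natural)
  qed (simp_all add: zero)
qed

section \<open>The translations between the two kinds of models\<close>

locale models = cartesian_bicategory C + cartesian_theory_locale S E
  for C :: "('o, 'a) cbicat" (structure) and S :: "'s signature" and E
begin

text \<open>Only the operations are read off from \<open>G\<close>. The four structural generators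
  receive the structure of \<open>C\<close> at the image of 1; \<open>car_model_gens\<close> shows
  that for \<open>Copy\<close> and \<open>Discard\<close> this agrees with \<open>G\<close>.\<close>

definition car_gens :: "(nat, 's gen prop_arrow, 'o, 'a) func \<Rightarrow> 's gen \<Rightarrow> 'a" where
  "car_gens G c = (case c of
      Op b \<Rightarrow> amap G (term_arrow eqL (arity S b) (Gen (Op b)) 1)
    | Copy \<Rightarrow> copy C (omap G (Suc 0)) | Discard \<Rightarrow> discard C (omap G (Suc 0))
    | Merge \<Rightarrow> merge C (omap G (Suc 0)) | Create \<Rightarrow> create C (omap G (Suc 0)))"

definition frob_gens :: "(nat, 's gen prop_arrow, 'o, 'a) func \<Rightarrow> 's gen \<Rightarrow> 'a" where
  "frob_gens F c = amap F (term_arrow eqF (arity sigF c) (Gen c) (coarity sigF c))"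

text \<open>
  Precomposition of a Frobenius model with the evident functor from the cartesian to the Frobenius
  prop, expressed through its values on generators so that both translations have the same form.
\<close>

definition to_car where
  "to_car F = eval_functor C sigL eqL (omap F) (frob_gens F)"

definition to_frob where
  "to_frob G = eval_functor C sigF eqF (omap G) (car_gens G)"

abbreviation car_model where "car_model \<equiv> product_preserving_functor L.Q (Map C)"
abbreviation frob_model where "frob_model \<equiv> cartesian_bifunctor Fr C"

lemma smc_Map: "symmetric_strict_monoidal_category (Map C)"
  using cartesian_smc_Map[OF cartesian_bicategory_axioms]
  by (simp add: cartesian_smc_def counital_smc_def)

text \<open>In \<open>Map C\<close> the unit object is terminal, which fixes the image of
  \<open>Discard\<close>; the counit laws, preserved by \<open>G\<close>, then fix that of
  \<open>Copy\<close> by \<open>d_unique\<close>.\<close>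

lemma car_model_gens:
  assumes G: "car_model G" and c: "c \<in> gens sigL"
  shows "car_gens G c = amap G (term_arrow eqL (arity sigL c) (Gen c) (coarity sigL c))"
proof -
  interpret Map: cartesian_smc "Map C" "copy C" "discard C"
    by (rule cartesian_smc_Map) (rule cartesian_bicategory_axioms)
  let ?g = "\<lambda>c. amap G (term_arrow eqL (arity sigL c) (Gen c) (coarity sigL c))"
  have G': "symmetric_strict_monoidal_functor L.Q (Map C) G"
    using G by (simp add: product_preserving_functor_def)
  interpret M: term_model "Map C" sigL "omap G" ?g
    by (rule L.functor_eval_term(1)[OF smc_Map G']) simp
  have ev: "amap G (term_arrow eqL m t n) = M.ev t" if "typed sigL t m n" for m t n
    by (rule L.functor_eval_term(2)[OF smc_Map G' _ that]) simp
  have ev_eq: "M.ev t = M.ev u" if "(t, u) \<in> axL" "typed sigL t m n" "typed sigL u m n" for t u m n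
    using L.tarr_eqI[OF prop_eq_ax[OF that(1)]] ev[OF that(2)] ev[OF that(3)] by simp
  have Discard: "?g Discard = discard C (omap G (Suc 0))"
    using M.ev_hom[of "Gen Discard" 1 0] Map.e_unique M.ob_0 by (simp add: typed_iff)
  have "?g Copy = copy C (omap G (Suc 0))"
  proof (rule Map.d_unique)
    show "?g Copy \<in> hom (Map C) (omap G (Suc 0)) (omap G (Suc 0) \<odot>\<^bsub>Map C\<^esub> omap G (Suc 0))"
      using M.ev_hom[of "Gen Copy" 1 2] M.ob_2 by (simp add: typed_iff)
    show "?g Copy \<Zsemi>\<^bsub>Map C\<^esub> (discard C (omap G (Suc 0)) \<oplus>\<^bsub>Map C\<^esub> ident (Map C) (omap G (Suc 0))) =
        ident (Map C) (omap G (Suc 0))"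
      using ev_eq[of "Gen Copy ;; (Gen Discard \<parallel> Id1)" Id1 1 1] Discard
      by (simp add: comonoid_laws_def typed_iff)
    show "?g Copy \<Zsemi>\<^bsub>Map C\<^esub> (ident (Map C) (omap G (Suc 0)) \<oplus>\<^bsub>Map C\<^esub> discard C (omap G (Suc 0))) =
        ident (Map C) (omap G (Suc 0))"
      using ev_eq[of "Gen Copy ;; (Id1 \<parallel> Gen Discard)" Id1 1 1] Discard
      by (simp add: comonoid_laws_def typed_iff)
  qed
  with Discard c show ?thesis
    by (auto simp: car_gens_def coarity_1)
qed

lemma car_model_eval:
  assumes G: "car_model G"
  shows "frobenius_term_model C S E (omap G) (car_gens G)"
    and "typed sigL t m n \<Longrightarrow>
      amap G (term_arrow eqL m t n) = eval_term C (omap G (Suc 0)) (car_gens G) t"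
proof -
  have G': "symmetric_strict_monoidal_functor L.Q (Map C) G"
    using G by (simp add: product_preserving_functor_def)
  note ev = L.functor_eval_term[OF smc_Map G' car_model_gens[OF G]]
  show eval: "amap G (term_arrow eqL m t n) = eval_term C (omap G (Suc 0)) (car_gens G) t"
    if "typed sigL t m n" for t m n
    using ev(2)[OF _ that] by (simp add: eval_term_Map)
  interpret M: term_model "Map C" sigL "omap G" "car_gens G"
    by (rule ev)
  show "frobenius_term_model C S E (omap G) (car_gens G)"
  proof
    show "omap G n \<in> obj C" "omap G 0 = unit_obj C" "omap G (k + n) = omap G k \<odot> omap G n" for k n
      using M.ob_obj M.ob_0 M.ob_add by simp_all
    then have ob: "omap G n \<in> obj C" "omap G 0 = unit_obj C"
      "omap G (Suc (Suc 0)) = omap G (Suc 0) \<odot> omap G (Suc 0)" for n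
      using M.ob_2 by (simp_all add: numeral_2_eq_2)
    show "car_gens G c \<in> hom C (omap G (arity sigF c)) (omap G (coarity sigF c))"
      if c: "c \<in> gens sigF" for c
    proof -
      consider b where "c = Op b" "b \<in> gens S" | "c = Copy" | "c = Discard" | "c = Merge" | "c = Create"
        using c by auto
      then show ?thesis
      proof cases
        case 1
        then show ?thesis using M.gen_hom[of c] by (simp add: hom_Map)
      qed (use ob in \<open>simp_all add: car_gens_def hom_iff numeral_2_eq_2\<close>)
    qed
    show "is_map C (car_gens G (Op c))" if "c \<in> gens S" for c
      using that M.gen_hom[of "Op c"] by (simp add: hom_Map)
    show "eval_term C (omap G (Suc 0)) (car_gens G) t = eval_term C (omap G (Suc 0)) (car_gens G) u"
      if tu: "(t, u) \<in> E" for t u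
    proof -
      obtain n where "typed sigL t n 1" "typed sigL u n 1"
        using E_typed[OF tu] by blast
      then show ?thesis
        using L.tarr_eqI[OF prop_eq_ax, of t u n 1] tu by (simp flip: eval)
    qed
  qed (simp_all add: car_gens_def)
qed

text \<open>A cartesian bifunctor is required to preserve copy and discard. Merge and create follow,
  since monotonicity turns the inequations of \<open>CW_laws\<close> into adjunctions in
  \<open>C\<close>.\<close>

lemma frob_model_eval:
  assumes F: "frob_model F"
  shows "frobenius_term_model C S E (omap F) (frob_gens F)"
    and "typed sigF t m n \<Longrightarrow>
      amap F (term_arrow eqF m t n) = eval_term C (omap F (Suc 0)) (frob_gens F) t"
proof -
  have F': "symmetric_strict_monoidal_functor F.Q C F"
    using F by (simp add: cartesian_bifunctor_def strict_monoidal_functor_Fr)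
  note ev = F.functor_eval_term[OF symmetric_strict_monoidal_category_axioms F' frob_gens_def]
  interpret M: term_model C sigF "omap F" "frob_gens F"
    by (rule ev)
  show eval: "amap F (term_arrow eqF m t n) = M.ev t" if "typed sigF t m n" for t m n
    using ev(2)[OF that] .
  have ev_eq: "M.ev t = M.ev u" if tu: "eqF t u" for t u
  proof -
    obtain m n where "typed sigF t m n" "typed sigF u m n"
      using F.R_typed[OF tu] by blast
    then show ?thesis
      using F.tarr_eqI[OF tu, of m n] eval[of t m n] eval[of u m n] by simp
  qed
  have ev_leq: "M.ev t \<preceq> M.ev u" if tu: "(t, u) \<in> axF" for t u
  proof -
    obtain m n where t: "typed sigF t m n" and u: "typed sigF u m n"
      using axF_typed[OF tu] by blast
    have "leq Fr (term_arrow eqF m t n) (term_arrow eqF m u n)"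
      using F.R_refl[OF t] F.R_refl[OF u] prop_le_ax[of t u axF sigF] tu by (auto simp: leq_Fr)
    then have "amap F (term_arrow eqF m t n) \<sqsubseteq> amap F (term_arrow eqF m u n)"
      using F F.tarr_hom[OF t] F.tarr_hom[OF u] by (simp add: cartesian_bifunctor_def)
    then show ?thesis
      using parallel_leq_hom[OF M.ev_hom[OF t] M.ev_hom[OF u]] by (simp add: eval t u)
  qed
  have copyt: "M.ev (copyt n) = copy C (omap F n)"
    and discardt: "M.ev (discardt n) = discard C (omap F n)" for n
    using F eval[of "copyt n" n "n + n"] eval[of "discardt n" n 0]
    by (simp_all add: cartesian_bifunctor_def typed_iff)
  have Copy: "frob_gens F Copy = copy C (omap F (Suc 0))"
    using ev_eq[OF eqF_copyt_1] copyt[of 1] by simp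
  have Discard: "frob_gens F Discard = discard C (omap F (Suc 0))"
    using ev_eq[OF eqF_discardt_1] discardt[of 1] by simp
  have ob1: "omap F (Suc 0) \<in> obj C"
    by simp
  show "frobenius_term_model C S E (omap F) (frob_gens F)"
  proof
    show "frob_gens F Copy = copy C (omap F (Suc 0))" "frob_gens F Discard = discard C (omap F (Suc 0))"
      by fact+
    have hom: "frob_gens F Merge \<in> hom C (omap F (Suc 0) \<odot> omap F (Suc 0)) (omap F (Suc 0))"
      "frob_gens F Create \<in> hom C (unit_obj C) (omap F (Suc 0))"
      using M.gen_hom[of Merge] M.gen_hom[of Create] by (simp_all add: M.ob_0 M.ob_2)
    \<comment> \<open>Counit and unit of the two adjunctions: the images of \<open>Merge\<close> and
      \<open>Create\<close> are right adjoint to copy and discard, just as \<open>merge\<close> and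
      \<open>create\<close> are.\<close>
    have "(Gen Merge ;; Gen Copy, idt 2) \<in> axF" "(Id1, Gen Copy ;; Gen Merge) \<in> axF"
      "(Gen Create ;; Gen Discard, Id0) \<in> axF" "(Id1, Gen Discard ;; Gen Create) \<in> axF"
      by (simp_all add: CW_laws_def)
    from this[THEN ev_leq]
    have "frob_gens F Merge \<Zsemi> copy C (omap F (Suc 0)) \<preceq> ident C (omap F (Suc 0) \<odot> omap F (Suc 0))"
      "ident C (omap F (Suc 0)) \<preceq> copy C (omap F (Suc 0)) \<Zsemi> frob_gens F Merge"
      "frob_gens F Create \<Zsemi> discard C (omap F (Suc 0)) \<preceq> ident C (unit_obj C)"
      "ident C (omap F (Suc 0)) \<preceq> discard C (omap F (Suc 0)) \<Zsemi> frob_gens F Create"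
      using M.ev_idt[of 2] by (simp_all add: Copy Discard M.ob_2)
    then show "frob_gens F Merge = merge C (omap F (Suc 0))"
      "frob_gens F Create = create C (omap F (Suc 0))"
      using arr_merge_copy[OF ob1] arr_copy_merge[OF ob1] arr_create_discard[OF ob1]
        arr_discard_create[OF ob1] hom merge_hom[OF ob1] create_hom[OF ob1]
      by (auto intro!: parallel_leq_antisym
          intro: right_adjoint_leq[OF copy_hom[OF ob1]] right_adjoint_leq[OF discard_hom[OF ob1]])
    show "is_map C (frob_gens F (Op c))" if c: "c \<in> gens S" for c
    proof -
      \<comment> \<open>These equations pass to the Frobenius prop by \<open>eqL_imp_eqF\<close>,
        and their images are the two conditions for a map.\<close>
      have "(Gen (Op c) ;; Gen Copy, copyt (arity S c) ;; (Gen (Op c) \<parallel> Gen (Op c))) \<in> axL"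
        "(Gen (Op c) ;; Gen Discard, discardt (arity S c)) \<in> axL"
        using c by (auto simp: naturality_laws_def)
      from this[THEN prop_eq_ax, THEN eqL_imp_eqF, THEN ev_eq] show ?thesis
        using is_map_iff[OF M.gen_hom[of "Op c"]] c
        by (simp add: Copy Discard copyt discardt coarity_1)
    qed
    show "M.ev t = M.ev u" if "(t, u) \<in> E" for t u
      using that by (intro ev_eq eqL_imp_eqF prop_eq_ax) simp
  qed
qed

lemma to_car_model:
  assumes "frob_model F"
  shows "car_model (to_car F)"
    and "typed sigL t m n \<Longrightarrow> amap (to_car F) (term_arrow eqL m t n) =
      amap F (term_arrow eqF m t n)"
  using eval_functor_L[OF frob_model_eval(1)[OF assms]] frob_model_eval(2)[OF assms]
    typed_sigL_sigF
  by (simp_all add: to_car_def cartesian_prop_eq)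

lemma to_frob_model:
  assumes "car_model G"
  shows "frob_model (to_frob G)"
    and "typed sigF t m n \<Longrightarrow> amap (to_frob G) (term_arrow eqF m t n) =
      eval_term C (omap G (Suc 0)) (car_gens G) t"
proof -
  interpret frobenius_term_model C S E "omap G" "car_gens G"
    by (rule car_model_eval[OF assms])
  show "frob_model (to_frob G)"
    and "typed sigF t m n \<Longrightarrow> amap (to_frob G) (term_arrow eqF m t n) = ev t"
    unfolding to_frob_def by (rule eval_functor_F, assumption?)+
qed

lemma omap_to_car [simp]: "omap (to_car F) = omap F"
  and omap_to_frob [simp]: "omap (to_frob F) = omap F"
  by (simp_all add: to_car_def to_frob_def)

text \<open>Both functors are evaluations, so agreement on generators suffices; on the structural
  ones it is the content of \<open>frob_model_eval\<close>.\<close>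

lemma to_frob_to_car:
  assumes F: "frob_model F"
  shows "to_frob (to_car F) = F"
proof (rule func_eqI[of _ _ "arr F.Q"])
  interpret M: frobenius_term_model C S E "omap F" "frob_gens F"
    by (rule frob_model_eval[OF F])
  note car = to_car_model[OF F] and frob = to_frob_model[OF to_car_model(1)[OF F]]
  show "amap (to_frob (to_car F)) \<in> extensional (arr F.Q)" "amap F \<in> extensional (arr F.Q)"
    using F frob(1) unfolding cartesian_bifunctor_def symmetric_strict_monoidal_functor_def
      is_functor_def Fr_simps by blast+
  have gens: "car_gens (to_car F) c = amap F (term_arrow eqF (arity sigF c) (Gen c) (coarity sigF c))"
    if "c \<in> gens sigF" for c
  proof -
    have "typed sigL (Gen (Op b)) (arity S b) 1" if "b \<in> gens S" for b
      using that by (simp add: typed_iff coarity_1)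
    then show ?thesis
      using that M.g_Copy M.g_Discard M.g_Merge M.g_Create car(2)
      by (auto simp: car_gens_def frob_gens_def coarity_1)
  qed
  show "amap (to_frob (to_car F)) f = amap F f" if "f \<in> arr F.Q" for f
    using that
  proof (rule F.arr_Q_cases)
    fix m t n assume t: "typed sigF t m n" "f = term_arrow eqF m t n"
    have F': "symmetric_strict_monoidal_functor F.Q C F"
      using F by (simp add: cartesian_bifunctor_def strict_monoidal_functor_Fr)
    show ?thesis
      using F.functor_eval_term(2)[OF symmetric_strict_monoidal_category_axioms F' gens t(1)]
      by (simp add: t(2) frob(2)[OF t(1)])
  qed
qed simp

lemma to_car_to_frob:
  assumes G: "car_model G"
  shows "to_car (to_frob G) = G"
proof (rule func_eqI[of _ _ "arr L.Q"])
  note frob = to_frob_model[OF G] and car = to_car_model[OF to_frob_model(1)[OF G]]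
  show "amap (to_car (to_frob G)) \<in> extensional (arr L.Q)" "amap G \<in> extensional (arr L.Q)"
    using G car(1) unfolding product_preserving_functor_def symmetric_strict_monoidal_functor_def
      is_functor_def by blast+
  show "amap (to_car (to_frob G)) f = amap G f" if "f \<in> arr L.Q" for f
    using that
  proof (rule L.arr_Q_cases)
    fix m t n assume t: "typed sigL t m n" "f = term_arrow eqL m t n"
    show ?thesis
      using car(2)[OF t(1)] frob(2)[OF typed_sigL_sigF[OF t(1)]] car_model_eval(2)[OF G t(1)]
      by (simp add: t(2))
  qed
qed simp

lemma lax_natural_iff_natural:
  assumes F: "frob_model F" and G: "frob_model G"
  shows "monoidal_lax_natural Fr C F \<alpha> G \<longleftrightarrow>
    monoidal_natural L.Q (Map C) (to_car F) \<alpha> (to_car G)"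
proof
  note F_eval = frob_model_eval[OF F] and G_eval = frob_model_eval[OF G]
  note F_car = to_car_model[OF F] and G_car = to_car_model[OF G]
  interpret MF: frobenius_term_model C S E "omap F" "frob_gens F" by (rule F_eval)
  interpret MG: frobenius_term_model C S E "omap G" "frob_gens G" by (rule G_eval)
  { assume lax: "monoidal_lax_natural Fr C F \<alpha> G"
    then have ext: "\<alpha> \<in> extensional UNIV" and hom: "\<alpha> n \<in> hom C (omap F n) (omap G n)"
      and add: "\<alpha> (m + n) = \<alpha> m \<oplus> \<alpha> n" and zero: "\<alpha> 0 = ident C (unit_obj C)"
      and natural: "f \<in> hom F.Q m n \<Longrightarrow> amap F f \<Zsemi> \<alpha> n \<sqsubseteq> \<alpha> m \<Zsemi> amap G f" for m n f
      by (simp_all add: monoidal_lax_natural_def monoidal_family_def)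
    note [simp] = hom[unfolded hom_iff]
    have le: "MF.ev t \<Zsemi> \<alpha> n \<preceq> \<alpha> m \<Zsemi> MG.ev t" if t: "typed sigF t m n" for t m n
      using natural[OF F.tarr_hom[OF t]] t by (simp add: F_eval(2) G_eval(2) parallel_leq_def)
    have map: "is_map C (\<alpha> n)" for n
    \<comment> \<open>Since the component at \<open>n + n\<close> is
      \<open>\<alpha> n \<oplus> \<alpha> n\<close> and the one at 0 is an identity, laxness at
      \<open>copyt n\<close> and \<open>discardt n\<close> is precisely the missing half of each map
      condition.\<close>
    proof (rule is_mapI[OF hom])
      show "copy C (omap F n) \<Zsemi> (\<alpha> n \<oplus> \<alpha> n) \<preceq> \<alpha> n \<Zsemi> copy C (omap G n)"
        using le[of "copyt n" n "n + n"] by (simp add: MF.ev_copyt MG.ev_copyt add typed_iff)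
      show "discard C (omap F n) \<preceq> \<alpha> n \<Zsemi> discard C (omap G n)"
        using le[of "discardt n" n 0] by (simp add: MF.ev_discardt MG.ev_discardt zero typed_iff)
    qed
    have "amap (to_car F) f \<Zsemi> \<alpha> n = \<alpha> m \<Zsemi> amap (to_car G) f" if "f \<in> hom L.Q m n" for m n f
      using that
    proof (rule L.hom_Q_cases)
      fix t assume t: "typed sigL t m n" "f = term_arrow eqL m t n"
      note t' = typed_sigL_sigF[OF t(1)]
      have "MF.ev t \<Zsemi> \<alpha> n = \<alpha> m \<Zsemi> MG.ev t"
        by (rule map_leq_eq[OF cmp_hom[OF MF.ev_hom[OF t'] hom]
              is_map_cmp[OF MF.ev_hom[OF t'] MF.ev_is_map[OF t(1)] hom map]
              cmp_hom[OF hom MG.ev_hom[OF t']]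
              is_map_cmp[OF hom map MG.ev_hom[OF t'] MG.ev_is_map[OF t(1)]] le[OF t']])
      then show ?thesis
        using t t' by (simp add: F_car(2) G_car(2) F_eval(2) G_eval(2))
    qed
    then show "monoidal_natural L.Q (Map C) (to_car F) \<alpha> (to_car G)"
      using ext hom add zero map
      by (simp add: monoidal_natural_def monoidal_family_def hom_Map) }
  { assume nat: "monoidal_natural L.Q (Map C) (to_car F) \<alpha> (to_car G)"
    then have ext: "\<alpha> \<in> extensional UNIV" and hom: "\<alpha> n \<in> hom C (omap F n) (omap G n)"
      and map: "is_map C (\<alpha> n)"
      and add: "\<alpha> (m + n) = \<alpha> m \<oplus> \<alpha> n" and zero: "\<alpha> 0 = ident C (unit_obj C)"
      and natural: "f \<in> hom L.Q m n \<Longrightarrow> amap (to_car F) f \<Zsemi> \<alpha> n = \<alpha> m \<Zsemi> amap (to_car G) f"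
      for m n f
      by (simp_all add: monoidal_natural_def monoidal_family_def hom_Map)
    have "frob_gens F (Op c) \<Zsemi> \<alpha> (Suc 0) = \<alpha> (arity S c) \<Zsemi> frob_gens G (Op c)"
      if "c \<in> gens S" for c
    proof -
      have t: "typed sigL (Gen (Op c)) (arity S c) (Suc 0)"
        using that by (simp add: typed_iff coarity_1)
      show ?thesis
        using natural[OF L.tarr_hom[OF t]] typed_sigL_sigF[OF t]
        by (simp add: F_car(2)[OF t] G_car(2)[OF t] F_eval(2) G_eval(2))
    qed
    note lax = lax_natural_on_terms[OF F_eval(1) G_eval(1) hom map add zero this]
    have "amap F f \<Zsemi> \<alpha> n \<sqsubseteq> \<alpha> m \<Zsemi> amap G f" if "f \<in> hom F.Q m n" for m n f
      using that
    proof (rule F.hom_Q_cases)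
      fix t assume t: "typed sigF t m n" "f = term_arrow eqF m t n"
      show ?thesis
        using parallel_leqD(5)[OF lax[OF _ t(1)]] t by (simp add: F_eval(2) G_eval(2))
    qed
    then show "monoidal_lax_natural Fr C F \<alpha> G"
      using ext hom add zero by (simp add: monoidal_lax_natural_def monoidal_family_def) }
qed

end


section \<open>Categories of models\<close>

lemma functor_category_simps [simp]:
  "obj (functor_category C D P N) = {F. P F}"
  "arr (functor_category C D P N) = {(F, \<alpha>, G). P F \<and> P G \<and> N F \<alpha> G}"
  "src (functor_category C D P N) (F, \<alpha>, G) = F"
  "tgt (functor_category C D P N) (F, \<alpha>, G) = G"
  "ident (functor_category C D P N) F = (F, \<lambda>x\<in>obj C. ident D (omap F x), F)"
  "(F, \<alpha>, G) \<Zsemi>\<^bsub>functor_category C D P N\<^esub> (G', \<beta>, H) = (F, \<lambda>x\<in>obj C. \<alpha> x \<Zsemi>\<^bsub>D\<^esub> \<beta> x, H)"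
  by (simp_all add: functor_category_def)

lemma hom_functor_category:
  "f \<in> hom (functor_category C D P N) F G \<longleftrightarrow> (\<exists>\<alpha>. f = (F, \<alpha>, G) \<and> P F \<and> P G \<and> N F \<alpha> G)"
  by (cases f) (auto simp: hom_iff)

text \<open>Left abstract in \<open>P\<close> and \<open>N\<close> so that natural and lax natural
  families share one argument.\<close>

lemma category_functor_category:
  assumes "category D"
    and is_functor: "\<And>F. P F \<Longrightarrow> is_functor C D F"
    and ext: "\<And>F \<alpha> G. N F \<alpha> G \<Longrightarrow> \<alpha> \<in> extensional (obj C)"
    and hom: "\<And>F \<alpha> G x. N F \<alpha> G \<Longrightarrow> x \<in> obj C \<Longrightarrow> \<alpha> x \<in> hom D (omap F x) (omap G x)"
    and N_ident: "\<And>F. P F \<Longrightarrow> N F (\<lambda>x\<in>obj C. ident D (omap F x)) F"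
    and N_cmp: "\<And>F \<alpha> G \<beta> H. P F \<Longrightarrow> P G \<Longrightarrow> P H \<Longrightarrow> N F \<alpha> G \<Longrightarrow> N G \<beta> H \<Longrightarrow>
      N F (\<lambda>x\<in>obj C. \<alpha> x \<Zsemi>\<^bsub>D\<^esub> \<beta> x) H"
  shows "category (functor_category C D P N)"
proof -
  interpret D: category D by fact
  show ?thesis
  proof
    fix F G H K f g h
    show "f \<in> arr (functor_category C D P N) \<Longrightarrow>
        src (functor_category C D P N) f \<in> obj (functor_category C D P N)"
      and "f \<in> arr (functor_category C D P N) \<Longrightarrow>
        tgt (functor_category C D P N) f \<in> obj (functor_category C D P N)"
      by auto
    show "F \<in> obj (functor_category C D P N) \<Longrightarrow> ident (functor_category C D P N) F
        \<in> hom (functor_category C D P N) F F"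
      by (simp add: hom_functor_category N_ident)
    show "f \<in> hom (functor_category C D P N) F G \<Longrightarrow> g \<in> hom (functor_category C D P N) G H \<Longrightarrow>
        f \<Zsemi>\<^bsub>functor_category C D P N\<^esub> g \<in> hom (functor_category C D P N) F H"
      by (auto simp: hom_functor_category intro: N_cmp)
    show "f \<in> hom (functor_category C D P N) F G \<Longrightarrow> g \<in> hom (functor_category C D P N) G H \<Longrightarrow>
        h \<in> hom (functor_category C D P N) H K \<Longrightarrow>
        f \<Zsemi>\<^bsub>functor_category C D P N\<^esub> g \<Zsemi>\<^bsub>functor_category C D P N\<^esub> h =
        f \<Zsemi>\<^bsub>functor_category C D P N\<^esub> (g \<Zsemi>\<^bsub>functor_category C D P N\<^esub> h)"
      by (auto simp: hom_functor_category restrict_def fun_eq_iff D.cmp_assoc[OF hom hom hom])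
    show "ident (functor_category C D P N) F \<Zsemi>\<^bsub>functor_category C D P N\<^esub> f = f"
      "f \<Zsemi>\<^bsub>functor_category C D P N\<^esub> ident (functor_category C D P N) G = f"
      if f: "f \<in> hom (functor_category C D P N) F G"
    proof -
      obtain \<alpha> where \<alpha>: "f = (F, \<alpha>, G)" "N F \<alpha> G"
        using f by (auto simp: hom_functor_category)
      then show "ident (functor_category C D P N) F \<Zsemi>\<^bsub>functor_category C D P N\<^esub> f = f"
        "f \<Zsemi>\<^bsub>functor_category C D P N\<^esub> ident (functor_category C D P N) G = f"
        using ext[OF \<alpha>(2)] D.ident_cmp[OF hom[OF \<alpha>(2)]] D.cmp_ident[OF hom[OF \<alpha>(2)]]
        by (auto intro: extensionalityI[of _ "obj C"])
    qed
  qed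
qed

lemma monoidal_family_ident:
  assumes "symmetric_strict_monoidal_category D" "symmetric_strict_monoidal_functor C D F"
    and "obj C = UNIV"
  shows "monoidal_family C D F (\<lambda>x\<in>obj C. ident D (omap F x)) F"
proof -
  interpret D: symmetric_strict_monoidal_category D by fact
  show ?thesis
    using strict_monoidal_functorD[OF assms(2)] assms(3)
    by (simp add: monoidal_family_def D.ident_hom)
qed

lemma monoidal_family_cmp:
  assumes "symmetric_strict_monoidal_category D" "obj C = UNIV"
    and \<alpha>: "monoidal_family C D F \<alpha> G" and \<beta>: "monoidal_family C D G \<beta> H"
  shows "monoidal_family C D F (\<lambda>x\<in>obj C. \<alpha> x \<Zsemi>\<^bsub>D\<^esub> \<beta> x) H"
proof -
  interpret D: symmetric_strict_monoidal_category D by fact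
  have hom: "\<alpha> x \<in> hom D (omap F x) (omap G x)" "\<beta> x \<in> hom D (omap G x) (omap H x)" for x
    using \<alpha> \<beta> assms(2) by (simp_all add: monoidal_family_def)
  show ?thesis
    using \<alpha> \<beta> assms(2) D.cmp_hom[OF hom] D.interchange[OF hom hom]
    by (simp add: monoidal_family_def)
qed

lemma category_Mod_CAR:
  assumes D: "symmetric_strict_monoidal_category D" and cat: "category (cartesian_prop T)"
    and UNIV: "obj (cartesian_prop T) = UNIV"
  shows "category (Mod_CAR T D)"
  unfolding Mod_CAR_def
proof (rule category_functor_category)
  interpret D: symmetric_strict_monoidal_category D by fact
  interpret L: category "cartesian_prop T" by fact
  let ?L = "cartesian_prop T"
  show "category D"
    by unfold_locales
  show "is_functor ?L D F" if "product_preserving_functor ?L D F" for F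
    using that by (simp add: product_preserving_functor_def symmetric_strict_monoidal_functor_def)
  show "\<alpha> \<in> extensional (obj ?L)" "x \<in> obj ?L \<Longrightarrow> \<alpha> x \<in> hom D (omap F x) (omap G x)"
    if "monoidal_natural ?L D F \<alpha> G" for F \<alpha> G x
    using that by (simp_all add: monoidal_natural_def monoidal_family_def)
  show "monoidal_natural ?L D F (\<lambda>x\<in>obj ?L. ident D (omap F x)) F"
    if "product_preserving_functor ?L D F" for F
  proof -
    have F: "symmetric_strict_monoidal_functor ?L D F"
      using that by (simp add: product_preserving_functor_def)
    show ?thesis
      using monoidal_family_ident[OF D F UNIV] D.ident_cmp[OF strict_monoidal_functorD(2)[OF F]]
        D.cmp_ident[OF strict_monoidal_functorD(2)[OF F]]
      by (simp add: monoidal_natural_def UNIV)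
  qed
  show "monoidal_natural ?L D F (\<lambda>x\<in>obj ?L. \<alpha> x \<Zsemi>\<^bsub>D\<^esub> \<beta> x) H"
    if P: "product_preserving_functor ?L D F" "product_preserving_functor ?L D G"
      "product_preserving_functor ?L D H"
      and \<alpha>: "monoidal_natural ?L D F \<alpha> G" and \<beta>: "monoidal_natural ?L D G \<beta> H" for F \<alpha> G \<beta> H
  proof -
    have hom: "\<alpha> x \<in> hom D (omap F x) (omap G x)" "\<beta> x \<in> hom D (omap G x) (omap H x)" for x
      using \<alpha> \<beta> UNIV by (simp_all add: monoidal_natural_def monoidal_family_def)
    have "amap F f \<Zsemi>\<^bsub>D\<^esub> (\<alpha> y \<Zsemi>\<^bsub>D\<^esub> \<beta> y) = \<alpha> x \<Zsemi>\<^bsub>D\<^esub> \<beta> x \<Zsemi>\<^bsub>D\<^esub> amap H f"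
      if f: "f \<in> hom ?L x y" for x y f
    proof -
      have F: "amap F f \<in> hom D (omap F x) (omap F y)" "amap G f \<in> hom D (omap G x) (omap G y)"
        "amap H f \<in> hom D (omap H x) (omap H y)"
        using P by (auto simp: product_preserving_functor_def intro!: strict_monoidal_functorD(2) f)
      have "amap F f \<Zsemi>\<^bsub>D\<^esub> \<alpha> y = \<alpha> x \<Zsemi>\<^bsub>D\<^esub> amap G f" "amap G f \<Zsemi>\<^bsub>D\<^esub> \<beta> y = \<beta> x \<Zsemi>\<^bsub>D\<^esub> amap H f"
        using \<alpha> \<beta> f by (auto simp: monoidal_natural_def)
      then show ?thesis
        using D.cmp_assoc[OF F(1) hom] D.cmp_assoc[OF hom(1) F(2) hom(2)] D.cmp_assoc[OF hom F(3)]
        by simp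
    qed
    then show ?thesis
      using \<alpha> \<beta> monoidal_family_cmp[OF D UNIV, of F \<alpha> G \<beta> H] by (simp add: monoidal_natural_def UNIV)
  qed
qed

lemma category_Mod_FROB:
  assumes "cartesian_bicategory C" and UNIV: "obj (frobenius_prop T) = UNIV"
  shows "category (Mod_FROB T C)"
  unfolding Mod_FROB_def
proof (rule category_functor_category)
  interpret C: cartesian_bicategory C by fact
  let ?F = "frobenius_prop T"
  have D: "symmetric_strict_monoidal_category C"
    by unfold_locales
  show "category C"
    by unfold_locales
  show "is_functor ?F C F" if "cartesian_bifunctor ?F C F" for F
    using that by (simp add: cartesian_bifunctor_def symmetric_strict_monoidal_functor_def)
  show "\<alpha> \<in> extensional (obj ?F)" "x \<in> obj ?F \<Longrightarrow> \<alpha> x \<in> hom C (omap F x) (omap G x)"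
    if "monoidal_lax_natural ?F C F \<alpha> G" for F \<alpha> G x
    using that by (simp_all add: monoidal_lax_natural_def monoidal_family_def)
  show "monoidal_lax_natural ?F C F (\<lambda>x\<in>obj ?F. ident C (omap F x)) F"
    if "cartesian_bifunctor ?F C F" for F
  proof -
    have F: "symmetric_strict_monoidal_functor ?F C F"
      using that by (simp add: cartesian_bifunctor_def)
    have "amap F f \<Zsemi>\<^bsub>C\<^esub> ident C (omap F y) \<sqsubseteq>\<^bsub>C\<^esub> ident C (omap F x) \<Zsemi>\<^bsub>C\<^esub> amap F f"
      if "f \<in> hom ?F x y" for x y f
      using strict_monoidal_functorD(2)[OF F that] C.leq_refl by (simp add: hom_iff)
    then show ?thesis
      using monoidal_family_ident[OF D F UNIV] by (simp add: monoidal_lax_natural_def UNIV)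
  qed
  show "monoidal_lax_natural ?F C F (\<lambda>x\<in>obj ?F. \<alpha> x \<Zsemi>\<^bsub>C\<^esub> \<beta> x) H"
    if P: "cartesian_bifunctor ?F C F" "cartesian_bifunctor ?F C G" "cartesian_bifunctor ?F C H"
      and \<alpha>: "monoidal_lax_natural ?F C F \<alpha> G" and \<beta>: "monoidal_lax_natural ?F C G \<beta> H"
    for F \<alpha> G \<beta> H
  proof -
    have hom: "\<alpha> x \<in> hom C (omap F x) (omap G x)" "\<beta> x \<in> hom C (omap G x) (omap H x)" for x
      using \<alpha> \<beta> UNIV by (simp_all add: monoidal_lax_natural_def monoidal_family_def)
    note [simp] = hom[unfolded hom_iff]
    have "amap F f \<Zsemi>\<^bsub>C\<^esub> (\<alpha> y \<Zsemi>\<^bsub>C\<^esub> \<beta> y) \<sqsubseteq>\<^bsub>C\<^esub> \<alpha> x \<Zsemi>\<^bsub>C\<^esub> \<beta> x \<Zsemi>\<^bsub>C\<^esub> amap H f"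
      if f: "f \<in> hom ?F x y" for x y f
    proof -
      have F: "amap F f \<in> hom C (omap F x) (omap F y)" "amap G f \<in> hom C (omap G x) (omap G y)"
        "amap H f \<in> hom C (omap H x) (omap H y)"
        using P by (auto simp: cartesian_bifunctor_def intro!: strict_monoidal_functorD(2) f)
      note [simp] = F[unfolded hom_iff]
      have le: "C.parallel_leq (amap F f \<Zsemi>\<^bsub>C\<^esub> \<alpha> y) (\<alpha> x \<Zsemi>\<^bsub>C\<^esub> amap G f)"
        "C.parallel_leq (amap G f \<Zsemi>\<^bsub>C\<^esub> \<beta> y) (\<beta> x \<Zsemi>\<^bsub>C\<^esub> amap H f)"
        using \<alpha> \<beta> f by (auto simp: monoidal_lax_natural_def C.parallel_leq_def)
      have "amap F f \<Zsemi>\<^bsub>C\<^esub> (\<alpha> y \<Zsemi>\<^bsub>C\<^esub> \<beta> y) = (amap F f \<Zsemi>\<^bsub>C\<^esub> \<alpha> y) \<Zsemi>\<^bsub>C\<^esub> \<beta> y"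
        by (simp add: C.arr_cmp_assoc)
      also have "C.parallel_leq \<dots> ((\<alpha> x \<Zsemi>\<^bsub>C\<^esub> amap G f) \<Zsemi>\<^bsub>C\<^esub> \<beta> y)"
        by (intro C.parallel_leq_cmp_left le) simp_all
      also have "(\<alpha> x \<Zsemi>\<^bsub>C\<^esub> amap G f) \<Zsemi>\<^bsub>C\<^esub> \<beta> y = \<alpha> x \<Zsemi>\<^bsub>C\<^esub> (amap G f \<Zsemi>\<^bsub>C\<^esub> \<beta> y)"
        by (simp add: C.arr_cmp_assoc)
      also have "C.parallel_leq \<dots> (\<alpha> x \<Zsemi>\<^bsub>C\<^esub> (\<beta> x \<Zsemi>\<^bsub>C\<^esub> amap H f))"
        by (intro C.parallel_leq_cmp_right le) simp_all
      finally show ?thesis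
        by (simp add: C.arr_cmp_assoc C.parallel_leq_def)
    qed
    then show ?thesis
      using \<alpha> \<beta> monoidal_family_cmp[OF D UNIV, of F \<alpha> G \<beta> H] by (simp add: monoidal_lax_natural_def UNIV)
  qed
qed

text \<open>The isomorphism leaves the families of arrows unchanged. This is possible because
  objects are preserved by \<open>omap\<close> and both targets have the same identities and
  composition, as \<open>C\<close> and \<open>Map C\<close> do.\<close>

lemma isomorphic_functor_categories:
  assumes cat: "category (functor_category C D P N)" "category (functor_category C' D' P' N')"
    and obj: "obj C = obj C'"
    and \<Phi>: "\<And>F. P F \<Longrightarrow> P' (\<Phi> F)" "\<And>F. P F \<Longrightarrow> \<Psi> (\<Phi> F) = F"
    and \<Psi>: "\<And>G. P' G \<Longrightarrow> P (\<Psi> G)" "\<And>G. P' G \<Longrightarrow> \<Phi> (\<Psi> G) = G"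
    and omap: "\<And>F. P F \<Longrightarrow> omap (\<Phi> F) = omap F"
    and N: "\<And>F G \<alpha>. P F \<Longrightarrow> P G \<Longrightarrow> N F \<alpha> G \<longleftrightarrow> N' (\<Phi> F) \<alpha> (\<Phi> G)"
    and ident: "ident D = ident D'" and cmp: "cmp D = cmp D'"
  shows "isomorphic_categories (functor_category C D P N) (functor_category C' D' P' N')"
proof -
  let ?A = "functor_category C D P N" and ?B = "functor_category C' D' P' N'"
  have omap': "omap (\<Psi> G) = omap G" if "P' G" for G
    using omap[OF \<Psi>(1)[OF that]] \<Psi>(2)[OF that] by simp
  have N': "N' F \<alpha> G \<longleftrightarrow> N (\<Psi> F) \<alpha> (\<Psi> G)" if "P' F" "P' G" for F G \<alpha>
    using N[of "\<Psi> F" "\<Psi> G" \<alpha>] \<Psi> that by simp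
  \<comment> \<open>An arrow is a family tagged with its source and target functors; only the tags
    are translated.\<close>
  define X where "X = \<lparr>omap = \<lambda>F\<in>obj ?A. \<Phi> F, amap = \<lambda>(F, \<alpha>, G)\<in>arr ?A. (\<Phi> F, \<alpha>, \<Phi> G)\<rparr>"
  define Y where "Y = \<lparr>omap = \<lambda>F\<in>obj ?B. \<Psi> F, amap = \<lambda>(F, \<alpha>, G)\<in>arr ?B. (\<Psi> F, \<alpha>, \<Psi> G)\<rparr>"
  have "is_functor ?A ?B X"
    unfolding is_functor_def
  proof (intro conjI ballI allI)
    show "amap X (f \<Zsemi>\<^bsub>?A\<^esub> g) = amap X f \<Zsemi>\<^bsub>?B\<^esub> amap X g"
      if fg: "f \<in> hom ?A F G" "g \<in> hom ?A G H" for f g F G H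
      using fg category.cmp_hom[OF cat(1) fg]
      by (auto simp: hom_functor_category X_def obj cmp)
    show "amap X (ident ?A F) = ident ?B (omap X F)" if "F \<in> obj ?A" for F
      using that category.ident_hom[OF cat(1) that]
      by (auto simp: hom_functor_category X_def obj ident omap)
  qed (auto simp: hom_functor_category X_def \<Phi> N)
  moreover have "is_functor ?B ?A Y"
    unfolding is_functor_def
  proof (intro conjI ballI allI)
    show "amap Y (f \<Zsemi>\<^bsub>?B\<^esub> g) = amap Y f \<Zsemi>\<^bsub>?A\<^esub> amap Y g"
      if fg: "f \<in> hom ?B F G" "g \<in> hom ?B G H" for f g F G H
      using fg category.cmp_hom[OF cat(2) fg]
      by (auto simp: hom_functor_category Y_def obj cmp)
    show "amap Y (ident ?B F) = ident ?A (omap Y F)" if "F \<in> obj ?B" for F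
      using that category.ident_hom[OF cat(2) that]
      by (auto simp: hom_functor_category Y_def obj ident omap')
  qed (auto simp: hom_functor_category Y_def \<Psi> N')
  moreover have "\<forall>x\<in>obj ?A. omap Y (omap X x) = x" "\<forall>y\<in>obj ?B. omap X (omap Y y) = y"
    by (simp_all add: X_def Y_def \<Phi> \<Psi>)
  moreover have "\<forall>f\<in>arr ?A. amap Y (amap X f) = f"
    by (auto simp: X_def Y_def \<Phi> \<Psi> N)
  moreover have "\<forall>g\<in>arr ?B. amap X (amap Y g) = g"
    by (auto simp: X_def Y_def \<Phi> \<Psi> N')
  ultimately show ?thesis
    using cat by (auto simp: isomorphic_categories_def)
qed

theorem theorem6p2:
  fixes T :: "'s monoidal_theory" and C :: "('o, 'a) cbicat"
  assumes "cartesian_theory T"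
    and "cartesian_bicategory C"
  shows "isomorphic_categories (Mod_FROB (frobenius_of_cartesian T) C) (Mod_CAR T (Map C))"
proof -
  obtain S E where T: "T = (S, E)"
    by (cases T)
  interpret models C S E
    using assms by (simp add: models_def cartesian_theory_locale_def T)
  have L: "category L.Q" "obj (cartesian_prop T) = UNIV"
    using L.symmetric_strict_monoidal_category_Q
    by (simp_all add: symmetric_strict_monoidal_category_def T cartesian_prop_eq)
  show ?thesis
    unfolding Mod_FROB_def Mod_CAR_def
  proof (rule isomorphic_functor_categories[where \<Phi> = to_car and \<Psi> = to_frob])
    show "category (functor_category (frobenius_prop (frobenius_of_cartesian T)) C
        (cartesian_bifunctor (frobenius_prop (frobenius_of_cartesian T)) C)
        (monoidal_lax_natural (frobenius_prop (frobenius_of_cartesian T)) C))"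
      using category_Mod_FROB[OF assms(2), of "frobenius_of_cartesian T"]
      by (simp add: T Mod_FROB_def)
    show "category (functor_category (cartesian_prop T) (Map C)
        (product_preserving_functor (cartesian_prop T) (Map C))
        (monoidal_natural (cartesian_prop T) (Map C)))"
      using category_Mod_CAR[OF smc_Map, of T] L by (simp add: T Mod_CAR_def cartesian_prop_eq)
  qed (simp_all add: T cartesian_prop_eq to_car_model to_frob_model to_frob_to_car to_car_to_frob
      lax_natural_iff_natural)
qed

end
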